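(* Let $\mathcal H\subseteq\operatorname{Lip}_{b,\mathsf d}(L,B)$ and assume that $U=U_0+\sum_{i=1}^KU_i$ satisfies condition (SGLD) with constants $\tilde L_U$ and $m_U$. Let $\xi\in\mathbb S_1(\mathsf X,\mathsf d)$ be the initial distribution. Fix any $\gamma\in\bigl(0,\tilde L_U^{-1}(K+1)^{-1}\bigr)$ and set $b_n=2\lceil\log(n)/\log(1/\Delta_1)\rceil$ with $\Delta_1=\sqrt{1-\gamma m_U}$. Then there exist constants $R_1(L,\xi),R_2(L,\xi)$, depending on $L$ and $\xi$ but not on $n,\varepsilon,\delta$, such that for any $\varepsilon>0$ and $\delta\in(0,1)$, with probability at least $1-\delta$, $$V_\infty^{(\mathsf{SGLD})}(\widehat h_{n,\varepsilon})-\inf_{h\in\mathcal H}V_\infty^{(\mathsf{SGLD})}(h)\lesssim C_4\,\varepsilon\log(n)+C_5\sqrt{\frac{\log^5(n)}{n}}\Bigl(\frac{|\mathcal H_\varepsilon|}{\delta}\Bigr)^{1/\log(n)}+C_6\,\frac{\log n}{n},$$ where $\lesssim$ is inequality up to an absolute constant and $$C_4=\frac{\sqrt R+\sqrt D}{m_U\gamma},\quad C_5=\frac{B^2R_1(L,\xi)}{(m_U\gamma)^2}+\frac{B^2R_2(L,\xi)}{(m_U\gamma)^{4+2/\log n}}+\frac{\sqrt{RD}}{m_U\gamma},\quad C_6=\frac{D(m_U\gamma)+\varsigma}{(m_U\gamma)^2},$$ with $D=\sup_{h\in\mathcal H}\operatorname{Var}_{\overline\pi}(h)$, $\varsigma=2LB\int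 W_1^{\mathsf d}(\delta_x,\overline\pi)\overline\pi(dx)$, and $$R=\frac{2B}{1-\Delta_1^{1/2}}\Bigl(2L\{W_1^{\mathsf d}(\xi,\overline\pi)\}^{1/2}\Bigl\{\int W_1^{\mathsf d}(\delta_x,\overline\pi)\overline\pi(dx)\Bigr\}^{1/2}+\{2LB\,W_1^{\mathsf d}(\xi,\overline\pi)\}^{1/2}\Bigr).$$
   Context: Condition (SGLD) on $U(\theta)=U_0(\theta)+\sum_{i=1}^KU_i(\theta)$, $\theta\in\mathbb R^d$: 1) for each $i\in\{0,\dots,K\}$, $U_i$ is continuously differentiable with $\tilde L_U$-Lipschitz gradient; 2) for each $i\in\{0,\dots,K\}$, $U_i$ is convex; 3) there is $m_U>0$ with $U(\theta')\ge U(\theta)+\langle\nabla U(\theta),\theta'-\theta\rangle+(m_U/2)\|\theta'-\theta\|^2$ for all $\theta,\theta'\in\mathbb R^d$. For a batch size $M\in\{1,\dots,K\}$, $\mathsf S_M$ is the set of subsets $S\subset\{1,\dots,K\}$ with $|S|=M$, and $\Upsilon_M$ is the uniform distribution on $\mathsf S_M$. SGLD recursion: $\theta_{k+1}=\theta_k-\gamma G(\theta_k,S_{k+1})+\sqrt{2\gamma}\,\xi_{k+1}$, $G(\theta,S)=\nabla U_0(\theta)+KM^{-1}\sum_{i\in S}\nabla U_i(\theta)$, with $S_{k+1}\sim\Upsilon_M$ independent of the past and $(\xi_k)_{k\ge 1}$ i.i.d. standard Gaussian in $\mathbb R^d$. Let $(\tilde S_k)_{k\ge0}$ be another sequence of independent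 uniform batches, $\tilde S_k$ independent of the filtration generated by $(\theta_\ell,S_\ell)_{\ell\le k}$, and $X_k=(\theta_k,\tilde S_k)\in\mathsf X=\mathbb R^d\times\mathsf S_M$, $X_0\sim\xi$. The metric on $\mathsf X$ is $\mathsf d((\vartheta,S),(\vartheta',S'))=\|\vartheta-\vartheta'\|+\mathbf 1_{\{S\ne S'\}}$. For $\gamma\in(0,\tilde L_U^{-1}(K+1)^{-1})$ the chain $(X_k)$ has a unique invariant probability measure $\overline\pi=\pi_\gamma^{(\mathsf{SGLD})}\otimes\Upsilon_M$, with $\pi_\gamma^{(\mathsf{SGLD})}$ the invariant measure of $(\theta_k)$. $\mathbb S_1(\mathsf X,\mathsf d)$: probability measures $\mu$ on $\mathsf X$ with $\int\mathsf d(x,y)\mu(dy)<\infty$ for all $x$. $W_1^{\mathsf d}$: Wasserstein distance of order 1. $\operatorname{Lip}_{b,\mathsf d}(L,B)$: real functions $h$ on $\mathsf X$ with $|h(x)-h(y)|\le L\,\mathsf d(x,y)$ and $\sup|h|\le B$. $\mathcal H=\{f-g:g\in\mathcal G\}$ where $f$ is a fixed function (of $\theta$, viewed as a function on $\mathsf X$) and $\mathcal G$ is a set of functions on $\mathsf X$ with $\overline\pi(g)=0$; $\mathcal H$ is totally bounded in $L^2(\overline\pi)$. For $h\in\mathcal H$, with expectation for the chain started from $\overline\pi$, $$V_\infty^{(\mathsf{SGLD})}(h)=\sum_{\ell\in\mathbb Z}\mathsf E_{\overline\pi}\bigl[(h(X_0)-\overline\pi(f))(h(X_{|\ell|})-\overline\pi(f))\bigr].$$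 Spectral variance based on $X_0,\dots,X_{n-1}$: $V_n(h)=\sum_{|\ell|<b_n}w_n(\ell)\rho_n^{(h)}(\ell)$, where for $\ell\ge0$, $\rho_n^{(h)}(\ell)=\rho_n^{(h)}(-\ell)=n^{-1}\sum_{k=0}^{n-\ell-1}(h(X_k)-\pi_n(h))(h(X_{k+\ell})-\pi_n(h))$, $\pi_n(h)=n^{-1}\sum_{k=0}^{n-1}h(X_k)$, $w_n(\ell)=w(\ell/b_n)$, $w$ symmetric, non-negative, supported on $[-1,1]$, $\sup_{y\in[0,1]}|w(y)|\le1$, $w(y)=1$ on $[-1/2,1/2]$. $\mathcal H_\varepsilon\subset\mathcal H$ is a minimal (smallest cardinality) $\varepsilon$-net of $\mathcal H$ in $L^2(\overline\pi)$, $|\mathcal H_\varepsilon|$ its cardinality, and $\widehat h_{n,\varepsilon}\in\operatorname{argmin}_{h\in\mathcal H_\varepsilon}V_n(h)$. The sample size is $n\ge2$. *)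

theory Defs
  imports "HOL-Probability.Probability"
begin

section \<open>Euclidean space of variable dimension\<close>

text \<open>
  The bound holds up to an absolute constant, which in particular does not depend on the dimension.
  The dimension is therefore a natural number \<open>d\<close> and not a type: points of \<open>\<real>\<^sup>d\<close> are the
  functions on \<open>{..<d}\<close>, extended by \<open>undefined\<close>, so that they are exactly the points of the
  product measurable space \<open>PiM {..<d} (\<lambda>_. borel)\<close>. On this set the product topology of
  \<open>nat \<Rightarrow> real\<close> is the Euclidean one.
\<close>

type_synonym vec = "nat \<Rightarrow> real"

definition rvec :: "nat \<Rightarrow> vec set" where
  "rvec d = ({..<d} \<rightarrow>\<^sub>E UNIV)"

definition vborel :: "nat \<Rightarrow> vec measure" where
  "vborel d = PiM {..<d} (\<lambda>_. borel)"

definition vdot :: "nat \<Rightarrow> vec \<Rightarrow> vec \<Rightarrow> real" where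
  "vdot d x y = (\<Sum>i<d. x i * y i)"

definition vdist :: "nat \<Rightarrow> vec \<Rightarrow> vec \<Rightarrow> real" where
  "vdist d x y = L2_set (\<lambda>i. x i - y i) {..<d}"

definition std_gaussian :: "nat \<Rightarrow> vec measure" where
  "std_gaussian d = PiM {..<d} (\<lambda>_. density lborel (normal_density 0 1))"

definition has_gradient :: "nat \<Rightarrow> (vec \<Rightarrow> real) \<Rightarrow> vec \<Rightarrow> vec \<Rightarrow> bool" where
  "has_gradient d F x g \<longleftrightarrow>
     ((\<lambda>y. (F y - F x - vdot d g (\<lambda>i. y i - x i)) / vdist d y x) \<longlongrightarrow> 0) (at x within rvec d)"

definition gradient :: "nat \<Rightarrow> (vec \<Rightarrow> real) \<Rightarrow> vec \<Rightarrow> vec" where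
  "gradient d F x = (THE g. g \<in> rvec d \<and> has_gradient d F x g)"

definition cont_differentiable :: "nat \<Rightarrow> (vec \<Rightarrow> real) \<Rightarrow> bool" where
  "cont_differentiable d F \<longleftrightarrow>
     (\<forall>x\<in>rvec d. \<exists>g\<in>rvec d. has_gradient d F x g) \<and> continuous_on (rvec d) (gradient d F)"

definition lipschitz_gradient :: "nat \<Rightarrow> real \<Rightarrow> (vec \<Rightarrow> real) \<Rightarrow> bool" where
  "lipschitz_gradient d C F \<longleftrightarrow>
     (\<forall>x\<in>rvec d. \<forall>y\<in>rvec d. vdist d (gradient d F x) (gradient d F y) \<le> C * vdist d x y)"

definition convex_fun :: "nat \<Rightarrow> (vec \<Rightarrow> real) \<Rightarrow> bool" where
  "convex_fun d F \<longleftrightarrow>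
     (\<forall>x\<in>rvec d. \<forall>y\<in>rvec d. \<forall>t\<in>{0..1}.
        F (\<lambda>i\<in>{..<d}. (1 - t) * x i + t * y i) \<le> (1 - t) * F x + t * F y)"


section \<open>The potential and the SGLD chain\<close>

definition total_potential :: "nat \<Rightarrow> (nat \<Rightarrow> vec \<Rightarrow> real) \<Rightarrow> vec \<Rightarrow> real" where
  "total_potential K U x = U 0 x + (\<Sum>i=1..K. U i x)"

definition sgld_condition ::
    "nat \<Rightarrow> nat \<Rightarrow> (nat \<Rightarrow> vec \<Rightarrow> real) \<Rightarrow> real \<Rightarrow> real \<Rightarrow> bool" where
  "sgld_condition d K U LU mU \<longleftrightarrow>
     (\<forall>i\<le>K. cont_differentiable d (U i) \<and> lipschitz_gradient d LU (U i)) \<and>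
     (\<forall>i\<le>K. convex_fun d (U i)) \<and>
     mU > 0 \<and>
     (\<forall>x\<in>rvec d. \<forall>y\<in>rvec d.
        total_potential K U y \<ge> total_potential K U x
          + vdot d (gradient d (total_potential K U) x) (\<lambda>i. y i - x i)
          + mU / 2 * (vdist d y x)\<^sup>2)"

definition batches :: "nat \<Rightarrow> nat \<Rightarrow> nat set set" where
  "batches K M = {S. S \<subseteq> {1..K} \<and> card S = M}"

definition batch_law :: "nat \<Rightarrow> nat \<Rightarrow> nat set measure" where
  "batch_law K M = uniform_count_measure (batches K M)"

type_synonym state = "vec \<times> nat set"

definition state_space :: "nat \<Rightarrow> nat \<Rightarrow> nat \<Rightarrow> state measure" where
  "state_space d K M = vborel d \<Otimes>\<^sub>M count_space (batches K M)"

definition stoch_gradient ::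
    "nat \<Rightarrow> nat \<Rightarrow> nat \<Rightarrow> (nat \<Rightarrow> vec \<Rightarrow> real) \<Rightarrow> vec \<Rightarrow> nat set \<Rightarrow> vec" where
  "stoch_gradient d K M U x S =
     (\<lambda>i\<in>{..<d}. gradient d (U 0) x i + real K / real M * (\<Sum>j\<in>S. gradient d (U j) x i))"

text \<open>
  The chain is realised on its canonical probability space. An outcome consists of the initial state
  \<open>X\<^sub>0\<close>, which has law \<open>\<xi>\<close>, and of a sequence, independent of it, of independent triples: the
  \<open>k\<close>-th triple is \<open>(S\<^bsub>k+1\<^esub>, S'\<^bsub>k+1\<^esub>, \<zeta>\<^bsub>k+1\<^esub>)\<close>, where \<open>S\<^bsub>k+1\<^esub>\<close> is the batch driving the recursion,
  \<open>S'\<^bsub>k+1\<^esub>\<close> the fresh batch which is the second component of \<open>X\<^bsub>k+1\<^esub>\<close>, and \<open>\<zeta>\<^bsub>k+1\<^esub>\<close> the Gaussian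
  noise.
\<close>

type_synonym outcome = "state \<times> (nat \<Rightarrow> nat set \<times> nat set \<times> vec)"

definition sgld_space :: "nat \<Rightarrow> nat \<Rightarrow> nat \<Rightarrow> state measure \<Rightarrow> outcome measure" where
  "sgld_space d K M \<xi> =
     \<xi> \<Otimes>\<^sub>M PiM UNIV (\<lambda>_. batch_law K M \<Otimes>\<^sub>M (batch_law K M \<Otimes>\<^sub>M std_gaussian d))"

primrec sgld_theta ::
    "nat \<Rightarrow> nat \<Rightarrow> nat \<Rightarrow> (nat \<Rightarrow> vec \<Rightarrow> real) \<Rightarrow> real \<Rightarrow> outcome \<Rightarrow> nat \<Rightarrow> vec" where
  "sgld_theta d K M U \<gamma> \<omega> 0 = fst (fst \<omega>)"
| "sgld_theta d K M U \<gamma> \<omega> (Suc k) =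
     (case snd \<omega> k of (S, S', z) \<Rightarrow>
        \<lambda>i\<in>{..<d}. sgld_theta d K M U \<gamma> \<omega> k i
                 - \<gamma> * stoch_gradient d K M U (sgld_theta d K M U \<gamma> \<omega> k) S i
                 + sqrt (2 * \<gamma>) * z i)"

definition sgld_aux_batch :: "outcome \<Rightarrow> nat \<Rightarrow> nat set" where
  "sgld_aux_batch \<omega> k = (case k of 0 \<Rightarrow> snd (fst \<omega>) | Suc j \<Rightarrow> fst (snd (snd \<omega> j)))"

definition sgld_chain ::
    "nat \<Rightarrow> nat \<Rightarrow> nat \<Rightarrow> (nat \<Rightarrow> vec \<Rightarrow> real) \<Rightarrow> real \<Rightarrow> nat \<Rightarrow> outcome \<Rightarrow> state" where
  "sgld_chain d K M U \<gamma> k \<omega> = (sgld_theta d K M U \<gamma> \<omega> k, sgld_aux_batch \<omega> k)"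

definition sgld_invariant ::
    "nat \<Rightarrow> nat \<Rightarrow> nat \<Rightarrow> (nat \<Rightarrow> vec \<Rightarrow> real) \<Rightarrow> real \<Rightarrow> state measure \<Rightarrow> bool" where
  "sgld_invariant d K M U \<gamma> \<mu> \<longleftrightarrow>
     prob_space \<mu> \<and> sets \<mu> = sets (state_space d K M) \<and>
     distr (sgld_space d K M \<mu>) (state_space d K M) (sgld_chain d K M U \<gamma> 1) = \<mu>"


section \<open>Metric, Wasserstein distance, function classes\<close>

definition dX :: "nat \<Rightarrow> state \<Rightarrow> state \<Rightarrow> real" where
  "dX d x y = vdist d (fst x) (fst y) + (if snd x \<noteq> snd y then 1 else 0)"

definition S1 :: "nat \<Rightarrow> nat \<Rightarrow> nat \<Rightarrow> state measure set" where
  "S1 d K M = {\<mu>. prob_space \<mu> \<and> sets \<mu> = sets (state_space d K M) \<and>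
     (\<forall>x\<in>space (state_space d K M). (\<integral>\<^sup>+y. ennreal (dX d x y) \<partial>\<mu>) < \<infinity>)}"

definition couplings :: "'a measure \<Rightarrow> 'b measure \<Rightarrow> ('a \<times> 'b) measure set" where
  "couplings \<mu> \<nu> = {\<zeta>. sets \<zeta> = sets (\<mu> \<Otimes>\<^sub>M \<nu>) \<and> distr \<zeta> \<mu> fst = \<mu> \<and> distr \<zeta> \<nu> snd = \<nu>}"

definition W1 :: "nat \<Rightarrow> state measure \<Rightarrow> state measure \<Rightarrow> real" where
  "W1 d \<mu> \<nu> =
     enn2real (INF \<zeta>\<in>couplings \<mu> \<nu>. \<integral>\<^sup>+z. ennreal (dX d (fst z) (snd z)) \<partial>\<zeta>)"

definition mean_W1 :: "nat \<Rightarrow> nat \<Rightarrow> nat \<Rightarrow> state measure \<Rightarrow> real" where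
  "mean_W1 d K M \<mu> = (\<integral>x. W1 d (return (state_space d K M) x) \<mu> \<partial>\<mu>)"

definition Lip_b :: "nat \<Rightarrow> nat \<Rightarrow> nat \<Rightarrow> real \<Rightarrow> real \<Rightarrow> (state \<Rightarrow> real) set" where
  "Lip_b d K M L B =
     {h. (\<forall>x\<in>space (state_space d K M). \<forall>y\<in>space (state_space d K M).
            \<bar>h x - h y\<bar> \<le> L * dX d x y) \<and>
         (\<forall>x\<in>space (state_space d K M). \<bar>h x\<bar> \<le> B)}"

definition dist_L2 :: "'a measure \<Rightarrow> ('a \<Rightarrow> real) \<Rightarrow> ('a \<Rightarrow> real) \<Rightarrow> real" where
  "dist_L2 \<mu> g h = sqrt (\<integral>x. (g x - h x)\<^sup>2 \<partial>\<mu>)"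

definition is_net :: "'a measure \<Rightarrow> real \<Rightarrow> ('a \<Rightarrow> real) set \<Rightarrow> ('a \<Rightarrow> real) set \<Rightarrow> bool" where
  "is_net \<mu> \<epsilon> H N \<longleftrightarrow> N \<subseteq> H \<and> finite N \<and> (\<forall>h\<in>H. \<exists>g\<in>N. dist_L2 \<mu> h g \<le> \<epsilon>)"

definition totally_bounded_L2 :: "'a measure \<Rightarrow> ('a \<Rightarrow> real) set \<Rightarrow> bool" where
  "totally_bounded_L2 \<mu> H \<longleftrightarrow> (\<forall>\<epsilon>>0. \<exists>N. is_net \<mu> \<epsilon> H N)"

definition minimal_net ::
    "'a measure \<Rightarrow> real \<Rightarrow> ('a \<Rightarrow> real) set \<Rightarrow> ('a \<Rightarrow> real) set \<Rightarrow> bool" where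
  "minimal_net \<mu> \<epsilon> H N \<longleftrightarrow> is_net \<mu> \<epsilon> H N \<and> (\<forall>N'. is_net \<mu> \<epsilon> H N' \<longrightarrow> card N \<le> card N')"

definition var :: "'a measure \<Rightarrow> ('a \<Rightarrow> real) \<Rightarrow> real" where
  "var \<mu> h = (\<integral>x. (h x - (\<integral>y. h y \<partial>\<mu>))\<^sup>2 \<partial>\<mu>)"


section \<open>Asymptotic and spectral variance\<close>

text \<open>The argument \<open>c\<close> is the centring \<open>\<pi>(f)\<close>; the expectation is over the chain started from \<open>\<pi>\<close>.\<close>

definition V_inf ::
    "nat \<Rightarrow> nat \<Rightarrow> nat \<Rightarrow> (nat \<Rightarrow> vec \<Rightarrow> real) \<Rightarrow> real \<Rightarrow> state measure \<Rightarrow> real \<Rightarrow>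
      (state \<Rightarrow> real) \<Rightarrow> real" where
  "V_inf d K M U \<gamma> \<pi> c h =
     (\<Sum>\<^sub>\<infinity>l\<in>(UNIV::int set).
        \<integral>\<omega>. (h (sgld_chain d K M U \<gamma> 0 \<omega>) - c) *
             (h (sgld_chain d K M U \<gamma> (nat \<bar>l\<bar>) \<omega>) - c) \<partial>sgld_space d K M \<pi>)"

definition emp_mean :: "nat \<Rightarrow> (nat \<Rightarrow> 'a) \<Rightarrow> ('a \<Rightarrow> real) \<Rightarrow> real" where
  "emp_mean n x h = (\<Sum>k<n. h (x k)) / real n"

definition emp_autocov :: "nat \<Rightarrow> (nat \<Rightarrow> 'a) \<Rightarrow> ('a \<Rightarrow> real) \<Rightarrow> nat \<Rightarrow> real" where
  "emp_autocov n x h l =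
     (\<Sum>k<n - l. (h (x k) - emp_mean n x h) * (h (x (k + l)) - emp_mean n x h)) / real n"

definition spectral_variance ::
    "(real \<Rightarrow> real) \<Rightarrow> nat \<Rightarrow> nat \<Rightarrow> (nat \<Rightarrow> 'a) \<Rightarrow> ('a \<Rightarrow> real) \<Rightarrow> real" where
  "spectral_variance w b n x h =
     (\<Sum>l\<in>{- int b<..<int b}. w (of_int l / real b) * emp_autocov n x h (nat \<bar>l\<bar>))"

definition lag_window :: "(real \<Rightarrow> real) \<Rightarrow> bool" where
  "lag_window w \<longleftrightarrow>
     (\<forall>y. w (- y) = w y) \<and> (\<forall>y. w y \<ge> 0) \<and> (\<forall>y. y \<notin> {-1..1} \<longrightarrow> w y = 0) \<and>
     (\<forall>y\<in>{0..1}. \<bar>w y\<bar> \<le> 1) \<and> (\<forall>y\<in>{-1/2..1/2}. w y = 1)"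


section \<open>Constants of the bound\<close>

definition Delta1 :: "real \<Rightarrow> real \<Rightarrow> real" where
  "Delta1 \<gamma> mU = sqrt (1 - \<gamma> * mU)"

definition truncation :: "real \<Rightarrow> real \<Rightarrow> nat \<Rightarrow> nat" where
  "truncation \<gamma> mU n = 2 * nat \<lceil>ln (real n) / ln (1 / Delta1 \<gamma> mU)\<rceil>"

definition const_D :: "state measure \<Rightarrow> (state \<Rightarrow> real) set \<Rightarrow> real" where
  "const_D \<pi> H = (SUP h\<in>H. var \<pi> h)"

definition const_varsigma ::
    "nat \<Rightarrow> nat \<Rightarrow> nat \<Rightarrow> real \<Rightarrow> real \<Rightarrow> state measure \<Rightarrow> real" where
  "const_varsigma d K M L B \<pi> = 2 * L * B * mean_W1 d K M \<pi>"

definition const_R ::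
    "nat \<Rightarrow> nat \<Rightarrow> nat \<Rightarrow> real \<Rightarrow> real \<Rightarrow> real \<Rightarrow> real \<Rightarrow> state measure \<Rightarrow> state measure \<Rightarrow> real" where
  "const_R d K M \<gamma> mU L B \<xi> \<pi> =
     2 * B / (1 - sqrt (Delta1 \<gamma> mU)) *
       (2 * L * sqrt (W1 d \<xi> \<pi>) * sqrt (mean_W1 d K M \<pi>) + sqrt (2 * L * B * W1 d \<xi> \<pi>))"

end

theory Submission
  imports Defs
begin

text \<open>
  With the same batches and the same noise, two SGLD trajectories approach each other in mean at the
  geometric rate \<open>\<Delta>\<^sub>1\<close>: every stochastic gradient is the gradient of a convex function whose gradient is
  \<open>LU (K + 1)\<close>-Lipschitz, hence cocoercive, and its average over the batches is the strongly monotone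
  gradient of \<open>U\<close>. Therefore \<open>X\<^sub>k\<close> is, up to an exponentially small error, a function of the last \<open>s\<close>
  innovations only. The products occurring in an empirical autocovariance are then functions of
  windows of length \<open>r\<close>, which split into \<open>r\<close> classes of independent variables, and Hoeffding's
  inequality applies to each class. Taking \<open>s\<close> of order \<open>ln (n / \<delta>) / (mU \<gamma>)\<close> and using
  \<open>ln x \<le> p x\<^bsup>1/p\<^esup>\<close> with \<open>p = ln n\<close> turns the exponential deviation bound into the stated one. The
  constants must not depend on \<open>L / B\<close>: since \<open>mean_W1 \<ge> sqrt \<gamma>\<close>, either \<open>B n \<le> L sqrt \<gamma>\<close> and
  the term with \<open>\<varsigma>\<close> dominates the whole variance, or \<open>L / B \<le> n / sqrt \<gamma>\<close>, which is absorbed into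
  the choice of \<open>s\<close>.
\<close>

section \<open>Iterated random functions\<close>

text \<open>Every window is restarted from one fixed state \<open>x0\<close>, so the windowed
  variables know nothing of the initial law: the same windows approximate the chain started from
  \<xi> and the stationary chain, and the stationary covariances are reached without comparing \<xi>
  with \<pi>. Only the first moment of \<xi> enters, through Markov's inequality for the summed
  window errors. The order of quantifiers shapes the constants: \<open>R1\<close> and
  \<open>R2\<close> are fixed before \<open>LU\<close>, \<open>mU\<close> and \<gamma>, so the drift
  bound has to be uniform over all admissible step sizes. The letter \<open>q\<close> stands for
  \<open>mU * \<gamma>\<close>; both \<open>1 - \<rho>\<close> and \<open>ln (1 / \<rho>)\<close>
  are at least \<open>q / 2\<close>, which converts rates into powers of \<open>q\<close>. In the
  bound, the term linear in \<epsilon> comes from Cauchy-Schwarz at each of the order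
  \<open>ln n / q\<close> lags kept when a function is replaced by a net point, the term with
  \<varsigma> from the geometric decay of the covariances beyond the truncation, and the square-root
  term from the deviation of the empirical covariances.\<close>

primrec orbit :: "('s \<Rightarrow> 'v \<Rightarrow> 's) \<Rightarrow> 's \<Rightarrow> (nat \<Rightarrow> 'v) \<Rightarrow> nat \<Rightarrow> 's" where
  "orbit stp x \<eta> 0 = x"
| "orbit stp x \<eta> (Suc k) = stp (orbit stp x \<eta> k) (\<eta> k)"

text \<open>The recursion unfolds at the last step, this identity at the first; it matches the
  splitting of the sequence space into one innovation and an independent remainder.\<close>

lemma orbit_case_nat: "orbit stp x (case_nat v \<eta>) (Suc k) = orbit stp (stp x v) \<eta> k"
  by (induction k) auto

lemma orbit_add: "orbit stp x \<eta> (a + s) = orbit stp (orbit stp x \<eta> a) (\<lambda>i. \<eta> (a + i)) s"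
  by (induction s) auto

lemma orbit_cong:
  assumes "\<And>i. i < k \<Longrightarrow> \<eta> i = \<eta>' i"
  shows "orbit stp x \<eta> k = orbit stp x \<eta>' k"
  using assms by (induction k) auto

text \<open>The contraction compares two states moved by the same innovation, the synchronous
  coupling behind a Wasserstein contraction of rate \<rho>. The reference state \<open>x0\<close> is
  where every window is restarted; \<kappa> bounds its mean displacement in one step and is the only
  moment information about the noise.\<close>

locale contractive_chain = sequence_space N for N :: "'v measure" +
  fixes X :: "'s measure" and stp :: "'s \<Rightarrow> 'v \<Rightarrow> 's" and D :: "'s \<Rightarrow> 's \<Rightarrow> real"
    and \<rho> \<kappa> :: real and x0 :: 's
  assumes stp_measurable[measurable]: "(\<lambda>(x, v). stp x v) \<in> X \<Otimes>\<^sub>M N \<rightarrow>\<^sub>M X"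
    and D_measurable[measurable]: "(\<lambda>(x, y). D x y) \<in> borel_measurable (X \<Otimes>\<^sub>M X)"
    and D_nonneg: "0 \<le> D x y"
    and D_triangle: "D x z \<le> D x y + D y z"
    and rho: "0 \<le> \<rho>" "\<rho> < 1"
    and contraction: "\<And>x y. x \<in> space X \<Longrightarrow> y \<in> space X \<Longrightarrow>
          (\<integral>\<^sup>+v. ennreal (D (stp x v) (stp y v)) \<partial>N) \<le> ennreal (\<rho> * D x y)"
    and x0[measurable, simp]: "x0 \<in> space X"
    and drift_x0: "(\<integral>\<^sup>+v. ennreal (D (stp x0 v) x0) \<partial>N) \<le> ennreal \<kappa>"
    and kappa: "0 \<le> \<kappa>"
begin

lemma prob_space_N: "prob_space N"
  by (rule M.prob_space_axioms)

lemma stp_space [simp]: "x \<in> space X \<Longrightarrow> v \<in> space N \<Longrightarrow> stp x v \<in> space X"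
  using measurable_space[OF stp_measurable, of "(x, v)"] by (simp add: space_pair_measure)

lemma stp_measurable' [measurable (raw)]:
  "f \<in> R \<rightarrow>\<^sub>M X \<Longrightarrow> g \<in> R \<rightarrow>\<^sub>M N \<Longrightarrow> (\<lambda>r. stp (f r) (g r)) \<in> R \<rightarrow>\<^sub>M X"
  using measurable_compose[OF measurable_Pair stp_measurable, of f R g] by simp

lemma D_measurable' [measurable (raw)]:
  "f \<in> R \<rightarrow>\<^sub>M X \<Longrightarrow> g \<in> R \<rightarrow>\<^sub>M X \<Longrightarrow> (\<lambda>r. D (f r) (g r)) \<in> borel_measurable R"
  using measurable_compose[OF measurable_Pair D_measurable, of f R g] by simp

lemma orbit_measurable [measurable (raw)]:
  "f \<in> R \<rightarrow>\<^sub>M X \<Longrightarrow> g \<in> R \<rightarrow>\<^sub>M S \<Longrightarrow> (\<lambda>r. orbit stp (f r) (g r) k) \<in> R \<rightarrow>\<^sub>M X"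
  by (induction k) auto

lemma orbit_space [simp]: "x \<in> space X \<Longrightarrow> \<eta> \<in> space S \<Longrightarrow> orbit stp x \<eta> k \<in> space X"
  by (induction k) (auto simp: space_PiM PiE_iff)

lemma shift_measurable [measurable (raw)]:
  "g \<in> R \<rightarrow>\<^sub>M S \<Longrightarrow> (\<lambda>r i. g r (a + i)) \<in> R \<rightarrow>\<^sub>M S" for a :: nat
  by (rule measurable_PiM_single') (auto simp: space_PiM PiE_iff dest!: measurable_space)

text \<open>A sequence of innovations is one innovation followed by an independent copy of the whole
  sequence. Integrating in this order is the Markov property at time 1 and drives the inductions on
  the number of steps.\<close>

lemma nn_integral_front:
  assumes [measurable]: "g \<in> borel_measurable S"
  shows "(\<integral>\<^sup>+\<eta>. g \<eta> \<partial>S) = (\<integral>\<^sup>+v. \<integral>\<^sup>+\<eta>. g (case_nat v \<eta>) \<partial>S \<partial>N)"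
proof -
  have "(\<integral>\<^sup>+\<eta>. g \<eta> \<partial>S) = (\<integral>\<^sup>+\<eta>. g \<eta> \<partial>distr (N \<Otimes>\<^sub>M S) S (\<lambda>(s, \<omega>). case_nat s \<omega>))"
    by (simp only: PiM_iter)
  also have "\<dots> = (\<integral>\<^sup>+z. g (case_nat (fst z) (snd z)) \<partial>(N \<Otimes>\<^sub>M S))"
    by (subst nn_integral_distr) (auto simp: split_beta')
  also have "\<dots> = (\<integral>\<^sup>+v. \<integral>\<^sup>+\<eta>. g (case_nat v \<eta>) \<partial>S \<partial>N)"
    by (subst P.nn_integral_fst[symmetric]) auto
  finally show ?thesis .
qed

lemma integral_front:
  assumes [measurable]: "g \<in> borel_measurable S" and "\<And>\<eta>. \<eta> \<in> space S \<Longrightarrow> \<bar>g \<eta>\<bar> \<le> (C::real)"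
  shows "(\<integral>\<eta>. g \<eta> \<partial>S) = (\<integral>v. \<integral>\<eta>. g (case_nat v \<eta>) \<partial>S \<partial>N)"
proof -
  interpret NS: pair_prob_space N S ..
  have sp: "case_nat (fst z) (snd z) \<in> space S" if "z \<in> space (N \<Otimes>\<^sub>M S)" for z
    using that by (auto simp: space_pair_measure space_PiM PiE_iff split: nat.split)
  have "(\<integral>\<eta>. g \<eta> \<partial>S) = (\<integral>\<eta>. g \<eta> \<partial>distr (N \<Otimes>\<^sub>M S) S (\<lambda>(s, \<omega>). case_nat s \<omega>))"
    by (simp only: PiM_iter)
  also have "\<dots> = (\<integral>z. g (case_nat (fst z) (snd z)) \<partial>(N \<Otimes>\<^sub>M S))"
    by (subst integral_distr) (auto simp: split_beta')
  also have "\<dots> = (\<integral>v. \<integral>\<eta>. g (case_nat v \<eta>) \<partial>S \<partial>N)"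
    by (subst NS.integral_fst'[symmetric])
       (auto intro!: NS.integrable_const_bound[of _ C] assms(2) sp)
  finally show ?thesis .
qed

lemma contraction_orbit:
  assumes "x \<in> space X" "y \<in> space X"
  shows "(\<integral>\<^sup>+\<eta>. ennreal (D (orbit stp x \<eta> s) (orbit stp y \<eta> s)) \<partial>S) \<le> ennreal (\<rho> ^ s * D x y)"
  using assms
proof (induction s arbitrary: x y)
  case 0
  then show ?case by (simp add: P.emeasure_space_1)
next
  case (Suc s)
  note [measurable] = Suc.prems
  have "(\<integral>\<^sup>+\<eta>. ennreal (D (orbit stp x \<eta> (Suc s)) (orbit stp y \<eta> (Suc s))) \<partial>S)
      = (\<integral>\<^sup>+v. \<integral>\<^sup>+\<eta>. ennreal (D (orbit stp (stp x v) \<eta> s) (orbit stp (stp y v) \<eta> s)) \<partial>S \<partial>N)"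
    by (subst nn_integral_front) (auto simp: orbit_case_nat simp del: orbit.simps)
  also have "\<dots> \<le> (\<integral>\<^sup>+v. ennreal (\<rho> ^ s) * ennreal (D (stp x v) (stp y v)) \<partial>N)"
    using Suc.prems rho by (intro nn_integral_mono)
      (auto intro!: order_trans[OF Suc.IH] simp: ennreal_mult' D_nonneg)
  also have "\<dots> = ennreal (\<rho> ^ s) * (\<integral>\<^sup>+v. ennreal (D (stp x v) (stp y v)) \<partial>N)"
    by (rule nn_integral_cmult) measurable
  also have "\<dots> \<le> ennreal (\<rho> ^ s) * ennreal (\<rho> * D x y)"
    by (intro mult_left_mono contraction Suc.prems) auto
  also have "\<dots> = ennreal (\<rho> ^ Suc s * D x y)"
    using rho by (simp add: ennreal_mult'[symmetric] D_nonneg mult_ac)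
  finally show ?case .
qed

text \<open>The image of x is compared with the image of \<open>x0\<close> under the same
  innovation, which contracts, and that image with \<open>x0\<close> itself, which costs
  \<kappa>.\<close>

lemma drift:
  assumes [measurable]: "x \<in> space X"
  shows "(\<integral>\<^sup>+v. ennreal (D (stp x v) x0) \<partial>N) \<le> ennreal (\<rho> * D x x0 + \<kappa>)"
proof -
  have "(\<integral>\<^sup>+v. ennreal (D (stp x v) x0) \<partial>N)
      \<le> (\<integral>\<^sup>+v. ennreal (D (stp x v) (stp x0 v)) + ennreal (D (stp x0 v) x0) \<partial>N)"
    by (intro nn_integral_mono) (auto simp: ennreal_plus[symmetric] D_nonneg D_triangle simp del: ennreal_plus)
  also have "\<dots> = (\<integral>\<^sup>+v. ennreal (D (stp x v) (stp x0 v)) \<partial>N) + (\<integral>\<^sup>+v. ennreal (D (stp x0 v) x0) \<partial>N)"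
    by (rule nn_integral_add) measurable
  also have "\<dots> \<le> ennreal (\<rho> * D x x0) + ennreal \<kappa>"
    by (intro add_mono contraction drift_x0 assms) auto
  also have "\<dots> = ennreal (\<rho> * D x x0 + \<kappa>)"
    using rho kappa by (simp add: ennreal_plus D_nonneg)
  finally show ?thesis .
qed

text \<open>The bracket bounds the mean distance to \<open>x0\<close> at time \<open>a\<close>,
  obtained by iterating \<open>drift\<close>; restarting from \<open>x0\<close> at that time makes
  an error of this size, and the \<open>s\<close> common innovations that follow shrink it by
  \<open>\<rho> ^ s\<close>.\<close>

lemma coupling:
  assumes "x \<in> space X"
  shows "(\<integral>\<^sup>+\<eta>. ennreal (D (orbit stp x \<eta> (a + s)) (orbit stp x0 (\<lambda>i. \<eta> (a + i)) s)) \<partial>S)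
    \<le> ennreal (\<rho> ^ s * (\<rho> ^ a * D x x0 + \<kappa> * (1 - \<rho> ^ a) / (1 - \<rho>)))"
  using assms
proof (induction a arbitrary: x)
  case 0
  then show ?case using contraction_orbit[of x x0 s] by simp
next
  case (Suc a)
  note [measurable] = Suc.prems
  let ?K = "\<kappa> * (1 - \<rho> ^ a) / (1 - \<rho>)"
  have K: "0 \<le> ?K" using kappa rho by (simp add: power_le_one)
  have "(\<integral>\<^sup>+\<eta>. ennreal (D (orbit stp x \<eta> (Suc a + s)) (orbit stp x0 (\<lambda>i. \<eta> (Suc a + i)) s)) \<partial>S)
      = (\<integral>\<^sup>+v. \<integral>\<^sup>+\<eta>. ennreal (D (orbit stp (stp x v) \<eta> (a + s)) (orbit stp x0 (\<lambda>i. \<eta> (a + i)) s)) \<partial>S \<partial>N)"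
    by (subst nn_integral_front, measurable)
       (auto intro!: nn_integral_cong simp: orbit_case_nat[of _ _ _ _ "a + s"] simp del: orbit.simps(2))
  also have "\<dots> \<le> (\<integral>\<^sup>+v. ennreal (\<rho> ^ s * \<rho> ^ a) * ennreal (D (stp x v) x0) + ennreal (\<rho> ^ s * ?K) \<partial>N)"
  proof (intro nn_integral_mono order_trans[OF Suc.IH])
    fix v
    have "ennreal (\<rho> ^ s * (\<rho> ^ a * D (stp x v) x0 + ?K))
        = ennreal (\<rho> ^ s * \<rho> ^ a * D (stp x v) x0 + \<rho> ^ s * ?K)"
      by (simp only: ring_distribs mult.assoc)
    also have "\<dots> = ennreal (\<rho> ^ s * \<rho> ^ a) * ennreal (D (stp x v) x0) + ennreal (\<rho> ^ s * ?K)"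
      using rho D_nonneg[of "stp x v" x0] mult_nonneg_nonneg[OF zero_le_power[OF rho(1), of s] K]
      by (subst ennreal_plus) (auto simp: ennreal_mult')
    finally show "ennreal (\<rho> ^ s * (\<rho> ^ a * D (stp x v) x0 + ?K))
        \<le> ennreal (\<rho> ^ s * \<rho> ^ a) * ennreal (D (stp x v) x0) + ennreal (\<rho> ^ s * ?K)" by simp
  qed (use Suc.prems in auto)
  also have "\<dots> = ennreal (\<rho> ^ s * \<rho> ^ a) * (\<integral>\<^sup>+v. ennreal (D (stp x v) x0) \<partial>N) + ennreal (\<rho> ^ s * ?K)"
    by (subst nn_integral_add) (auto simp: nn_integral_cmult M.emeasure_space_1)
  also have "\<dots> \<le> ennreal (\<rho> ^ s * \<rho> ^ a) * ennreal (\<rho> * D x x0 + \<kappa>) + ennreal (\<rho> ^ s * ?K)"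
    by (intro add_mono mult_left_mono drift Suc.prems) auto
  also have "\<dots> = ennreal (\<rho> ^ s * \<rho> ^ a * (\<rho> * D x x0 + \<kappa>) + \<rho> ^ s * ?K)"
    using rho kappa D_nonneg[of x x0] mult_nonneg_nonneg[OF zero_le_power[OF rho(1), of s] K]
    by (subst ennreal_mult'[symmetric], simp, subst ennreal_plus[symmetric]) auto
  also have "\<rho> ^ s * \<rho> ^ a * (\<rho> * D x x0 + \<kappa>) + \<rho> ^ s * ?K
      = \<rho> ^ s * (\<rho> ^ Suc a * D x x0 + \<kappa> * (1 - \<rho> ^ Suc a) / (1 - \<rho>))"
    using rho by (simp add: field_simps)
  finally show ?case .
qed

lemma coupling':
  assumes "x \<in> space X"
  shows "(\<integral>\<^sup>+\<eta>. ennreal (D (orbit stp x \<eta> (a + s)) (orbit stp x0 (\<lambda>i. \<eta> (a + i)) s)) \<partial>S)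
    \<le> ennreal (\<rho> ^ s) * (ennreal (D x x0) + ennreal (\<kappa> / (1 - \<rho>)))"
proof -
  have "\<rho> ^ a * D x x0 + \<kappa> * (1 - \<rho> ^ a) / (1 - \<rho>) \<le> D x x0 + \<kappa> / (1 - \<rho>)"
    using rho kappa D_nonneg[of x x0]
    by (intro add_mono divide_right_mono mult_left_le mult_left_le_one_le) (auto simp: power_le_one)
  then have "ennreal (\<rho> ^ s * (\<rho> ^ a * D x x0 + \<kappa> * (1 - \<rho> ^ a) / (1 - \<rho>)))
      \<le> ennreal (\<rho> ^ s * (D x x0 + \<kappa> / (1 - \<rho>)))"
    using rho by (intro ennreal_leI mult_left_mono) auto
  also have "\<dots> = ennreal (\<rho> ^ s) * (ennreal (D x x0) + ennreal (\<kappa> / (1 - \<rho>)))"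
    using rho kappa by (simp add: ennreal_mult' D_nonneg)
  finally show ?thesis using coupling[OF assms, of a s] by (rule order_trans[rotated])
qed

end

section \<open>Invariant laws: stationarity and first moment\<close>

lemma (in prob_space) abs_expectation_le:
  fixes f :: "'a \<Rightarrow> real"
  assumes "\<And>x. x \<in> space M \<Longrightarrow> \<bar>f x\<bar> \<le> C" "0 \<le> C"
  shows "\<bar>expectation f\<bar> \<le> C"
proof -
  have "\<bar>expectation f\<bar> \<le> expectation (\<lambda>x. \<bar>f x\<bar>)" by simp
  also have "\<dots> \<le> expectation (\<lambda>_. C)" using assms by (intro integral_mono') auto
  finally show ?thesis by (simp add: prob_space)
qed

context contractive_chain begin

definition invariant :: "'s measure \<Rightarrow> bool" where
  "invariant \<pi> \<longleftrightarrow> prob_space \<pi> \<and> sets \<pi> = sets X \<and> distr (\<pi> \<Otimes>\<^sub>M N) X (\<lambda>(x, v). stp x v) = \<pi>"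

lemma invariant_nn_integral:
  assumes "invariant \<pi>" and [measurable]: "g \<in> borel_measurable X"
  shows "(\<integral>\<^sup>+x. \<integral>\<^sup>+v. g (stp x v) \<partial>N \<partial>\<pi>) = (\<integral>\<^sup>+x. g x \<partial>\<pi>)"
proof -
  have [measurable_cong]: "sets \<pi> = sets X" using assms by (simp add: invariant_def)
  have "(\<integral>\<^sup>+x. g x \<partial>\<pi>) = (\<integral>\<^sup>+x. g x \<partial>distr (\<pi> \<Otimes>\<^sub>M N) X (\<lambda>(x, v). stp x v))"
    using assms by (simp add: invariant_def)
  also have "\<dots> = (\<integral>\<^sup>+z. g (stp (fst z) (snd z)) \<partial>(\<pi> \<Otimes>\<^sub>M N))"
    by (subst nn_integral_distr) (auto simp: split_beta')
  also have "\<dots> = (\<integral>\<^sup>+x. \<integral>\<^sup>+v. g (stp x v) \<partial>N \<partial>\<pi>)"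
    by (subst M.nn_integral_fst[symmetric]) auto
  finally show ?thesis by simp
qed

lemma invariant_integral:
  assumes "invariant \<pi>" and [measurable]: "g \<in> borel_measurable X"
    and bd: "\<And>x. x \<in> space X \<Longrightarrow> \<bar>g x\<bar> \<le> (C::real)"
  shows "(\<integral>x. \<integral>v. g (stp x v) \<partial>N \<partial>\<pi>) = (\<integral>x. g x \<partial>\<pi>)"
proof -
  have sets[measurable_cong]: "sets \<pi> = sets X" using assms by (simp add: invariant_def)
  have sp: "space \<pi> = space X" by (rule sets_eq_imp_space_eq[OF sets])
  interpret pi: prob_space \<pi> using assms by (simp add: invariant_def)
  interpret NS: pair_prob_space \<pi> N ..
  have "(\<integral>x. g x \<partial>\<pi>) = (\<integral>x. g x \<partial>distr (\<pi> \<Otimes>\<^sub>M N) X (\<lambda>(x, v). stp x v))"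
    using assms by (simp add: invariant_def)
  also have "\<dots> = (\<integral>z. g (stp (fst z) (snd z)) \<partial>(\<pi> \<Otimes>\<^sub>M N))"
    by (subst integral_distr) (auto simp: split_beta')
  also have "\<dots> = (\<integral>x. \<integral>v. g (stp x v) \<partial>N \<partial>\<pi>)"
    by (subst NS.integral_fst'[symmetric])
       (auto intro!: NS.integrable_const_bound[of _ C] AE_I2 bd simp: space_pair_measure sp)
  finally show ?thesis by simp
qed

text \<open>The state at time \<open>k\<close> together with all later innovations has again the law
  of the initial state together with all innovations. Since \<open>g\<close> sees both, products at
  two different times can be shifted along the trajectory.\<close>

lemma stationary_orbit:
  assumes "invariant \<pi>" and g[measurable]: "g \<in> borel_measurable (X \<Otimes>\<^sub>M S)"
    and bd: "\<And>z. z \<in> space (X \<Otimes>\<^sub>M S) \<Longrightarrow> \<bar>g z\<bar> \<le> (C::real)"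
  shows "(\<integral>x. \<integral>\<eta>. g (orbit stp x \<eta> k, \<lambda>i. \<eta> (k + i)) \<partial>S \<partial>\<pi>) = (\<integral>x. \<integral>\<eta>. g (x, \<eta>) \<partial>S \<partial>\<pi>)"
proof (induction k)
  case 0
  then show ?case by simp
next
  case (Suc k)
  have sets[measurable_cong]: "sets \<pi> = sets X" using assms by (simp add: invariant_def)
  have sp: "space \<pi> = space X" by (rule sets_eq_imp_space_eq[OF sets])
  have C: "0 \<le> C" if "x \<in> space X" for x
  proof -
    obtain \<eta> where "\<eta> \<in> space S" using P.not_empty by blast
    then show ?thesis using bd[of "(x, \<eta>)"] that by (force simp: space_pair_measure)
  qed
  have sh: "(\<lambda>i. \<eta> (k + i)) \<in> space S" if "\<eta> \<in> space S" for \<eta> and k :: nat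
    using that by (simp add: space_PiM PiE_iff)
  \<comment> \<open>Conditioning on the first innovation reduces k + 1 steps from x to k steps from
    \<open>stp x v\<close>; the outer average of \<open>Q (stp x v)\<close> is then removed by
    one-step invariance.\<close>
  define Q where "Q x = (\<integral>\<eta>. g (orbit stp x \<eta> k, \<lambda>i. \<eta> (k + i)) \<partial>S)" for x
  have [measurable]: "Q \<in> borel_measurable X" unfolding Q_def by measurable
  have Q: "\<bar>Q x\<bar> \<le> C" if "x \<in> space X" for x
    unfolding Q_def using that sh C by (intro P.abs_expectation_le bd) (auto simp: space_pair_measure)
  have "(\<integral>\<eta>. g (orbit stp x \<eta> (Suc k), \<lambda>i. \<eta> (Suc k + i)) \<partial>S) = (\<integral>v. Q (stp x v) \<partial>N)"
    if [measurable]: "x \<in> space X" for x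
  proof -
    have "(\<integral>\<eta>. g (orbit stp x \<eta> (Suc k), \<lambda>i. \<eta> (Suc k + i)) \<partial>S)
        = (\<integral>v. \<integral>\<eta>. g (orbit stp x (case_nat v \<eta>) (Suc k), \<lambda>i. case_nat v \<eta> (Suc k + i)) \<partial>S \<partial>N)"
    proof (rule integral_front[where C = C])
      fix \<eta> assume "\<eta> \<in> space S"
      then show "\<bar>g (orbit stp x \<eta> (Suc k), \<lambda>i. \<eta> (Suc k + i))\<bar> \<le> C"
        using that sh[of \<eta> "Suc k"] by (intro bd) (auto simp: space_pair_measure simp del: orbit.simps)
    qed measurable
    then show ?thesis by (simp add: orbit_case_nat Q_def del: orbit.simps)
  qed
  then have "(\<integral>x. \<integral>\<eta>. g (orbit stp x \<eta> (Suc k), \<lambda>i. \<eta> (Suc k + i)) \<partial>S \<partial>\<pi>) = (\<integral>x. \<integral>v. Q (stp x v) \<partial>N \<partial>\<pi>)"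
    by (intro Bochner_Integration.integral_cong) (auto simp: sp)
  also have "\<dots> = (\<integral>x. Q x \<partial>\<pi>)"
    by (rule invariant_integral[OF assms(1) _ Q]) measurable
  finally show ?case using Suc by (simp add: Q_def)
qed

text \<open>
  The drift inequality cannot be integrated directly, since integrability is part of the claim; but
  \<open>min (D x x0) i\<close> is bounded, so its mean does not change in one step.
\<close>

lemma invariant_first_moment:
  assumes inv: "invariant \<pi>"
  shows "(\<integral>\<^sup>+x. ennreal (D x x0) \<partial>\<pi>) \<le> ennreal (\<kappa> / (1 - \<rho>))"
proof -
  have sets[measurable_cong]: "sets \<pi> = sets X" using inv by (simp add: invariant_def)
  have sp: "space \<pi> = space X" by (rule sets_eq_imp_space_eq[OF sets])
  interpret pi: prob_space \<pi> using inv by (simp add: invariant_def)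
  \<comment> \<open>The truncated quantity increases to \<open>D x x0\<close> with the level, and
    the bound is uniform in the level, so monotone convergence finishes the proof.\<close>
  have trunc: "(\<integral>\<^sup>+x. ennreal (D x x0 * indicator {..real i} (D x x0)) \<partial>\<pi>) \<le> ennreal (\<kappa> / (1 - \<rho>))" for i :: nat
  proof -
    let ?T = "real i"
    have i1: "integrable \<pi> (\<lambda>x. min (D x x0) ?T)" 
      by (intro pi.integrable_const_bound[of _ ?T]) (auto simp: D_nonneg)
    have i2: "integrable \<pi> (\<lambda>x. min (\<rho> * D x x0 + \<kappa>) ?T)"
      using rho kappa by (intro pi.integrable_const_bound[of _ ?T]) (auto simp: D_nonneg)
    have i3: "integrable \<pi> (\<lambda>x. D x x0 * indicator {..?T} (D x x0))"
      by (intro pi.integrable_const_bound[of _ ?T]) (auto simp: D_nonneg split: split_indicator)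
    have "(\<integral>\<^sup>+x. ennreal (min (D x x0) ?T) \<partial>\<pi>) = (\<integral>\<^sup>+x. \<integral>\<^sup>+v. ennreal (min (D (stp x v) x0) ?T) \<partial>N \<partial>\<pi>)"
      by (rule invariant_nn_integral[OF inv, symmetric]) measurable
    also have "\<dots> \<le> (\<integral>\<^sup>+x. ennreal (min (\<rho> * D x x0 + \<kappa>) ?T) \<partial>\<pi>)"
    proof (rule nn_integral_mono)
      fix x assume "x \<in> space \<pi>"
      then have x: "x \<in> space X" by (simp add: sp)
      have "(\<integral>\<^sup>+v. ennreal (min (D (stp x v) x0) ?T) \<partial>N) \<le> (\<integral>\<^sup>+v. ennreal (D (stp x v) x0) \<partial>N)"
        by (intro nn_integral_mono ennreal_leI) auto
      moreover have "(\<integral>\<^sup>+v. ennreal (min (D (stp x v) x0) ?T) \<partial>N) \<le> (\<integral>\<^sup>+v. ennreal ?T \<partial>N)"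
        by (intro nn_integral_mono ennreal_leI) auto
      ultimately show "(\<integral>\<^sup>+v. ennreal (min (D (stp x v) x0) ?T) \<partial>N) \<le> ennreal (min (\<rho> * D x x0 + \<kappa>) ?T)"
        using drift[OF x] by (auto simp: M.emeasure_space_1 min_def intro: order_trans)
    qed
    finally have le: "(\<integral>x. min (D x x0) ?T \<partial>\<pi>) \<le> (\<integral>x. min (\<rho> * D x x0 + \<kappa>) ?T \<partial>\<pi>)"
      using rho kappa i1 i2
      by (subst (asm) (1 2) nn_integral_eq_integral) (auto simp: D_nonneg intro!: integral_nonneg_AE)
    \<comment> \<open>Where \<open>D x x0\<close> is at most the level this is the drift inequality;
      above the level the left side is \<open>- \<kappa>\<close> and the right side is
      nonnegative.\<close>
    have "(\<integral>x. (1 - \<rho>) * (D x x0 * indicator {..?T} (D x x0)) - \<kappa> \<partial>\<pi>)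
        \<le> (\<integral>x. min (D x x0) ?T - min (\<rho> * D x x0 + \<kappa>) ?T \<partial>\<pi>)"
      using rho kappa i1 i2 i3 
      by (intro integral_mono) (auto simp: algebra_simps split: split_indicator)
    also have "\<dots> \<le> 0" using le i1 i2 by simp
    finally have "(1 - \<rho>) * (\<integral>x. D x x0 * indicator {..?T} (D x x0) \<partial>\<pi>) \<le> \<kappa>"
      using i3 by (simp add: pi.prob_space)
    then have "(\<integral>x. D x x0 * indicator {..?T} (D x x0) \<partial>\<pi>) \<le> \<kappa> / (1 - \<rho>)"
      using rho by (simp add: pos_le_divide_eq mult.commute)
    then show ?thesis
      using i3 by (subst nn_integral_eq_integral) (auto simp: D_nonneg intro: ennreal_leI)
  qed
  have "(\<lambda>i. \<integral>\<^sup>+x. ennreal (D x x0 * indicator {..real i} (D x x0)) \<partial>\<pi>) \<longlonglongrightarrow> (\<integral>\<^sup>+x. ennreal (D x x0) \<partial>\<pi>)"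
  proof (rule nn_integral_LIMSEQ)
    show "incseq (\<lambda>i x. ennreal (D x x0 * indicator {..real i} (D x x0)))"
      by (auto simp: incseq_def le_fun_def D_nonneg split: split_indicator)
    fix x
    obtain m :: nat where m: "D x x0 \<le> real m" using real_arch_simple by blast
    have "\<forall>\<^sub>F i in sequentially. ennreal (D x x0 * indicator {..real i} (D x x0)) = ennreal (D x x0)"
      using eventually_ge_at_top[of m] by eventually_elim (use m in \<open>auto split: split_indicator\<close>)
    then show "(\<lambda>i. ennreal (D x x0 * indicator {..real i} (D x x0))) \<longlonglongrightarrow> ennreal (D x x0)"
      by (rule tendsto_eventually)
  qed measurable
  then show ?thesis using trunc by (intro LIMSEQ_le_const2) auto
qed

text \<open>Two functions are allowed because the empirical mean is later treated as a lag-0 product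
  with a constant function. The integral is over the joint space, the form in which
  \<open>V_inf\<close> is given.\<close>

definition autocov :: "'s measure \<Rightarrow> ('s \<Rightarrow> real) \<Rightarrow> ('s \<Rightarrow> real) \<Rightarrow> nat \<Rightarrow> real" where
  "autocov \<pi> u v l = (\<integral>\<omega>. u (fst \<omega>) * v (orbit stp (fst \<omega>) (snd \<omega>) l) \<partial>(\<pi> \<Otimes>\<^sub>M S))"

lemma abs_autocov_le:
  assumes inv: "invariant \<pi>"
    and u: "\<And>x. x \<in> space X \<Longrightarrow> \<bar>u x\<bar> \<le> A" and v: "\<And>x. x \<in> space X \<Longrightarrow> \<bar>v x\<bar> \<le> A"
  shows "\<bar>autocov \<pi> u v l\<bar> \<le> A\<^sup>2"
proof -
  interpret pi: prob_space \<pi> using inv by (simp add: invariant_def)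
  have spi: "space \<pi> = space X" using inv by (intro sets_eq_imp_space_eq) (simp add: invariant_def)
  interpret PS: pair_prob_space \<pi> S ..
  show ?thesis unfolding autocov_def
    by (rule PS.P.abs_expectation_le)
       (auto simp: abs_mult power2_eq_square space_pair_measure spi intro!: mult_mono' u v)
qed

lemma autocov_iterated:
  assumes inv: "invariant \<pi>" and [measurable]: "u \<in> borel_measurable X" "v \<in> borel_measurable X"
    and u: "\<And>x. x \<in> space X \<Longrightarrow> \<bar>u x\<bar> \<le> A" and v: "\<And>x. x \<in> space X \<Longrightarrow> \<bar>v x\<bar> \<le> A'"
  shows "autocov \<pi> u v l = (\<integral>x. \<integral>\<eta>. u x * v (orbit stp x \<eta> l) \<partial>S \<partial>\<pi>)"
proof -
  have sets[measurable_cong]: "sets \<pi> = sets X" using inv by (simp add: invariant_def)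
  have sp: "space \<pi> = space X" by (rule sets_eq_imp_space_eq[OF sets])
  interpret pi: prob_space \<pi> using inv by (simp add: invariant_def)
  interpret NS: pair_prob_space \<pi> S ..
  show ?thesis unfolding autocov_def
    by (subst NS.integral_fst'[symmetric])
       (auto intro!: NS.integrable_const_bound[of _ "A * A'"] AE_I2 mult_mono' u v
         simp: space_pair_measure sp abs_mult)
qed

text \<open>The conditional mean \<open>Q\<close> of \<open>v\<close> after \<open>l\<close> steps
  is Lipschitz with constant \<open>L * \<rho> ^ l\<close> and centred, so its size at x is at most
  that constant times the mean distance from x to a stationary point. Integrating against
  \<open>u\<close> gives the bound; for \<open>A = 2 * B\<close> the prefactor is the \<varsigma> of
  the theorem.\<close>

lemma autocov_decay:
  assumes inv: "invariant \<pi>" and [measurable]: "u \<in> borel_measurable X" "v \<in> borel_measurable X"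
    and u: "\<And>x. x \<in> space X \<Longrightarrow> \<bar>u x\<bar> \<le> A" and v: "\<And>x. x \<in> space X \<Longrightarrow> \<bar>v x\<bar> \<le> A'"
    and lip: "\<And>x y. x \<in> space X \<Longrightarrow> y \<in> space X \<Longrightarrow> \<bar>v x - v y\<bar> \<le> L * D x y" and L: "0 \<le> L"
    and centred: "(\<integral>x. v x \<partial>\<pi>) = 0"
    and W: "(\<integral>\<^sup>+x. \<integral>\<^sup>+y. ennreal (D x y) \<partial>\<pi> \<partial>\<pi>) \<le> ennreal W" "0 \<le> W"
  shows "\<bar>autocov \<pi> u v l\<bar> \<le> A * L * W * \<rho> ^ l"
proof -
  have sets[measurable_cong]: "sets \<pi> = sets X" using inv by (simp add: invariant_def)
  have sp: "space \<pi> = space X" by (rule sets_eq_imp_space_eq[OF sets])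
  interpret pi: prob_space \<pi> using inv by (simp add: invariant_def)
  have A: "0 \<le> A" using u[OF x0] by linarith
  have A': "0 \<le> A'" using v[OF x0] by linarith
  define Q where "Q x = (\<integral>\<eta>. v (orbit stp x \<eta> l) \<partial>S)" for x
  have [measurable]: "Q \<in> borel_measurable X" unfolding Q_def by measurable
  have iv: "integrable S (\<lambda>\<eta>. v (orbit stp x \<eta> l))" if [measurable]: "x \<in> space X" for x
    by (intro P.integrable_const_bound[of _ A']) (auto intro!: AE_I2 v simp: that)
  have Q: "\<bar>Q x\<bar> \<le> A'" if "x \<in> space X" for x
    unfolding Q_def using that A' by (intro P.abs_expectation_le v) auto
  have iQ: "integrable \<pi> Q"
    by (intro pi.integrable_const_bound[of _ A']) (auto intro!: AE_I2 Q simp: sp)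
  have Q0: "(\<integral>x. Q x \<partial>\<pi>) = 0"
  proof -
    have "(\<integral>x. Q x \<partial>\<pi>) = (\<integral>x. \<integral>\<eta>. v (fst (orbit stp x \<eta> l, \<lambda>i. \<eta> (l + i))) \<partial>S \<partial>\<pi>)"
      by (simp add: Q_def)
    also have "\<dots> = (\<integral>x. \<integral>\<eta>. v (fst (x, \<eta>)) \<partial>S \<partial>\<pi>)"
      by (rule stationary_orbit[OF inv, where C = A']) (auto intro!: v simp: space_pair_measure)
    also have "\<dots> = 0" by (simp add: P.prob_space centred)
    finally show ?thesis .
  qed
  have Qlip: "ennreal \<bar>Q x - Q y\<bar> \<le> ennreal (L * \<rho> ^ l) * ennreal (D x y)"
    if [measurable]: "x \<in> space X" "y \<in> space X" for x y
  proof -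
    have "ennreal \<bar>Q x - Q y\<bar> = ennreal (norm (\<integral>\<eta>. v (orbit stp x \<eta> l) - v (orbit stp y \<eta> l) \<partial>S))"
      using iv that by (simp add: Q_def)
    also have "\<dots> \<le> (\<integral>\<^sup>+\<eta>. norm (v (orbit stp x \<eta> l) - v (orbit stp y \<eta> l)) \<partial>S)"
      using iv that by (intro integral_norm_bound_ennreal) auto
    also have "\<dots> \<le> (\<integral>\<^sup>+\<eta>. ennreal L * ennreal (D (orbit stp x \<eta> l) (orbit stp y \<eta> l)) \<partial>S)"
      using that L by (intro nn_integral_mono) (auto intro!: ennreal_leI lip simp: ennreal_mult'[symmetric])
    also have "\<dots> = ennreal L * (\<integral>\<^sup>+\<eta>. ennreal (D (orbit stp x \<eta> l) (orbit stp y \<eta> l)) \<partial>S)"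
      by (rule nn_integral_cmult) measurable
    also have "\<dots> \<le> ennreal L * ennreal (\<rho> ^ l * D x y)"
      by (intro mult_left_mono contraction_orbit that) auto
    finally show ?thesis using L rho by (simp add: ennreal_mult' mult_ac D_nonneg)
  qed
  have Qabs: "ennreal \<bar>Q x\<bar> \<le> ennreal (L * \<rho> ^ l) * (\<integral>\<^sup>+y. ennreal (D x y) \<partial>\<pi>)"
    if [measurable]: "x \<in> space X" for x
  proof -
    have "ennreal \<bar>Q x\<bar> = ennreal (norm (\<integral>y. Q x - Q y \<partial>\<pi>))"
      using iQ by (simp add: Q0 pi.prob_space)
    also have "\<dots> \<le> (\<integral>\<^sup>+y. norm (Q x - Q y) \<partial>\<pi>)"
      using iQ by (intro integral_norm_bound_ennreal) auto
    also have "\<dots> \<le> (\<integral>\<^sup>+y. ennreal (L * \<rho> ^ l) * ennreal (D x y) \<partial>\<pi>)"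
      using that Qlip by (intro nn_integral_mono) (auto simp: sp)
    also have "\<dots> = ennreal (L * \<rho> ^ l) * (\<integral>\<^sup>+y. ennreal (D x y) \<partial>\<pi>)"
      by (rule nn_integral_cmult) measurable
    finally show ?thesis .
  qed
  have "autocov \<pi> u v l = (\<integral>x. u x * Q x \<partial>\<pi>)"
    by (subst autocov_iterated[OF inv _ _ u v]) (auto simp: Q_def)
  then have "ennreal \<bar>autocov \<pi> u v l\<bar> = ennreal (norm (\<integral>x. u x * Q x \<partial>\<pi>))" by simp
  also have "\<dots> \<le> (\<integral>\<^sup>+x. norm (u x * Q x) \<partial>\<pi>)"
    by (intro integral_norm_bound_ennreal pi.integrable_const_bound[of _ "A * A'"])
       (auto intro!: AE_I2 mult_mono' Q u simp: sp abs_mult)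
  also have "\<dots> \<le> (\<integral>\<^sup>+x. ennreal A * (ennreal (L * \<rho> ^ l) * (\<integral>\<^sup>+y. ennreal (D x y) \<partial>\<pi>)) \<partial>\<pi>)"
    by (intro nn_integral_mono) (auto simp: sp abs_mult ennreal_mult intro!: mult_mono Qabs ennreal_leI u)
  also have "\<dots> = ennreal A * (ennreal (L * \<rho> ^ l) * (\<integral>\<^sup>+x. \<integral>\<^sup>+y. ennreal (D x y) \<partial>\<pi> \<partial>\<pi>))"
    by (simp add: nn_integral_cmult)
  also have "\<dots> \<le> ennreal A * (ennreal (L * \<rho> ^ l) * ennreal W)"
    by (intro mult_left_mono W) auto
  also have "\<dots> = ennreal (A * L * W * \<rho> ^ l)"
    using A L rho W by (simp add: ennreal_mult'[symmetric] mult_ac)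
  finally show ?thesis
    using A L rho W by (subst (asm) ennreal_le_iff) auto
qed

end

section \<open>Sums of window-dependent bounded variables\<close>

text \<open>A class meets each block of length \<open>r\<close> once, hence has at most
  \<open>n div r + 1\<close> members; \<open>r \<le> n\<close> absorbs the 1 at the price of the
  factor 2.\<close>

lemma card_residue_class:
  fixes r q n :: nat
  assumes "1 \<le> r" "r \<le> n" "q \<le> n"
  shows "real (card {k\<in>{..<q}. k mod r = j}) \<le> 2 * real n / real r"
proof -
  have "{k\<in>{..<q}. k mod r = j} \<subseteq> (\<lambda>i. r * i + j) ` {..n div r}"
  proof
    fix k assume k: "k \<in> {k\<in>{..<q}. k mod r = j}"
    have "k div r \<le> n div r" using k assms by (intro div_le_mono) auto
    moreover have "k = r * (k div r) + j" using k by auto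
    ultimately show "k \<in> (\<lambda>i. r * i + j) ` {..n div r}" by blast
  qed
  then have "card {k\<in>{..<q}. k mod r = j} \<le> card ((\<lambda>i. r * i + j) ` {..n div r})"
    by (rule card_mono[rotated]) simp
  also have "\<dots> \<le> n div r + 1" using card_image_le[of "{..n div r}"] by simp
  finally have "real (card {k\<in>{..<q}. k mod r = j}) \<le> real (n div r + 1)"
    by (simp only: of_nat_le_iff)
  then have "real (card {k\<in>{..<q}. k mod r = j}) \<le> real (n div r) + 1" by simp
  also have "real (n div r) \<le> real n / real r" by (rule of_nat_div_le_of_nat)
  also have "real n / real r + 1 \<le> 2 * real n / real r"
    using assms by (simp add: field_simps)
  finally show ?thesis by simp
qed

context sequence_space begin

lemma indep_coordinates: "P.indep_vars (\<lambda>_. M) (\<lambda>i \<omega>. \<omega> i) UNIV"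
proof -
  have eq: "(\<Pi>\<^sub>M i\<in>UNIV. distr S M (\<lambda>\<omega>. \<omega> i)) = S"
    by (rule PiM_cong) (auto intro: distr_PiM_component[OF M.prob_space_axioms])
  show ?thesis
    by (subst P.indep_vars_iff_distr_eq_PiM) (auto simp: eq restrict_UNIV distr_id2)
qed

text \<open>Independence of blocks is available for functions of the restricted coordinates, whereas
  \<open>\<Phi> k\<close> takes a whole sequence. Filling the coordinates outside the window with a
  fixed sequence factors \<open>\<Phi> k\<close> through the restriction.\<close>

lemma window_indep:
  fixes r :: nat
  assumes meas: "\<And>k. \<Phi> k \<in> borel_measurable S"
    and window: "\<And>k \<eta> \<eta>'. (\<And>i. i \<in> {k..<k + r} \<Longrightarrow> \<eta> i = \<eta>' i) \<Longrightarrow> \<Phi> k \<eta> = (\<Phi> k \<eta>' :: real)"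
    and disj: "disjoint_family_on (\<lambda>k. {k..<k + r}) J"
  shows "P.indep_vars (\<lambda>_. borel) \<Phi> J"
proof -
  obtain \<eta>0 where \<eta>0: "\<eta>0 \<in> space S" using P.not_empty by blast
  define pad where "pad k z = (\<lambda>i. if i \<in> {k..<k + r} then z i else \<eta>0 i)" for k and z :: "nat \<Rightarrow> 'a"
  have [measurable]: "pad k \<in> PiM {k..<k + r} (\<lambda>_. M) \<rightarrow>\<^sub>M S" for k
  proof (rule measurable_PiM_single')
    fix i :: nat
    show "(\<lambda>z. pad k z i) \<in> PiM {k..<k + r} (\<lambda>_. M) \<rightarrow>\<^sub>M M"
    proof (cases "i \<in> {k..<k + r}")
      case True then show ?thesis unfolding pad_def by simp
    next
      case False
      then have "(\<lambda>z. pad k z i) = (\<lambda>_. \<eta>0 i)" by (auto simp: pad_def)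
      then show ?thesis using \<eta>0 by (auto simp: space_PiM PiE_iff)
    qed
  qed (use \<eta>0 in \<open>auto simp: space_PiM PiE_iff pad_def\<close>)
  have "P.indep_vars (\<lambda>j. PiM {j..<j + r} (\<lambda>_. M)) (\<lambda>j \<omega>. restrict (\<lambda>i. \<omega> i) {j..<j + r}) J"
    by (rule P.indep_vars_restrict[OF indep_coordinates]) (use disj in auto)
  then have "P.indep_vars (\<lambda>_. borel) (\<lambda>j \<omega>. (\<Phi> j \<circ> pad j) (restrict (\<lambda>i. \<omega> i) {j..<j + r})) J"
    by (rule P.indep_vars_compose2) (use meas in measurable)
  moreover have "\<Phi> j = (\<lambda>\<omega>. (\<Phi> j \<circ> pad j) (restrict (\<lambda>i. \<omega> i) {j..<j + r}))" for j
    by (rule ext, unfold o_apply, rule window) (simp add: pad_def)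
  ultimately show ?thesis by simp
qed

text \<open>Within a residue class modulo \<open>r\<close> the windows are disjoint. If the total
  deviation reaches \<open>r * t\<close>, one of the \<open>r\<close> classes deviates by at least
  \<open>t\<close>; this puts one factor \<open>r\<close> under the root and one in front of the
  exponential.\<close>

lemma window_Hoeffding:
  fixes A lam :: real and r q n :: nat
  assumes meas: "\<And>k. \<Phi> k \<in> borel_measurable S"
    and window: "\<And>k \<eta> \<eta>'. (\<And>i. i \<in> {k..<k + r} \<Longrightarrow> \<eta> i = \<eta>' i) \<Longrightarrow> \<Phi> k \<eta> = (\<Phi> k \<eta>' :: real)"
    and bd: "\<And>k \<eta>. \<eta> \<in> space S \<Longrightarrow> \<bar>\<Phi> k \<eta>\<bar> \<le> A"
    and A: "0 < A" and r: "1 \<le> r" "r \<le> n" "q \<le> n" and lam: "0 < lam"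
  shows "measure S {\<eta>\<in>space S. 2 * A * sqrt (n * r * lam) \<le> \<bar>(\<Sum>k<q. \<Phi> k \<eta> - (\<integral>\<eta>. \<Phi> k \<eta> \<partial>S))\<bar>}
    \<le> 2 * r * exp (- lam)"
proof -
  note [measurable] = meas
  define I where "I j = {k\<in>{..<q}. k mod r = j}" for j
  \<comment> \<open>A class has at most \<open>2 * n / r\<close> members, each with range
    \<open>2 * A\<close>, so this \<open>t\<close> makes Hoeffding's exponent at least
    \<open>lam\<close>.\<close>
  define t where "t = 2 * A * sqrt (n / r * lam)"
  have t: "0 < t" using A r lam by (auto simp: t_def)
  have t2: "t\<^sup>2 = 4 * A\<^sup>2 * (n / r * lam)" using lam by (simp add: t_def power_mult_distrib)
  have rt: "real r * t = 2 * A * sqrt (n * r * lam)"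
  proof -
    have "sqrt (n * r * lam) = sqrt ((real r)\<^sup>2 * (n / r * lam))" using r by (simp add: power2_eq_square)
    also have "\<dots> = r * sqrt (n / r * lam)" by (subst real_sqrt_mult) simp
    finally show ?thesis by (simp add: t_def)
  qed
  define E where "E j = {\<eta>\<in>space S. t \<le> \<bar>(\<Sum>k\<in>I j. \<Phi> k \<eta>) - (\<Sum>k\<in>I j. \<integral>\<eta>. \<Phi> k \<eta> \<partial>S)\<bar>}" for j
  have E[measurable]: "E j \<in> sets S" for j unfolding E_def by measurable
  have residue: "measure S (E j) \<le> 2 * exp (- lam)" for j
  proof (cases "I j = {}")
    case True
    then have "E j = {}" using t by (auto simp: E_def)
    then show ?thesis by simp
  next
    case False
    have fin: "finite (I j)" by (simp add: I_def)
    interpret H: Hoeffding_ineq S "I j" \<Phi> "\<lambda>_. - A" "\<lambda>_. A" "\<Sum>k\<in>I j. \<integral>\<eta>. \<Phi> k \<eta> \<partial>S"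
    proof (unfold_locales, goal_cases)
      case 2
      show ?case
      proof (rule window_indep[OF meas window])
        show "disjoint_family_on (\<lambda>k. {k..<k + r}) (I j)"
        proof (unfold disjoint_family_on_def, intro ballI impI)
          fix k k' assume kk: "k \<in> I j" "k' \<in> I j" "k \<noteq> k'"
          have *: "a + r \<le> b" if "a \<in> I j" "b \<in> I j" "a < b" for a b
          proof -
            have "r dvd b - a" using that mod_eq_dvd_iff_nat[of a b r] by (simp add: I_def)
            then show ?thesis using that by (auto dest: dvd_imp_le)
          qed
          show "{k..<k + r} \<inter> {k'..<k' + r} = {}"
            using *[of k k'] *[of k' k] kk by (cases k k' rule: linorder_cases) auto
        qed
      qed
    next
      case (3 i)
      have "- A \<le> \<Phi> i \<eta> \<and> \<Phi> i \<eta> \<le> A" if "\<eta> \<in> space S" for \<eta>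
        using bd[OF that, of i] by linarith
      then show ?case by (intro AE_I2) auto
    qed (use fin in auto)
    have c: "0 < card (I j)" using False fin by (simp add: card_gt_0_iff)
    have sum: "(\<Sum>i\<in>I j. (A - - A)\<^sup>2) = card (I j) * (4 * A\<^sup>2)" by (simp add: power2_eq_square)
    have "measure S (E j) \<le> 2 * exp (- 2 * t\<^sup>2 / (\<Sum>i\<in>I j. (A - - A)\<^sup>2))"
      unfolding E_def using t A c sum by (intro H.Hoeffding_ineq_abs_ge) auto
    also have "\<dots> \<le> 2 * exp (- lam)"
    proof -
      have "lam * (card (I j) * (4 * A\<^sup>2)) \<le> lam * ((2 * n / r) * (4 * A\<^sup>2))"
        using lam A card_residue_class[OF r, of j] unfolding I_def
        by (intro mult_left_mono mult_right_mono) auto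
      also have "\<dots> = 2 * t\<^sup>2" by (simp add: t2)
      finally have "lam \<le> 2 * t\<^sup>2 / (card (I j) * (4 * A\<^sup>2))"
        using c A by (simp add: pos_le_divide_eq)
      then show ?thesis by (simp add: sum)
    qed
    finally show ?thesis .
  qed
  have "{\<eta>\<in>space S. 2 * A * sqrt (n * r * lam) \<le> \<bar>(\<Sum>k<q. \<Phi> k \<eta> - (\<integral>\<eta>. \<Phi> k \<eta> \<partial>S))\<bar>} \<subseteq> (\<Union>j<r. E j)"
  proof safe
    fix \<eta> assume \<eta>: "\<eta> \<in> space S" and big: "2 * A * sqrt (n * r * lam) \<le> \<bar>(\<Sum>k<q. \<Phi> k \<eta> - (\<integral>\<eta>. \<Phi> k \<eta> \<partial>S))\<bar>"
    show "\<eta> \<in> (\<Union>j<r. E j)"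
    proof (rule ccontr)
      assume "\<eta> \<notin> (\<Union>j<r. E j)"
      then have small: "\<bar>(\<Sum>k\<in>I j. \<Phi> k \<eta> - (\<integral>\<eta>. \<Phi> k \<eta> \<partial>S))\<bar> < t" if "j < r" for j
        using \<eta> that by (auto simp: E_def sum_subtractf not_le)
      have "(\<Sum>k<q. \<Phi> k \<eta> - (\<integral>\<eta>. \<Phi> k \<eta> \<partial>S)) = (\<Sum>j<r. \<Sum>k\<in>I j. \<Phi> k \<eta> - (\<integral>\<eta>. \<Phi> k \<eta> \<partial>S))"
        unfolding I_def by (rule sum.group[symmetric]) (use r in auto)
      then have "\<bar>(\<Sum>k<q. \<Phi> k \<eta> - (\<integral>\<eta>. \<Phi> k \<eta> \<partial>S))\<bar> \<le> (\<Sum>j<r. \<bar>\<Sum>k\<in>I j. \<Phi> k \<eta> - (\<integral>\<eta>. \<Phi> k \<eta> \<partial>S)\<bar>)"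
        by simp
      also have "\<dots> < (\<Sum>j<r. t)"
        by (rule sum_strict_mono) (use r small in \<open>auto simp: lessThan_empty_iff\<close>)
      finally show False using big rt by simp
    qed
  qed
  then have "measure S {\<eta>\<in>space S. 2 * A * sqrt (n * r * lam) \<le> \<bar>(\<Sum>k<q. \<Phi> k \<eta> - (\<integral>\<eta>. \<Phi> k \<eta> \<partial>S))\<bar>}
      \<le> measure S (\<Union>j<r. E j)"
    by (rule P.finite_measure_mono) measurable
  also have "\<dots> \<le> (\<Sum>j<r. measure S (E j))"
    by (rule measure_UNION_le) auto
  also have "\<dots> \<le> (\<Sum>j<r. 2 * exp (- lam))" by (intro sum_mono residue)
  finally show ?thesis by simp
qed

end

section \<open>Concentration of empirical covariances\<close>

lemma sum_lessThan_add: "(\<Sum>k<a + q. f k) = (\<Sum>k<a. f k) + (\<Sum>k<q. f (a + k))"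
  for f :: "nat \<Rightarrow> 'a::comm_monoid_add"
  by (induction q) (auto simp: add_ac)

lemma abs_mult_diff_le:
  fixes a b a' b' :: real
  assumes "\<bar>a\<bar> \<le> A" "\<bar>b'\<bar> \<le> A" "\<bar>a - a'\<bar> \<le> e" "\<bar>b - b'\<bar> \<le> e'"
  shows "\<bar>a * b - a' * b'\<bar> \<le> A * (e + e')"
proof -
  have "a * b - a' * b' = a * (b - b') + (a - a') * b'" by (simp add: algebra_simps)
  also have "\<bar>\<dots>\<bar> \<le> A * e' + e * A"
    unfolding abs_mult[symmetric]
    by (rule order_trans[OF abs_triangle_ineq]) (auto simp: abs_mult intro!: add_mono mult_mono' assms)
  finally show ?thesis by (simp add: algebra_simps)
qed

context contractive_chain begin

text \<open>The windowed product is compared with the product along a stationary trajectory driven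
  by the same innovations. The 4 counts the two windows and, for each, the mean distance from \<pi>
  to \<open>x0\<close> plus the accumulated drift, both at most
  \<open>\<kappa> / (1 - \<rho>)\<close>.\<close>

lemma window_bias:
  assumes inv: "invariant \<pi>" and [measurable]: "u \<in> borel_measurable X" "v \<in> borel_measurable X"
    and u: "\<And>x. x \<in> space X \<Longrightarrow> \<bar>u x\<bar> \<le> A" and v: "\<And>x. x \<in> space X \<Longrightarrow> \<bar>v x\<bar> \<le> A"
    and ulip: "\<And>x y. x \<in> space X \<Longrightarrow> y \<in> space X \<Longrightarrow> \<bar>u x - u y\<bar> \<le> L * D x y"
    and vlip: "\<And>x y. x \<in> space X \<Longrightarrow> y \<in> space X \<Longrightarrow> \<bar>v x - v y\<bar> \<le> L * D x y" and L: "0 \<le> L"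
  shows "\<bar>(\<integral>\<eta>. u (orbit stp x0 (\<lambda>i. \<eta> (k + i)) s) * v (orbit stp x0 (\<lambda>i. \<eta> (k + l + i)) s) \<partial>S)
      - autocov \<pi> u v l\<bar> \<le> 4 * A * L * \<rho> ^ s * \<kappa> / (1 - \<rho>)"
proof -
  have sets[measurable_cong]: "sets \<pi> = sets X" using inv by (simp add: invariant_def)
  have sp: "space \<pi> = space X" by (rule sets_eq_imp_space_eq[OF sets])
  interpret pi: prob_space \<pi> using inv by (simp add: invariant_def)
  have A: "0 \<le> A" using u[OF x0] by linarith
  let ?w = "\<lambda>\<eta> k. orbit stp x0 (\<lambda>i. \<eta> (k + i)) s"
  have w: "?w \<eta> k \<in> space X" if "\<eta> \<in> space S" for \<eta> k
    using that by (intro orbit_space) (auto simp: space_PiM PiE_iff)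
  \<comment> \<open>The window opened at \<open>k\<close> uses the innovations from \<open>k\<close>
    to \<open>k + s - 1\<close> and so imitates the state at time \<open>k + s\<close>, not
    \<open>k\<close>. By stationarity the products at times \<open>k + s\<close> and
    \<open>k + l + s\<close> still have mean \<open>autocov\<close>.\<close>
  define a where "a x \<eta> = u (orbit stp x \<eta> (k + s)) * v (orbit stp x \<eta> (k + l + s))" for x \<eta>
  define b where "b \<eta> = u (?w \<eta> k) * v (?w \<eta> (k + l))" for \<eta>
  have [measurable]: "(\<lambda>z. a (fst z) (snd z)) \<in> borel_measurable (X \<Otimes>\<^sub>M S)" "b \<in> borel_measurable S"
    unfolding a_def b_def by measurable
  have a_meas[measurable]: "a x \<in> borel_measurable S" if [measurable]: "x \<in> space X" for x
    unfolding a_def by measurable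
  have abd: "\<bar>a x \<eta>\<bar> \<le> A * A" if "x \<in> space X" "\<eta> \<in> space S" for x \<eta>
    unfolding a_def abs_mult using that by (intro mult_mono' u v) auto
  have bbd: "\<bar>b \<eta>\<bar> \<le> A * A" if "\<eta> \<in> space S" for \<eta>
    unfolding b_def abs_mult using that w by (intro mult_mono' u v) auto
  have ia: "integrable S (a x)" if "x \<in> space X" for x
    using that by (intro P.integrable_const_bound[of _ "A * A"] AE_I2) (auto intro: abd)
  have ib: "integrable S b"
    by (intro P.integrable_const_bound[of _ "A * A"] AE_I2) (auto intro: bbd)
  have "autocov \<pi> u v l = (\<integral>x. \<integral>\<eta>. u (fst (x, \<eta>)) * v (orbit stp (fst (x, \<eta>)) (snd (x, \<eta>)) l) \<partial>S \<partial>\<pi>)"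
    by (subst autocov_iterated[OF inv _ _ u v]) auto
  also have "\<dots> = (\<integral>x. \<integral>\<eta>. u (fst (orbit stp x \<eta> (k + s), \<lambda>i. \<eta> (k + s + i)))
      * v (orbit stp (fst (orbit stp x \<eta> (k + s), \<lambda>i. \<eta> (k + s + i))) (snd (orbit stp x \<eta> (k + s), \<lambda>i. \<eta> (k + s + i))) l) \<partial>S \<partial>\<pi>)"
    by (rule stationary_orbit[OF inv, symmetric, where C = "A * A"])
       (auto intro!: mult_mono' u v simp: space_pair_measure abs_mult)
  also have "\<dots> = (\<integral>x. \<integral>\<eta>. a x \<eta> \<partial>S \<partial>\<pi>)"
  proof -
    have "k + l + s = k + s + l" by simp
    then show ?thesis by (simp only: a_def orbit_add fst_conv snd_conv)
  qed
  finally have cov: "autocov \<pi> u v l = (\<integral>x. \<integral>\<eta>. a x \<eta> \<partial>S \<partial>\<pi>)" .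
  have ipa: "integrable \<pi> (\<lambda>x. \<integral>\<eta>. a x \<eta> \<partial>S)"
    using A by (intro pi.integrable_const_bound[of _ "A * A"] AE_I2) 
      (auto simp: sp intro!: P.abs_expectation_le abd)
  have "(\<integral>\<eta>. b \<eta> \<partial>S) - autocov \<pi> u v l = (\<integral>x. (\<integral>\<eta>. b \<eta> \<partial>S) - (\<integral>\<eta>. a x \<eta> \<partial>S) \<partial>\<pi>)"
    using ipa by (simp add: cov pi.prob_space)
  also have "\<dots> = (\<integral>x. \<integral>\<eta>. b \<eta> - a x \<eta> \<partial>S \<partial>\<pi>)"
    using ia ib by (intro Bochner_Integration.integral_cong) (auto simp: sp)
  finally have eq: "(\<integral>\<eta>. b \<eta> \<partial>S) - autocov \<pi> u v l = (\<integral>x. \<integral>\<eta>. b \<eta> - a x \<eta> \<partial>S \<partial>\<pi>)" .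
  have inner: "ennreal (norm (\<integral>\<eta>. b \<eta> - a x \<eta> \<partial>S))
      \<le> ennreal (2 * A * L * \<rho> ^ s) * (ennreal (D x x0) + ennreal (\<kappa> / (1 - \<rho>)))"
    if x[measurable]: "x \<in> space X" for x
  proof -
    let ?d = "\<lambda>\<eta> k. D (orbit stp x \<eta> (k + s)) (?w \<eta> k)"
    have "ennreal (norm (\<integral>\<eta>. b \<eta> - a x \<eta> \<partial>S)) \<le> (\<integral>\<^sup>+\<eta>. norm (b \<eta> - a x \<eta>) \<partial>S)"
      using ia ib x by (intro integral_norm_bound_ennreal) auto
    also have "\<dots> \<le> (\<integral>\<^sup>+\<eta>. ennreal (A * L) * (ennreal (?d \<eta> k) + ennreal (?d \<eta> (k + l))) \<partial>S)"
    proof (rule nn_integral_mono)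
      fix \<eta> assume \<eta>: "\<eta> \<in> space S"
      have "\<bar>a x \<eta> - b \<eta>\<bar> \<le> A * (L * ?d \<eta> k + L * ?d \<eta> (k + l))"
        unfolding a_def b_def using \<eta> x w by (intro abs_mult_diff_le u v ulip vlip) auto
      then have "ennreal (norm (b \<eta> - a x \<eta>)) \<le> ennreal (A * L * (?d \<eta> k + ?d \<eta> (k + l)))"
        by (intro ennreal_leI) (simp add: abs_minus_commute algebra_simps)
      also have "\<dots> = ennreal (A * L) * (ennreal (?d \<eta> k) + ennreal (?d \<eta> (k + l)))"
        using A L by (simp add: ennreal_mult' D_nonneg)
      finally show "ennreal (norm (b \<eta> - a x \<eta>)) \<le> ennreal (A * L) * (ennreal (?d \<eta> k) + ennreal (?d \<eta> (k + l)))" .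
    qed
    also have "\<dots> = ennreal (A * L) * ((\<integral>\<^sup>+\<eta>. ennreal (?d \<eta> k) \<partial>S) + (\<integral>\<^sup>+\<eta>. ennreal (?d \<eta> (k + l)) \<partial>S))"
      by (subst nn_integral_cmult, measurable) (subst nn_integral_add, auto)
    also have "\<dots> \<le> ennreal (A * L) * (ennreal (\<rho> ^ s) * (ennreal (D x x0) + ennreal (\<kappa> / (1 - \<rho>)))
        + ennreal (\<rho> ^ s) * (ennreal (D x x0) + ennreal (\<kappa> / (1 - \<rho>))))"
      by (intro mult_left_mono add_mono coupling' x) auto
    also have "\<dots> = ennreal (2 * A * L * \<rho> ^ s) * (ennreal (D x x0) + ennreal (\<kappa> / (1 - \<rho>)))"
      using A L rho kappa D_nonneg[of x x0]
      by (simp add: ennreal_plus[symmetric] ennreal_mult'[symmetric] mult_ac del: ennreal_plus)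
    finally show ?thesis .
  qed
  have abd_bbd: "\<bar>b \<eta> - a x \<eta>\<bar> \<le> 2 * (A * A)" if "x \<in> space X" "\<eta> \<in> space S" for x \<eta>
    using abd[OF that] bbd[OF that(2)] by linarith
  have "ennreal \<bar>(\<integral>\<eta>. b \<eta> \<partial>S) - autocov \<pi> u v l\<bar> \<le> (\<integral>\<^sup>+x. norm (\<integral>\<eta>. b \<eta> - a x \<eta> \<partial>S) \<partial>\<pi>)"
    unfolding eq real_norm_def[symmetric]
    using A by (intro integral_norm_bound_ennreal pi.integrable_const_bound[of _ "2 * (A * A)"] AE_I2)
      (auto simp: sp intro!: P.abs_expectation_le[OF abd_bbd])
  also have "\<dots> \<le> (\<integral>\<^sup>+x. ennreal (2 * A * L * \<rho> ^ s) * (ennreal (D x x0) + ennreal (\<kappa> / (1 - \<rho>))) \<partial>\<pi>)"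
    by (intro nn_integral_mono inner) (simp add: sp)
  also have "\<dots> = ennreal (2 * A * L * \<rho> ^ s) * ((\<integral>\<^sup>+x. ennreal (D x x0) \<partial>\<pi>) + ennreal (\<kappa> / (1 - \<rho>)))"
    by (subst nn_integral_cmult, measurable) (subst nn_integral_add, auto simp: pi.emeasure_space_1)
  also have "\<dots> \<le> ennreal (2 * A * L * \<rho> ^ s) * (ennreal (\<kappa> / (1 - \<rho>)) + ennreal (\<kappa> / (1 - \<rho>)))"
    by (intro mult_left_mono add_mono invariant_first_moment inv) auto
  also have "\<dots> = ennreal (4 * A * L * \<rho> ^ s * \<kappa> / (1 - \<rho>))"
    using A L rho kappa
    by (simp add: ennreal_plus[symmetric] ennreal_mult'[symmetric] mult_ac del: ennreal_plus)
  finally show ?thesis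
    using A L rho kappa unfolding b_def by (subst (asm) ennreal_le_iff) auto
qed

text \<open>The index set bundles functions and lags so that one event serves all of them. Half of
  \<delta> goes to Markov's inequality for the summed window distances, an event independent of
  \<open>i\<close>, and half to a union bound over Hoeffding's inequality. The error terms are, in
  order: the part of the sum not matched by windows, the windowing error along the trajectory from
  \<xi>, the bias of the windowed means, and the fluctuation of the windowed products.\<close>

lemma lag_estimate:
  fixes U V :: "'i \<Rightarrow> 's \<Rightarrow> real" and lag :: "'i \<Rightarrow> nat"
  assumes xi: "prob_space \<xi>" "sets \<xi> = sets X" "(\<integral>\<^sup>+x. ennreal (D x x0) \<partial>\<xi>) \<le> ennreal C0" "0 < C0"
    and inv: "invariant \<pi>" and I: "finite I"
    and meas: "\<And>i. i \<in> I \<Longrightarrow> U i \<in> borel_measurable X" "\<And>i. i \<in> I \<Longrightarrow> V i \<in> borel_measurable X"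
    and u: "\<And>i x. i \<in> I \<Longrightarrow> x \<in> space X \<Longrightarrow> \<bar>U i x\<bar> \<le> A"
    and v: "\<And>i x. i \<in> I \<Longrightarrow> x \<in> space X \<Longrightarrow> \<bar>V i x\<bar> \<le> A"
    and ulip: "\<And>i x y. i \<in> I \<Longrightarrow> x \<in> space X \<Longrightarrow> y \<in> space X \<Longrightarrow> \<bar>U i x - U i y\<bar> \<le> L * D x y"
    and vlip: "\<And>i x y. i \<in> I \<Longrightarrow> x \<in> space X \<Longrightarrow> y \<in> space X \<Longrightarrow> \<bar>V i x - V i y\<bar> \<le> L * D x y"
    and L: "0 \<le> L" and A: "0 < A" and rho0: "0 < \<rho>"
    and r: "\<And>i. i \<in> I \<Longrightarrow> lag i + s \<le> r" "1 \<le> r" "r \<le> n"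
    and \<delta>: "0 < \<delta>" and lam: "0 < lam" "real (card I) * (2 * r * exp (- lam)) \<le> \<delta> / 2"
  shows "\<exists>E\<in>sets (\<xi> \<Otimes>\<^sub>M S). measure (\<xi> \<Otimes>\<^sub>M S) E \<ge> 1 - \<delta> \<and> (\<forall>\<omega>\<in>E. \<forall>i\<in>I.
    \<bar>(\<Sum>k<n - lag i. U i (orbit stp (fst \<omega>) (snd \<omega>) k) * V i (orbit stp (fst \<omega>) (snd \<omega>) (k + lag i)))
      - n * autocov \<pi> (U i) (V i) (lag i)\<bar>
    \<le> 2 * r * A\<^sup>2 + 4 * A * L * n * \<rho> ^ s * (C0 + \<kappa> / (1 - \<rho>)) / \<delta>
      + 4 * A * L * n * \<rho> ^ s * \<kappa> / (1 - \<rho>) + 2 * A\<^sup>2 * sqrt (n * r * lam))"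
proof -
  note sets[measurable_cong] = xi(2)
  have sp: "space \<xi> = space X" by (rule sets_eq_imp_space_eq[OF sets])
  have sp2: "space (\<xi> \<Otimes>\<^sub>M S) = space X \<times> space S" by (simp add: space_pair_measure sp)
  interpret xi: prob_space \<xi> by (rule xi)
  interpret XS: pair_prob_space \<xi> S ..
  interpret pi: prob_space \<pi> using inv by (simp add: invariant_def)
  define C1 where "C1 = C0 + \<kappa> / (1 - \<rho>)"
  have C1: "0 < C1" using xi(4) kappa rho by (simp add: C1_def add_pos_nonneg)
  \<comment> \<open>The summed window distances have mean at most
    \<open>n * \<rho> ^ s * C1\<close>, so Markov's inequality at level \<open>T\<close> has
    probability at most \<open>\<delta> / 2\<close>.\<close>
  define T where "T = 2 * n * \<rho> ^ s * C1 / \<delta>"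
  have n: "0 < n" using r by simp
  have T: "0 < T" using n rho0 C1 \<delta> by (simp add: T_def)
  let ?w = "\<lambda>\<eta> k. orbit stp x0 (\<lambda>i. \<eta> (k + i)) s"
  have w: "?w \<eta> k \<in> space X" if "\<eta> \<in> space S" for \<eta> k
    using that by (intro orbit_space) (auto simp: space_PiM PiE_iff)
  define d where "d k \<omega> = D (orbit stp (fst \<omega>) (snd \<omega>) (k + s)) (?w (snd \<omega>) k)" for k \<omega>
  have [measurable]: "d k \<in> borel_measurable (\<xi> \<Otimes>\<^sub>M S)" for k unfolding d_def by measurable
  have d0: "0 \<le> d k \<omega>" for k \<omega> by (simp add: d_def D_nonneg)
  have Ed: "(\<integral>\<^sup>+\<omega>. ennreal (d k \<omega>) \<partial>(\<xi> \<Otimes>\<^sub>M S)) \<le> ennreal (\<rho> ^ s * C1)" for k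
  proof -
    have "(\<integral>\<^sup>+\<omega>. ennreal (d k \<omega>) \<partial>(\<xi> \<Otimes>\<^sub>M S)) = (\<integral>\<^sup>+x. \<integral>\<^sup>+\<eta>. ennreal (d k (x, \<eta>)) \<partial>S \<partial>\<xi>)"
      by (subst P.nn_integral_fst[symmetric]) auto
    also have "\<dots> \<le> (\<integral>\<^sup>+x. ennreal (\<rho> ^ s) * (ennreal (D x x0) + ennreal (\<kappa> / (1 - \<rho>))) \<partial>\<xi>)"
      unfolding d_def fst_conv snd_conv by (intro nn_integral_mono coupling') (simp add: sp)
    also have "\<dots> = ennreal (\<rho> ^ s) * ((\<integral>\<^sup>+x. ennreal (D x x0) \<partial>\<xi>) + ennreal (\<kappa> / (1 - \<rho>)))"
      by (subst nn_integral_cmult, measurable) (subst nn_integral_add, auto simp: xi.emeasure_space_1)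
    also have "\<dots> \<le> ennreal (\<rho> ^ s) * (ennreal C0 + ennreal (\<kappa> / (1 - \<rho>)))"
      by (intro mult_left_mono add_mono xi) auto
    also have "\<dots> = ennreal (\<rho> ^ s * C1)"
      using rho kappa xi(4) by (simp add: C1_def ennreal_mult')
    finally show ?thesis .
  qed
  define B1 where "B1 = {\<omega>\<in>space (\<xi> \<Otimes>\<^sub>M S). 1 \<le> ennreal (1 / T) * (\<Sum>k<n. ennreal (d k \<omega>))}"
  have B1[measurable]: "B1 \<in> sets (\<xi> \<Otimes>\<^sub>M S)" unfolding B1_def by measurable
  have "emeasure (\<xi> \<Otimes>\<^sub>M S) B1 \<le> ennreal (1 / T) * (\<integral>\<^sup>+\<omega>. (\<Sum>k<n. ennreal (d k \<omega>)) * indicator (space (\<xi> \<Otimes>\<^sub>M S)) \<omega> \<partial>(\<xi> \<Otimes>\<^sub>M S))"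
    using nn_integral_Markov_inequality[of "\<lambda>\<omega>. \<Sum>k<n. ennreal (d k \<omega>)" "space (\<xi> \<Otimes>\<^sub>M S)" "\<xi> \<Otimes>\<^sub>M S" "ennreal (1 / T)"]
    by (simp add: B1_def Int_absorb2 subset_eq Int_commute)
  also have "\<dots> = ennreal (1 / T) * (\<Sum>k<n. \<integral>\<^sup>+\<omega>. ennreal (d k \<omega>) \<partial>(\<xi> \<Otimes>\<^sub>M S))"
    by (subst nn_integral_sum[symmetric]) (auto intro!: arg_cong2[where f = "(*)"] nn_integral_cong)
  also have "\<dots> \<le> ennreal (1 / T) * (\<Sum>k<n. ennreal (\<rho> ^ s * C1))"
    by (intro mult_left_mono sum_mono Ed) auto
  also have "\<dots> = ennreal (\<delta> / 2)"
  proof -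
    have "(\<Sum>k<n. ennreal (\<rho> ^ s * C1)) = ennreal (n * (\<rho> ^ s * C1))"
      using rho C1 by (subst sum_ennreal) auto
    moreover have "1 / T * (n * (\<rho> ^ s * C1)) = \<delta> / 2"
      using T n rho0 C1 \<delta> by (simp add: T_def field_simps)
    ultimately show ?thesis using T by (simp only: ennreal_mult'[symmetric] divide_nonneg_pos zero_le_one)
  qed
  finally have mB1: "measure (\<xi> \<Otimes>\<^sub>M S) B1 \<le> \<delta> / 2"
    using \<delta> by (simp add: XS.P.emeasure_eq_measure)
  define \<Phi> where "\<Phi> i k \<eta> = U i (?w \<eta> k) * V i (?w \<eta> (k + lag i))" for i k \<eta>
  have [measurable]: "\<Phi> i k \<in> borel_measurable S" if "i \<in> I" for i k
    using meas[OF that] unfolding \<Phi>_def by measurable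
  have \<Phi>bd: "\<bar>\<Phi> i k \<eta>\<bar> \<le> A\<^sup>2" if "i \<in> I" "\<eta> \<in> space S" for i k \<eta>
    unfolding \<Phi>_def abs_mult power2_eq_square using that w by (intro mult_mono' u v) auto
  define q where "q i = n - lag i - s" for i
  define H where "H i = {\<eta>\<in>space S. 2 * A\<^sup>2 * sqrt (n * r * lam) \<le> \<bar>\<Sum>k<q i. \<Phi> i k \<eta> - (\<integral>\<eta>. \<Phi> i k \<eta> \<partial>S)\<bar>}" for i
  have H[measurable]: "H i \<in> sets S" if "i \<in> I" for i unfolding H_def using that by measurable
  have mH: "measure S (H i) \<le> 2 * r * exp (- lam)" if i: "i \<in> I" for i
    unfolding H_def
  proof (rule window_Hoeffding)
    fix k \<eta> \<eta>' assume eq: "\<And>j. j \<in> {k..<k + r} \<Longrightarrow> \<eta> j = (\<eta>' j :: 'v)"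
    have "?w \<eta> k = ?w \<eta>' k" "?w \<eta> (k + lag i) = ?w \<eta>' (k + lag i)"
      using r(1)[OF i] by (auto intro!: orbit_cong eq)
    then show "\<Phi> i k \<eta> = \<Phi> i k \<eta>'" by (simp add: \<Phi>_def)
  qed (use i \<Phi>bd A r lam in \<open>auto simp: q_def\<close>)
  define B2 where "B2 = space \<xi> \<times> (\<Union>i\<in>I. H i)"
  have UH[measurable]: "(\<Union>i\<in>I. H i) \<in> sets S" using I H by auto
  have B2[measurable]: "B2 \<in> sets (\<xi> \<Otimes>\<^sub>M S)" unfolding B2_def by measurable
  have "measure (\<xi> \<Otimes>\<^sub>M S) B2 = measure S (\<Union>i\<in>I. H i)"
    unfolding B2_def measure_def by (subst P.emeasure_pair_measure_Times) (auto simp: xi.emeasure_space_1)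
  also have "\<dots> \<le> (\<Sum>i\<in>I. measure S (H i))" by (rule measure_UNION_le) (auto simp: I)
  also have "\<dots> \<le> (\<Sum>i\<in>I. 2 * r * exp (- lam))" by (rule sum_mono) (rule mH)
  also have "\<dots> \<le> \<delta> / 2" using lam by simp
  finally have mB2: "measure (\<xi> \<Otimes>\<^sub>M S) B2 \<le> \<delta> / 2" .
  define E where "E = space (\<xi> \<Otimes>\<^sub>M S) - (B1 \<union> B2)"
  have E: "E \<in> sets (\<xi> \<Otimes>\<^sub>M S)" unfolding E_def by measurable
  have "measure (\<xi> \<Otimes>\<^sub>M S) (B1 \<union> B2) \<le> measure (\<xi> \<Otimes>\<^sub>M S) B1 + measure (\<xi> \<Otimes>\<^sub>M S) B2"
    by (rule measure_Un_le) auto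
  then have prob: "1 - \<delta> \<le> measure (\<xi> \<Otimes>\<^sub>M S) E"
    unfolding E_def using mB1 mB2 by (subst XS.P.prob_compl) auto
  have bound: "\<bar>(\<Sum>k<n - lag i. U i (orbit stp (fst \<omega>) (snd \<omega>) k) * V i (orbit stp (fst \<omega>) (snd \<omega>) (k + lag i)))
      - real n * autocov \<pi> (U i) (V i) (lag i)\<bar>
    \<le> 2 * real r * A\<^sup>2 + 4 * A * L * n * \<rho> ^ s * C1 / \<delta>
      + 4 * A * L * n * \<rho> ^ s * \<kappa> / (1 - \<rho>) + 2 * A\<^sup>2 * sqrt (real n * real r * lam)"
    if \<omega>: "\<omega> \<in> E" and i: "i \<in> I" for \<omega> i
  proof -
    define x \<eta> l where "x = fst \<omega>" and "\<eta> = snd \<omega>" and "l = lag i"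
    have x: "x \<in> space X" and \<eta>: "\<eta> \<in> space S" using \<omega> by (auto simp: E_def sp2 x_def \<eta>_def)
    let ?X = "orbit stp x \<eta>"
    have X: "?X k \<in> space X" for k using x \<eta> by simp
    define y where "y k = U i (?X k) * V i (?X (k + l))" for k
    have ybd: "\<bar>y k\<bar> \<le> A\<^sup>2" for k
      unfolding y_def abs_mult power2_eq_square using i X by (intro mult_mono' u v) auto
    define c where "c = autocov \<pi> (U i) (V i) l"
    have cbd: "\<bar>c\<bar> \<le> A\<^sup>2"
      unfolding c_def using i by (intro abs_autocov_le inv u v)
    have sumd: "(\<Sum>k<n. d k \<omega>) \<le> T"
    proof -
      have "\<omega> \<notin> B1" using \<omega> by (auto simp: E_def)
      then have "ennreal (1 / T) * (\<Sum>k<n. ennreal (d k \<omega>)) < 1" using \<omega> by (simp add: B1_def E_def)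
      then have "ennreal (1 / T * (\<Sum>k<n. d k \<omega>)) < ennreal 1"
        using T d0 by (subst ennreal_mult') (auto simp: sum_nonneg sum_ennreal)
      moreover have "0 \<le> 1 / T * (\<Sum>k<n. d k \<omega>)"
        using T by (intro mult_nonneg_nonneg sum_nonneg d0) auto
      ultimately have "1 / T * (\<Sum>k<n. d k \<omega>) < 1" by (simp add: ennreal_less_iff)
      then show ?thesis using T by (simp add: field_simps)
    qed
    have hoeff: "\<bar>\<Sum>k<q i. \<Phi> i k \<eta> - (\<integral>\<eta>. \<Phi> i k \<eta> \<partial>S)\<bar> \<le> 2 * A\<^sup>2 * sqrt (n * r * lam)"
    proof -
      have "\<eta> \<notin> H i" using \<omega> i by (auto simp: E_def B2_def \<eta>_def sp2 sp mem_Times_iff)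
      then show ?thesis using \<eta> by (simp add: H_def)
    qed
    \<comment> \<open>Windows imitate the states from time \<open>s\<close> on. The at most
      \<open>s\<close> products before that, and the equally unmatched multiples of
      \<open>c\<close>, are bounded by \<open>A\<^sup>2\<close> each; these are the two
      contributions \<open>r * A\<^sup>2\<close>.\<close>
    define a where "a = n - l - q i"
    have nl: "n - l = a + q i" and as: "a \<le> s" "q i \<noteq> 0 \<Longrightarrow> a = s" by (auto simp: a_def q_def l_def)
    have "(\<Sum>k<n - l. y k) = (\<Sum>k<a. y k) + (\<Sum>k<q i. y (a + k))" unfolding nl by (rule sum_lessThan_add)
    also have "(\<Sum>k<q i. y (a + k)) = (\<Sum>k<q i. y (k + s))"
      using as(2) by (cases "q i = 0") (auto simp: add.commute)
    finally have split: "(\<Sum>k<n - l. y k) = (\<Sum>k<a. y k) + (\<Sum>k<q i. y (k + s))" .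
    have nq: "real n - q i \<le> r" "q i \<le> n" using r(1)[OF i] by (auto simp: q_def l_def)
    have e1: "\<bar>\<Sum>k<a. y k\<bar> \<le> r * A\<^sup>2"
    proof -
      have "\<bar>\<Sum>k<a. y k\<bar> \<le> (\<Sum>k<a. A\<^sup>2)" by (intro order_trans[OF sum_abs] sum_mono ybd)
      also have "\<dots> \<le> r * A\<^sup>2" using as r(1)[OF i] by (simp add: mult_right_mono)
      finally show ?thesis .
    qed
    have e2: "\<bar>(real n - q i) * c\<bar> \<le> r * A\<^sup>2"
      unfolding abs_mult using nq cbd by (intro mult_mono) auto
    have sub: "(\<Sum>k<q i. d (k + b) \<omega>) \<le> T" if "b \<le> l" for b
    proof -
      have "(\<Sum>k<q i. d (k + b) \<omega>) = (\<Sum>k\<in>(\<lambda>k. k + b) ` {..<q i}. d k \<omega>)"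
        by (subst sum.reindex) (auto simp: inj_on_def)
      also have "\<dots> \<le> (\<Sum>k<n. d k \<omega>)"
        using that by (intro sum_mono2) (auto simp: q_def l_def d0)
      finally show ?thesis using sumd by simp
    qed
    have e3: "\<bar>\<Sum>k<q i. y (k + s) - \<Phi> i k \<eta>\<bar> \<le> 2 * A * L * T"
    proof -
      have "\<bar>\<Sum>k<q i. y (k + s) - \<Phi> i k \<eta>\<bar> \<le> (\<Sum>k<q i. A * (L * d k \<omega> + L * d (k + l) \<omega>))"
      proof (intro order_trans[OF sum_abs] sum_mono)
        fix k
        have "\<bar>U i (?X (k + s)) * V i (?X (k + s + l)) - U i (?w \<eta> k) * V i (?w \<eta> (k + lag i))\<bar>
            \<le> A * (L * D (?X (k + s)) (?w \<eta> k) + L * D (?X (k + s + l)) (?w \<eta> (k + lag i)))"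
          using i X w[OF \<eta>] by (intro abs_mult_diff_le u v ulip vlip) auto
        then show "\<bar>y (k + s) - \<Phi> i k \<eta>\<bar> \<le> A * (L * d k \<omega> + L * d (k + l) \<omega>)"
          by (simp add: y_def \<Phi>_def d_def x_def \<eta>_def l_def add_ac)
      qed
      also have "\<dots> = A * L * ((\<Sum>k<q i. d (k + 0) \<omega>) + (\<Sum>k<q i. d (k + l) \<omega>))"
        by (simp add: sum.distrib sum_distrib_left algebra_simps)
      also have "\<dots> \<le> A * L * (T + T)" using A L by (intro mult_left_mono add_mono sub) auto
      finally show ?thesis by simp
    qed
    have e4: "\<bar>\<Sum>k<q i. (\<integral>\<eta>. \<Phi> i k \<eta> \<partial>S) - c\<bar> \<le> n * (4 * A * L * \<rho> ^ s * \<kappa> / (1 - \<rho>))"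
    proof -
      have "\<bar>\<Sum>k<q i. (\<integral>\<eta>. \<Phi> i k \<eta> \<partial>S) - c\<bar> \<le> (\<Sum>k<q i. 4 * A * L * \<rho> ^ s * \<kappa> / (1 - \<rho>))"
        unfolding \<Phi>_def c_def l_def using i
        by (intro order_trans[OF sum_abs] sum_mono window_bias inv meas u v ulip vlip L) auto
      also have "\<dots> \<le> n * (4 * A * L * \<rho> ^ s * \<kappa> / (1 - \<rho>))"
        unfolding sum_constant using nq A L rho kappa by (intro mult_right_mono) auto
      finally show ?thesis .
    qed
    have "(\<Sum>k<n - l. y k) - n * c = (\<Sum>k<a. y k) - (real n - q i) * c
        + (\<Sum>k<q i. y (k + s) - \<Phi> i k \<eta>) + (\<Sum>k<q i. \<Phi> i k \<eta> - (\<integral>\<eta>. \<Phi> i k \<eta> \<partial>S))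
        + (\<Sum>k<q i. (\<integral>\<eta>. \<Phi> i k \<eta> \<partial>S) - c)"
      by (simp add: split sum_subtractf algebra_simps)
    moreover have "2 * A * L * T = 4 * A * L * n * \<rho> ^ s * C1 / \<delta>" by (simp add: T_def)
    ultimately have "\<bar>(\<Sum>k<n - l. y k) - n * c\<bar> \<le> 2 * r * A\<^sup>2 + 4 * A * L * n * \<rho> ^ s * C1 / \<delta>
        + n * (4 * A * L * \<rho> ^ s * \<kappa> / (1 - \<rho>)) + 2 * A\<^sup>2 * sqrt (n * r * lam)"
      using e1 e2 e3 e4 hoeff by linarith
    then show ?thesis by (simp add: y_def c_def l_def x_def \<eta>_def mult_ac)
  qed
  show ?thesis
    by (intro bexI[OF _ E] conjI ballI prob bound[unfolded C1_def])
qed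

end

section \<open>Gradients of smooth convex functions\<close>

lemma vdist_power2: "(vdist d x y)\<^sup>2 = (\<Sum>i<d. (x i - y i)\<^sup>2)"
  unfolding vdist_def L2_set_def by (simp add: sum_nonneg)

lemma vdist_nonneg [simp]: "0 \<le> vdist d x y"
  by (simp add: vdist_def)

lemma vdist_commute: "vdist d x y = vdist d y x"
  by (simp add: vdist_def L2_set_def power2_commute)

lemma vdist_triangle: "vdist d x z \<le> vdist d x y + vdist d y z"
  using L2_set_triangle_ineq[of "\<lambda>i. x i - y i" "\<lambda>i. y i - z i" "{..<d}"] by (simp add: vdist_def)

lemma vdist_eq_0: "x \<in> rvec d \<Longrightarrow> y \<in> rvec d \<Longrightarrow> vdist d x y = 0 \<longleftrightarrow> x = y"
  by (auto simp: vdist_def L2_set_eq_0_iff rvec_def intro: PiE_ext)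

lemma vdot_le: "vdot d (\<lambda>i. x i - y i) (\<lambda>i. z i - w i) \<le> vdist d x y * vdist d z w"
proof -
  have "vdot d (\<lambda>i. x i - y i) (\<lambda>i. z i - w i) \<le> (\<Sum>i<d. \<bar>x i - y i\<bar> * \<bar>z i - w i\<bar>)"
    unfolding vdot_def by (intro sum_mono) (simp add: abs_mult[symmetric])
  also have "\<dots> \<le> vdist d x y * vdist d z w"
    unfolding vdist_def by (rule L2_set_mult_ineq)
  finally show ?thesis .
qed

lemma vdist_le_sum: "vdist d x y \<le> (\<Sum>i<d. \<bar>x i - y i\<bar>)"
  unfolding vdist_def by (rule L2_set_le_sum_abs)

text \<open>The restriction to \<open>{..<d}\<close> keeps every point in \<open>rvec d\<close> for
  arbitrary \<open>v\<close>, so that differences of points, which are not extensional, can serve as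
  directions.\<close>

definition vline :: "nat \<Rightarrow> vec \<Rightarrow> vec \<Rightarrow> real \<Rightarrow> vec" where
  "vline d x v t = (\<lambda>i\<in>{..<d}. x i + t * v i)"

lemma vline_rvec [simp]: "vline d x v t \<in> rvec d"
  by (simp add: vline_def rvec_def)

lemma vline_0: "x \<in> rvec d \<Longrightarrow> vline d x v 0 = x"
  by (auto simp: vline_def rvec_def PiE_def extensional_def fun_eq_iff)

lemma vline_vline: "vline d (vline d x v t) v h = vline d x v (t + h)"
  by (auto simp: vline_def fun_eq_iff algebra_simps)

lemma continuous_on_vline: "continuous_on UNIV (vline d x v)"
proof (rule continuous_on_coordinatewise_then_product)
  fix i
  show "continuous_on UNIV (\<lambda>t. vline d x v t i)"
    by (cases "i < d") (auto simp: vline_def intro!: continuous_intros)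
qed

text \<open>Reduces the multivariate notion to one-variable calculus, on which uniqueness of the
  gradient, the tangent inequality and the descent lemma are built.\<close>

lemma has_gradient_line:
  assumes "x \<in> rvec d" "has_gradient d F x g"
  shows "((\<lambda>t. F (vline d x v t)) has_real_derivative vdot d g v) (at 0)"
proof -
  define c where "c = vdist d v (\<lambda>_. 0)"
  have c2: "c\<^sup>2 = (\<Sum>i<d. (v i)\<^sup>2)" by (simp add: c_def vdist_power2)
  show ?thesis
  \<comment> \<open>If the direction vanishes on the first d coordinates the line never leaves x,
    and the punctured filter in \<open>has_gradient\<close> cannot be used; the function along the
    line is then constant.\<close>
  proof (cases "c = 0")
    case True
    then have v: "v i = 0" if "i < d" for i
      using c2 that by (simp add: sum_nonneg_eq_0_iff)
    have "vline d x v t = vline d x v 0" for t by (auto simp: vline_def v)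
    then have "(\<lambda>t. F (vline d x v t)) = (\<lambda>_. F (vline d x v 0))" by metis
    moreover have "vdot d g v = 0" by (simp add: vdot_def v)
    ultimately show ?thesis by simp
  next
    case False
    have c0: "0 < c" using False by (simp add: c_def less_le)
    have dist: "vdist d (vline d x v h) x = \<bar>h\<bar> * c" for h
    proof -
      have "(vdist d (vline d x v h) x)\<^sup>2 = (\<bar>h\<bar> * c)\<^sup>2"
        by (simp add: vdist_power2 c2 power_mult_distrib sum_distrib_left vline_def)
      then show ?thesis using c0 by (metis power2_eq_iff_nonneg vdist_nonneg abs_ge_zero less_imp_le mult_nonneg_nonneg)
    qed
    have neq: "vline d x v h \<noteq> x" if "h \<noteq> 0" for h
      using dist[of h] that c0 vdist_eq_0[of "vline d x v h" d x] assms(1) by auto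
    have "(vline d x v \<longlongrightarrow> vline d x v 0) (at 0)"
      using continuous_on_vline[of d x v] by (auto simp: continuous_on_def)
    then have "filterlim (vline d x v) (at x within rvec d) (at 0)"
      unfolding filterlim_at vline_0[OF assms(1)]
      by (auto simp: eventually_at_filter neq)
    from filterlim_compose[OF assms(2)[unfolded has_gradient_def] this]
    have lim: "((\<lambda>h. (F (vline d x v h) - F x - vdot d g (\<lambda>i. vline d x v h i - x i)) / (\<bar>h\<bar> * c)) \<longlongrightarrow> 0) (at 0)"
      by (simp add: dist)
    have lin: "vdot d g (\<lambda>i. vline d x v h i - x i) = h * vdot d g v" for h
      by (simp add: vdot_def vline_def sum_distrib_left mult_ac)
    \<comment> \<open>Passing to norms allows the divisor \<open>\<bar>h\<bar>\<close> to be
      exchanged for the signed h of the difference quotient.\<close>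
    have "((\<lambda>h. c * norm ((F (vline d x v h) - F x - h * vdot d g v) / (\<bar>h\<bar> * c))) \<longlongrightarrow> c * norm (0::real)) (at 0)"
      using lim unfolding lin by (intro tendsto_intros)
    moreover have "c * norm ((F (vline d x v h) - F x - h * vdot d g v) / (\<bar>h\<bar> * c))
        = norm ((F (vline d x v h) - F x) / h - vdot d g v)" if "h \<noteq> 0" for h
    proof -
      have "(F (vline d x v h) - F x) / h - vdot d g v = (F (vline d x v h) - F x - h * vdot d g v) / h"
        using that by (simp add: field_simps)
      then show ?thesis using c0 by (simp add: abs_mult)
    qed
    ultimately have "((\<lambda>h. norm ((F (vline d x v h) - F x) / h - vdot d g v)) \<longlongrightarrow> 0) (at 0)"
      by (subst (asm) tendsto_cong[of _ "\<lambda>h. norm ((F (vline d x v h) - F x) / h - vdot d g v)"])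
         (auto simp: eventually_at_filter)
    then have "((\<lambda>h. (F (vline d x v h) - F x) / h) \<longlongrightarrow> vdot d g v) (at 0)"
      by (subst Lim_null) (rule tendsto_norm_zero_cancel)
    then show ?thesis
      by (simp add: DERIV_def vline_0[OF assms(1)])
  qed
qed

text \<open>Derivatives along the coordinate axes fix the first d components, and beyond them both
  vectors are \<open>undefined\<close>. This gives the \<open>THE\<close> in \<open>gradient\<close>
  its meaning.\<close>

lemma has_gradient_unique:
  assumes "x \<in> rvec d" "g \<in> rvec d" "g' \<in> rvec d" "has_gradient d F x g" "has_gradient d F x g'"
  shows "g = g'"
proof -
  have "g i = g' i" if "i < d" for i
  proof -
    have e: "vdot d h (\<lambda>j. if j = i then 1 else 0) = h i" for h
      using that by (simp add: vdot_def if_distrib[of "\<lambda>z. _ * z"] cong: if_cong)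
    show ?thesis
      using DERIV_unique[OF has_gradient_line[OF assms(1,4)] has_gradient_line[OF assms(1,5)],
          of "\<lambda>j. if j = i then 1 else 0"] by (simp add: e)
  qed
  then show ?thesis using assms by (auto simp: rvec_def intro: PiE_ext)
qed

lemma gradient_eqI:
  assumes "x \<in> rvec d" "g \<in> rvec d" "has_gradient d F x g"
  shows "gradient d F x = g"
  unfolding gradient_def using assms by (intro the_equality) (auto intro: has_gradient_unique)

lemma cont_differentiable_gradient:
  assumes "cont_differentiable d F" "x \<in> rvec d"
  shows "gradient d F x \<in> rvec d" "has_gradient d F x (gradient d F x)"
proof -
  obtain g where "g \<in> rvec d" "has_gradient d F x g"
    using assms by (auto simp: cont_differentiable_def)
  with gradient_eqI[OF assms(2) this] show "gradient d F x \<in> rvec d" "has_gradient d F x (gradient d F x)" by auto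
qed

lemma gradient_line:
  assumes "cont_differentiable d F"
  shows "((\<lambda>t. F (vline d x v t)) has_real_derivative vdot d (gradient d F (vline d x v t)) v) (at t)"
proof -
  let ?D = "vdot d (gradient d F (vline d x v t)) v"
  have "((\<lambda>h. F (vline d x v (h + t))) has_real_derivative ?D) (at 0)"
    using has_gradient_line[OF vline_rvec cont_differentiable_gradient(2)[OF assms vline_rvec], of x v t v]
    by (simp add: vline_vline add.commute[of t])
  then show ?thesis
    using DERIV_shift[of "\<lambda>t. F (vline d x v t)" ?D 0 t] by simp
qed

text \<open>By convexity the difference quotients along the segment from x to y are at most
  \<open>F y - F x\<close>; the directional derivative is their limit from the right.\<close>

lemma convex_first_order:
  assumes "cont_differentiable d F" "convex_fun d F" and x: "x \<in> rvec d" and y: "y \<in> rvec d"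
  shows "F y \<ge> F x + vdot d (gradient d F x) (\<lambda>i. y i - x i)"
proof -
  let ?v = "\<lambda>i. y i - x i"
  have "((\<lambda>h. (F (vline d x ?v h) - F x) / h) \<longlongrightarrow> vdot d (gradient d F x) ?v) (at 0)"
    using has_gradient_line[OF x cont_differentiable_gradient(2)[OF assms(1) x], of ?v]
    by (simp add: DERIV_def vline_0[OF x])
  then have lim: "((\<lambda>h. (F (vline d x ?v h) - F x) / h) \<longlongrightarrow> vdot d (gradient d F x) ?v) (at_right 0)"
    by (rule tendsto_within_subset) simp
  have "\<forall>\<^sub>F h in at_right 0. (F (vline d x ?v h) - F x) / h \<le> F y - F x"
  proof -
    have "\<forall>\<^sub>F h in at_right (0::real). 0 < h \<and> h < 1"
      unfolding eventually_at_right_field by (auto intro: exI[of _ 1])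
    then show ?thesis
    proof eventually_elim
      case (elim h)
      have "vline d x ?v h = (\<lambda>i\<in>{..<d}. (1 - h) * x i + h * y i)"
        by (auto simp: vline_def algebra_simps)
      then have "F (vline d x ?v h) \<le> (1 - h) * F x + h * F y"
        using assms(2) x y elim by (auto simp: convex_fun_def)
      then show ?case using elim by (simp add: field_simps)
    qed
  qed
  from tendsto_upperbound[OF lim this] show ?thesis by simp
qed

text \<open>After subtracting the linear and the quadratic term, F along the segment has nonpositive
  derivative, by Cauchy-Schwarz and the Lipschitz bound for the gradient.\<close>

lemma descent_lemma:
  assumes "cont_differentiable d F" "lipschitz_gradient d C F" and x: "x \<in> rvec d" and y: "y \<in> rvec d"
  shows "F y \<le> F x + vdot d (gradient d F x) (\<lambda>i. y i - x i) + C / 2 * (vdist d y x)\<^sup>2"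
proof -
  let ?v = "\<lambda>i. y i - x i"
  let ?p = "vline d x ?v"
  define \<psi> where "\<psi> t = F (?p t) - t * vdot d (gradient d F x) ?v - C / 2 * t\<^sup>2 * (vdist d y x)\<^sup>2" for t
  have "\<psi> 1 \<le> \<psi> 0"
  proof (rule DERIV_nonpos_imp_nonincreasing[of 0 1 \<psi>])
    fix t :: real assume t: "0 \<le> t" "t \<le> 1"
    have "(\<psi> has_real_derivative vdot d (gradient d F (?p t)) ?v - vdot d (gradient d F x) ?v
        - C * t * (vdist d y x)\<^sup>2) (at t)"
      unfolding \<psi>_def
      by (rule derivative_eq_intros gradient_line[OF assms(1)] refl)+ (simp add: algebra_simps)
    moreover have "vdot d (gradient d F (?p t)) ?v - vdot d (gradient d F x) ?v \<le> C * t * (vdist d y x)\<^sup>2"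
    proof -
      have "vdot d (gradient d F (?p t)) ?v - vdot d (gradient d F x) ?v
          = vdot d (\<lambda>i. gradient d F (?p t) i - gradient d F x i) ?v"
        by (simp add: vdot_def sum_subtractf[symmetric] left_diff_distrib)
      also have "\<dots> \<le> vdist d (gradient d F (?p t)) (gradient d F x) * vdist d y x" by (rule vdot_le)
      also have "\<dots> \<le> (C * vdist d (?p t) x) * vdist d y x"
        using assms(2) x by (intro mult_right_mono) (auto simp: lipschitz_gradient_def)
      also have "vdist d (?p t) x = t * vdist d y x"
        using t unfolding vdist_def by (subst L2_set_right_distrib) (auto simp: vline_def intro!: L2_set_cong)
      finally show ?thesis by (simp add: power2_eq_square mult_ac)
    qed
    ultimately show "\<exists>D. (\<psi> has_real_derivative D) (at t) \<and> D \<le> 0" by (intro exI conjI) auto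
  qed simp
  moreover have "?p 1 = y" using y by (auto simp: vline_def rvec_def PiE_def extensional_def fun_eq_iff)
  ultimately show ?thesis by (simp add: \<psi>_def vline_0[OF x])
qed

text \<open>The Baillon-Haddad inequality. At a common third point the tangent at \<open>a\<close>
  lies below F and the descent parabola at \<open>b\<close> above it, which bounds the Bregman
  divergence below by the squared gradient difference over \<open>2 * C\<close>. Adding the
  inequalities for both orders of the points cancels the values of F.\<close>

lemma cocoercive:
  assumes F: "cont_differentiable d F" "lipschitz_gradient d C F" "convex_fun d F" and C: "0 < C"
    and x: "x \<in> rvec d" and y: "y \<in> rvec d"
  shows "(\<Sum>i<d. (gradient d F x i - gradient d F y i)\<^sup>2)
    \<le> C * vdot d (\<lambda>i. x i - y i) (\<lambda>i. gradient d F x i - gradient d F y i)"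
proof -
  let ?g = "gradient d F"
  have half: "(\<Sum>i<d. (?g a i - ?g b i)\<^sup>2) / (2 * C) \<le> F b - F a - vdot d (?g a) (\<lambda>i. b i - a i)"
    if a: "a \<in> rvec d" and b: "b \<in> rvec d" for a b
  proof -
    let ?w = "\<lambda>i. ?g b i - ?g a i"
    \<comment> \<open>This point minimises the gap between the parabola at \<open>b\<close> and the
      tangent at \<open>a\<close>.\<close>
    define z where "z = vline d b ?w (- 1 / C)"
    have z: "z \<in> rvec d" by (simp add: z_def)
    have zi: "z i = b i - ?w i / C" if "i < d" for i using that by (simp add: z_def vline_def)
    have 1: "F z \<ge> F a + vdot d (?g a) (\<lambda>i. z i - a i)" by (rule convex_first_order[OF F(1,3) a z])
    have 2: "F z \<le> F b + vdot d (?g b) (\<lambda>i. z i - b i) + C / 2 * (vdist d z b)\<^sup>2"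
      by (rule descent_lemma[OF F(1,2) b z])
    have "vdot d (?g b) (\<lambda>i. z i - b i) - vdot d (?g a) (\<lambda>i. z i - a i) + C / 2 * (vdist d z b)\<^sup>2
       = (\<Sum>i<d. ?g b i * (z i - b i) - ?g a i * (z i - a i) + C / 2 * (z i - b i)\<^sup>2)"
      by (simp add: vdot_def vdist_power2 sum.distrib sum_subtractf sum_distrib_left)
    also have "\<dots> = (\<Sum>i<d. - (?g a i - ?g b i)\<^sup>2 / (2 * C) - ?g a i * (b i - a i))"
    proof (rule sum.cong)
      fix i assume "i \<in> {..<d}"
      then have zi: "z i = b i - ?w i / C" by (simp add: zi)
      show "?g b i * (z i - b i) - ?g a i * (z i - a i) + C / 2 * (z i - b i)\<^sup>2
          = - (?g a i - ?g b i)\<^sup>2 / (2 * C) - ?g a i * (b i - a i)"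
        unfolding zi using C by (simp add: field_simps power2_eq_square)
    qed simp
    also have "\<dots> = - (\<Sum>i<d. (?g a i - ?g b i)\<^sup>2) / (2 * C) - vdot d (?g a) (\<lambda>i. b i - a i)"
      by (simp add: vdot_def sum_subtractf sum_divide_distrib[symmetric] sum_negf)
    finally show ?thesis using 1 2 by simp
  qed
  have sq: "(\<Sum>i<d. (?g y i - ?g x i)\<^sup>2) = (\<Sum>i<d. (?g x i - ?g y i)\<^sup>2)"
    by (simp add: power2_commute)
  have "(\<Sum>i<d. (?g x i - ?g y i)\<^sup>2) / C \<le> - vdot d (?g x) (\<lambda>i. y i - x i) - vdot d (?g y) (\<lambda>i. x i - y i)"
    using half[OF x y] half[OF y x] unfolding sq by (simp add: field_simps)
  also have "\<dots> = vdot d (\<lambda>i. x i - y i) (\<lambda>i. ?g x i - ?g y i)"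
    by (simp add: vdot_def sum_negf[symmetric] sum_subtractf[symmetric] algebra_simps)
  finally show ?thesis using C by (simp add: field_simps)
qed

section \<open>The SGLD chain is contractive\<close>

lemma finite_batches [simp]: "finite (batches K M)"
  by (rule finite_subset[of _ "Pow {1..K}"]) (auto simp: batches_def)

lemma card_batches: "card (batches K M) = K choose M"
  using n_subsets[of "{1..K}" M] by (simp add: batches_def)

lemma card_batches_containing:
  assumes "j \<in> {1..K}" "1 \<le> M"
  shows "card {S\<in>batches K M. j \<in> S} = (K - 1) choose (M - 1)"
proof -
  have "{S\<in>batches K M. j \<in> S} = insert j ` {T. T \<subseteq> {1..K} - {j} \<and> card T = M - 1}" (is "?A = _ ` ?B")
  proof safe
    fix S assume S: "S \<in> batches K M" "j \<in> S"
    then have "S = insert j (S - {j})" "S - {j} \<in> ?B" by (auto simp: batches_def)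
    then show "S \<in> insert j ` ?B" by blast
  next
    fix T assume T: "T \<subseteq> {1..K} - {j}" "card T = M - 1"
    then have "finite T" "j \<notin> T" by (auto intro: finite_subset)
    then show "insert j T \<in> batches K M" using T assms by (auto simp: batches_def)
  qed
  moreover have "inj_on (insert j) ?B" by (auto simp: inj_on_def)
  ultimately have "card ?A = card ?B" by (simp add: card_image)
  also have "\<dots> = card ({1..K} - {j}) choose (M - 1)" by (rule n_subsets) simp
  finally show ?thesis using assms by simp
qed

text \<open>Every index lies in the fraction \<open>M / K\<close> of all batches, so the weight
  \<open>K / M\<close> makes the batch sum an unbiased estimate of the full sum.\<close>

lemma batch_average:
  fixes a :: "nat \<Rightarrow> real"
  assumes M: "M \<in> {1..K}"
  shows "(\<Sum>S\<in>batches K M. real K / real M * (\<Sum>j\<in>S. a j)) / real (card (batches K M)) = (\<Sum>j=1..K. a j)"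
proof -
  have "(\<Sum>S\<in>batches K M. \<Sum>j\<in>S. a j) = (\<Sum>S\<in>batches K M. \<Sum>j\<in>{1..K}. if j \<in> S then a j else 0)"
    by (intro sum.cong refl sum.mono_neutral_cong_left) (auto simp: batches_def)
  also have "\<dots> = (\<Sum>j=1..K. \<Sum>S\<in>batches K M. if j \<in> S then a j else 0)" by (rule sum.swap)
  also have "\<dots> = (\<Sum>j=1..K. real ((K - 1) choose (M - 1)) * a j)"
    using M by (intro sum.cong refl, subst sum.inter_filter[symmetric])
      (auto simp: card_batches_containing)
  also have "\<dots> = real ((K - 1) choose (M - 1)) * (\<Sum>j=1..K. a j)" by (simp add: sum_distrib_left)
  finally have eq: "(\<Sum>S\<in>batches K M. \<Sum>j\<in>S. a j) = real ((K - 1) choose (M - 1)) * (\<Sum>j=1..K. a j)" .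
  have "M * (K choose M) = K * ((K - 1) choose (M - 1))"
    using M by (intro times_binomial_minus1_eq) auto
  then have binom: "real M * real (K choose M) = real K * real ((K - 1) choose (M - 1))" "0 < real (K choose M)"
    using M by (metis of_nat_mult, simp)
  have "(\<Sum>S\<in>batches K M. real K / real M * (\<Sum>j\<in>S. a j))
      = real K / real M * (real ((K - 1) choose (M - 1)) * (\<Sum>j=1..K. a j))"
    by (simp only: sum_distrib_left[symmetric] eq)
  then have "(\<Sum>S\<in>batches K M. real K / real M * (\<Sum>j\<in>S. a j)) / real (card (batches K M))
      = real K / real M * (real ((K - 1) choose (M - 1)) * (\<Sum>j=1..K. a j)) / real (K choose M)"
    by (simp only: card_batches)
  also have "\<dots> = (real K * real ((K - 1) choose (M - 1))) / (real M * real (K choose M)) * (\<Sum>j=1..K. a j)"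
    by simp
  also have "\<dots> = (\<Sum>j=1..K. a j)"
    unfolding binom(1)[symmetric] using M binom(2) by simp
  finally show ?thesis .
qed

lemma batches_nonempty: "M \<in> {1..K} \<Longrightarrow> batches K M \<noteq> {}"
  using card_batches[of K M] by (metis atLeastAtMost_iff binomial_eq_0_iff card.empty not_less)

lemma prob_space_batch_law: "M \<in> {1..K} \<Longrightarrow> prob_space (batch_law K M)"
  unfolding batch_law_def by (rule prob_space_uniform_count_measure) (simp_all add: batches_nonempty)

lemma nn_integral_batch_law:
  assumes "\<And>S. S \<in> batches K M \<Longrightarrow> 0 \<le> f S"
  shows "(\<integral>\<^sup>+S. ennreal (f S) \<partial>batch_law K M) = ennreal ((\<Sum>S\<in>batches K M. f S) / card (batches K M))"
  unfolding batch_law_def uniform_count_measure_def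
  using assms by (subst nn_integral_point_measure_finite)
    (auto simp: ennreal_mult'[symmetric] sum_divide_distrib intro!: sum_ennreal)

lemma sets_batch_law [measurable_cong]: "sets (batch_law K M) = sets (count_space (batches K M))"
  unfolding batch_law_def by (rule sets_uniform_count_measure_count_space)

lemma space_batch_law [simp]: "space (batch_law K M) = batches K M"
  by (simp add: batch_law_def space_uniform_count_measure)

section \<open>Measurability on the state space\<close>

lemma space_vborel: "space (vborel d) = rvec d"
  by (simp add: vborel_def space_PiM rvec_def)

lemma space_state_space: "space (state_space d K M) = rvec d \<times> batches K M"
  by (simp add: state_space_def space_pair_measure space_vborel)

lemma vborel_component [measurable (raw)]:
  "i < d \<Longrightarrow> f \<in> R \<rightarrow>\<^sub>M vborel d \<Longrightarrow> (\<lambda>x. f x i) \<in> borel_measurable R"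
  unfolding vborel_def by (rule measurable_compose[OF _ measurable_component_singleton]) auto

text \<open>Continuity refers to the product topology over all natural indices,
  \<open>vborel d\<close> only to the first d. On \<open>rvec d\<close> the other coordinates are
  constantly \<open>undefined\<close>, so the identity is measurable between the two
  structures.\<close>

lemma continuous_on_rvec_measurable:
  fixes f :: "vec \<Rightarrow> real"
  assumes "continuous_on (rvec d) f"
  shows "f \<in> borel_measurable (vborel d)"
proof -
  have "(\<lambda>x. x) \<in> vborel d \<rightarrow>\<^sub>M restrict_space borel (rvec d)"
  proof (rule measurable_restrict_space2)
    show "(\<lambda>x. x) \<in> borel_measurable (vborel d)"
    proof (rule measurable_coordinatewise_then_product)
      fix i
      show "(\<lambda>x. x i) \<in> borel_measurable (vborel d)"
      proof (cases "i < d")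
        case False
        then have "x i = undefined" if "x \<in> space (vborel d)" for x
          using that by (auto simp: space_vborel rvec_def PiE_def extensional_def)
        then show ?thesis by (subst measurable_cong[where g = "\<lambda>_. undefined"]) auto
      qed simp
    qed
  qed (simp add: space_vborel)
  from measurable_compose[OF this borel_measurable_continuous_on_restrict[OF assms]]
  show ?thesis by simp
qed

lemma gradient_measurable:
  assumes "cont_differentiable d F" 
  shows "(\<lambda>x. gradient d F x i) \<in> borel_measurable (vborel d)"
  using assms continuous_on_product_then_coordinatewise
  by (intro continuous_on_rvec_measurable) (auto simp: cont_differentiable_def)

lemma vdist_continuous: "continuous_on A (\<lambda>y. vdist d y x)"
  unfolding vdist_def L2_set_def by (intro continuous_intros continuous_on_subset[OF continuous_on_product_coordinates]) auto

lemma vdist_Lipschitz_continuous: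
  assumes "\<And>x y. x \<in> rvec d \<Longrightarrow> y \<in> rvec d \<Longrightarrow> \<bar>f x - f y\<bar> \<le> L * vdist d x y"
  shows "continuous_on (rvec d) f"
  unfolding continuous_on_def
proof
  fix x assume x: "x \<in> rvec d"
  have "((\<lambda>y. L * vdist d y x) \<longlongrightarrow> L * vdist d x x) (at x within rvec d)"
    using vdist_continuous[of "rvec d" d x] x by (intro tendsto_intros) (auto simp: continuous_on_def)
  then have "((\<lambda>y. L * vdist d y x) \<longlongrightarrow> 0) (at x within rvec d)"
    using vdist_eq_0[OF x x] by simp
  then have "((\<lambda>y. f y - f x) \<longlongrightarrow> 0) (at x within rvec d)"
    by (rule Lim_null_comparison[rotated]) (auto simp: eventually_at_filter assms x)
  then show "(f \<longlongrightarrow> f x) (at x within rvec d)"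
    by (rule Lim_null[THEN iffD2])
qed

lemma state_space_measurableI:
  assumes "\<And>S. S \<in> batches K M \<Longrightarrow> (\<lambda>x. h (x, S)) \<in> borel_measurable (vborel d)"
  shows "h \<in> borel_measurable (state_space d K M)"
proof -
  have "(\<lambda>(S, x). h (x, S)) \<in> borel_measurable (count_space (batches K M) \<Otimes>\<^sub>M vborel d)"
    using assms by (intro measurable_pair_measure_countable1) (auto intro: countable_finite)
  from measurable_compose[OF measurable_pair_swap' this]
  show ?thesis by (simp add: state_space_def split_beta')
qed

text \<open>Membership in \<open>Lip_b\<close> says nothing about measurability. For a fixed batch
  the function is Lipschitz in \<open>vdist\<close>, hence continuous on \<open>rvec d\<close>, and
  there are only finitely many batches.\<close>

lemma Lip_b_measurable:
  assumes "h \<in> Lip_b d K M L B"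
  shows "h \<in> borel_measurable (state_space d K M)"
proof (rule state_space_measurableI)
  fix S assume S: "S \<in> batches K M"
  have "\<bar>h (x, S) - h (y, S)\<bar> \<le> L * vdist d x y" if "x \<in> rvec d" "y \<in> rvec d" for x y
  proof -
    have "\<bar>h (x, S) - h (y, S)\<bar> \<le> L * dX d (x, S) (y, S)"
      using assms that S unfolding Lip_b_def space_state_space by blast
    then show ?thesis by (simp add: dX_def)
  qed
  then show "(\<lambda>x. h (x, S)) \<in> borel_measurable (vborel d)"
    by (intro continuous_on_rvec_measurable vdist_Lipschitz_continuous)
qed

lemma vdist_measurable [measurable (raw)]:
  "f \<in> R \<rightarrow>\<^sub>M vborel d \<Longrightarrow> g \<in> R \<rightarrow>\<^sub>M vborel d \<Longrightarrow> (\<lambda>x. vdist d (f x) (g x)) \<in> borel_measurable R"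
proof -
  assume f: "f \<in> R \<rightarrow>\<^sub>M vborel d" and g: "g \<in> R \<rightarrow>\<^sub>M vborel d"
  have [measurable]: "(\<lambda>x. f x i) \<in> borel_measurable R" "(\<lambda>x. g x i) \<in> borel_measurable R" if "i \<in> {..<d}" for i
    using that f g by (auto intro: vborel_component)
  show "(\<lambda>x. vdist d (f x) (g x)) \<in> borel_measurable R"
    unfolding vdist_def L2_set_def by measurable
qed

lemma dX_measurable:
  "(\<lambda>(x, y). dX d x y) \<in> borel_measurable (state_space d K M \<Otimes>\<^sub>M state_space d K M)"
proof -
  have "(\<lambda>p. (snd (fst p), snd (snd p))) \<in> state_space d K M \<Otimes>\<^sub>M state_space d K M
      \<rightarrow>\<^sub>M count_space (batches K M) \<Otimes>\<^sub>M count_space (batches K M)"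
    unfolding state_space_def by measurable
  then have "(\<lambda>p. (snd (fst p), snd (snd p))) \<in> state_space d K M \<Otimes>\<^sub>M state_space d K M
      \<rightarrow>\<^sub>M count_space (batches K M \<times> batches K M)"
    by (simp add: pair_measure_countable countable_finite)
  from measurable_compose[OF this, of "\<lambda>q. if fst q \<noteq> snd q then 1 else (0::real)" borel]
  have [measurable]: "(\<lambda>p. if snd (fst p) \<noteq> snd (snd p) then 1 else (0::real)) \<in> borel_measurable (state_space d K M \<Otimes>\<^sub>M state_space d K M)"
    by simp
  have [measurable]: "(\<lambda>p. fst (fst p)) \<in> state_space d K M \<Otimes>\<^sub>M state_space d K M \<rightarrow>\<^sub>M vborel d"
     "(\<lambda>p. fst (snd p)) \<in> state_space d K M \<Otimes>\<^sub>M state_space d K M \<rightarrow>\<^sub>M vborel d"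
    unfolding state_space_def by measurable
  show ?thesis unfolding dX_def split_beta' by measurable
qed

lemma dX_nonneg: "0 \<le> dX d x y"
  by (simp add: dX_def)

lemma dX_triangle: "dX d x z \<le> dX d x y + dX d y z"
  using vdist_triangle[of d "fst x" "fst z" "fst y"] by (simp add: dX_def)

section \<open>One step of the recursion\<close>

definition sgld_noise :: "nat \<Rightarrow> nat \<Rightarrow> nat \<Rightarrow> (nat set \<times> nat set \<times> vec) measure" where
  "sgld_noise d K M = batch_law K M \<Otimes>\<^sub>M (batch_law K M \<Otimes>\<^sub>M std_gaussian d)"

text \<open>The batch of the new state comes from the noise. Two states moved by the same noise
  therefore share it, and the indicator in \<open>dX\<close> disappears after one step.\<close>

definition sgld_step ::
    "nat \<Rightarrow> nat \<Rightarrow> nat \<Rightarrow> (nat \<Rightarrow> vec \<Rightarrow> real) \<Rightarrow> real \<Rightarrow> state \<Rightarrow> nat set \<times> nat set \<times> vec \<Rightarrow> state" where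
  "sgld_step d K M U \<gamma> x v =
     (\<lambda>i\<in>{..<d}. fst x i - \<gamma> * stoch_gradient d K M U (fst x) (fst v) i + sqrt (2 * \<gamma>) * snd (snd v) i,
      fst (snd v))"

lemma prob_space_std_gaussian: "prob_space (std_gaussian d)"
  unfolding std_gaussian_def by (intro prob_space_PiM prob_space_normal_density) simp

lemma sets_std_gaussian [measurable_cong]: "sets (std_gaussian d) = sets (vborel d)"
  unfolding std_gaussian_def vborel_def by (rule sets_PiM_cong) auto

lemma prob_space_sgld_noise: "M \<in> {1..K} \<Longrightarrow> prob_space (sgld_noise d K M)"
  unfolding sgld_noise_def by (intro prob_space_pair prob_space_batch_law prob_space_std_gaussian)

lemma sgld_step_measurable:
  assumes U: "\<And>j. j \<le> K \<Longrightarrow> cont_differentiable d (U j)"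
  shows "(\<lambda>(x, v). sgld_step d K M U \<gamma> x v) \<in> state_space d K M \<Otimes>\<^sub>M sgld_noise d K M \<rightarrow>\<^sub>M state_space d K M"
proof -
  let ?R = "state_space d K M \<Otimes>\<^sub>M sgld_noise d K M"
  have m[measurable]: "(\<lambda>p. fst (fst p)) \<in> ?R \<rightarrow>\<^sub>M vborel d"
      "(\<lambda>p. snd (snd (snd p))) \<in> ?R \<rightarrow>\<^sub>M vborel d"
      "(\<lambda>p. fst (snd (snd p))) \<in> ?R \<rightarrow>\<^sub>M count_space (batches K M)"
      "(\<lambda>p. fst (snd p)) \<in> ?R \<rightarrow>\<^sub>M count_space (batches K M)"
    unfolding state_space_def sgld_noise_def by measurable
  have g[measurable]: "(\<lambda>p. gradient d (U j) (fst (fst p)) i) \<in> borel_measurable ?R" if "j \<le> K" for i j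
    using measurable_compose[OF m(1) gradient_measurable[OF U[OF that]]] .
  have b[measurable]: "(\<lambda>p. if j \<in> fst (snd p) then 1 else (0::real)) \<in> borel_measurable ?R" for j
    using measurable_compose[OF m(4), of "\<lambda>S. if j \<in> S then 1 else (0::real)" borel] by simp
  \<comment> \<open>The sum over the random batch is rewritten as a sum over all of
    \<open>{1..K}\<close> with indicators, whose terms are visibly measurable.\<close>
  have "(\<lambda>p. \<lambda>i\<in>{..<d}. fst (fst p) i - \<gamma> * (gradient d (U 0) (fst (fst p)) i
          + real K / real M * (\<Sum>j\<in>{1..K}. (if j \<in> fst (snd p) then 1 else 0) * gradient d (U j) (fst (fst p)) i))
        + sqrt (2 * \<gamma>) * snd (snd (snd p)) i) \<in> ?R \<rightarrow>\<^sub>M vborel d" (is "?f \<in> _")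
    unfolding vborel_def[of d] by (rule measurable_restrict) measurable
  moreover have "fst (sgld_step d K M U \<gamma> (fst p) (snd p)) = ?f p" if "p \<in> space ?R" for p
  proof -
    have S: "fst (snd p) \<in> batches K M" using that by (auto simp: space_pair_measure sgld_noise_def)
    have "(\<Sum>j\<in>{1..K}. (if j \<in> fst (snd p) then 1 else 0) * a j) = (\<Sum>j\<in>fst (snd p). a j)" for a :: "nat \<Rightarrow> real"
      using S by (intro sum.mono_neutral_cong_right) (auto simp: batches_def)
    then show ?thesis by (auto simp: sgld_step_def stoch_gradient_def)
  qed
  ultimately have "(\<lambda>p. fst (sgld_step d K M U \<gamma> (fst p) (snd p))) \<in> ?R \<rightarrow>\<^sub>M vborel d"
    by (simp cong: measurable_cong)
  then have "(\<lambda>p. (fst (sgld_step d K M U \<gamma> (fst p) (snd p)), fst (snd (snd p)))) \<in> ?R \<rightarrow>\<^sub>M state_space d K M"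
    using m(3) unfolding state_space_def by (rule measurable_Pair)
  then show ?thesis by (simp add: sgld_step_def split_beta')
qed

section \<open>Strong monotonicity and contraction in mean\<close>

lemma has_gradient_total:
  assumes "\<And>j. j \<le> K \<Longrightarrow> cont_differentiable d (U j)" and x: "x \<in> rvec d"
  shows "has_gradient d (total_potential K U) x (\<lambda>i\<in>{..<d}. \<Sum>j\<le>K. gradient d (U j) x i)"
proof -
  have K: "(\<Sum>j\<le>K. f j) = f 0 + (\<Sum>j=1..K. f j)" for f :: "nat \<Rightarrow> real"
    by (simp add: atMost_atLeast0 sum.atLeast_Suc_atMost)
  have "((\<lambda>y. \<Sum>j\<le>K. (U j y - U j x - vdot d (gradient d (U j) x) (\<lambda>i. y i - x i)) / vdist d y x) \<longlongrightarrow> (\<Sum>j\<le>K. 0)) (at x within rvec d)"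
    using cont_differentiable_gradient(2)[OF assms(1) x]
    by (intro tendsto_sum) (auto simp: has_gradient_def)
  moreover have "(\<Sum>j\<le>K. (U j y - U j x - vdot d (gradient d (U j) x) (\<lambda>i. y i - x i)) / vdist d y x)
      = (total_potential K U y - total_potential K U x
          - vdot d (\<lambda>i\<in>{..<d}. \<Sum>j\<le>K. gradient d (U j) x i) (\<lambda>i. y i - x i)) / vdist d y x" for y
  proof -
    have "vdot d (\<lambda>i\<in>{..<d}. \<Sum>j\<le>K. gradient d (U j) x i) (\<lambda>i. y i - x i)
        = (\<Sum>i<d. \<Sum>j\<le>K. gradient d (U j) x i * (y i - x i))"
      by (simp add: vdot_def sum_distrib_right)
    also have "\<dots> = (\<Sum>j\<le>K. vdot d (gradient d (U j) x) (\<lambda>i. y i - x i))"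
      unfolding vdot_def by (rule sum.swap)
    moreover have "total_potential K U z = (\<Sum>j\<le>K. U j z)" for z
      by (simp add: total_potential_def K)
    ultimately show ?thesis
      by (simp only: sum_divide_distrib[symmetric] sum_subtractf)
  qed
  ultimately show ?thesis by (simp add: has_gradient_def)
qed

lemma gradient_total:
  assumes "\<And>j. j \<le> K \<Longrightarrow> cont_differentiable d (U j)" and "x \<in> rvec d" "i < d"
  shows "gradient d (total_potential K U) x i = (\<Sum>j\<le>K. gradient d (U j) x i)"
  using gradient_eqI[OF _ _ has_gradient_total[OF assms(1)], of x] assms by (simp add: rvec_def)

text \<open>Adding the strong convexity inequality for both orders of x and y cancels the values of
  the potential. The sum over components on the right is the form in which the batch average appears
  later.\<close>

lemma sgld_strongly_monotone:
  assumes cond: "sgld_condition d K U LU mU" and x: "x \<in> rvec d" and y: "y \<in> rvec d"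
  shows "mU * (vdist d x y)\<^sup>2
    \<le> (\<Sum>j\<le>K. vdot d (\<lambda>i. x i - y i) (\<lambda>i. gradient d (U j) x i - gradient d (U j) y i))"
proof -
  let ?g = "gradient d (total_potential K U)"
  have C: "\<And>j. j \<le> K \<Longrightarrow> cont_differentiable d (U j)" using cond by (simp add: sgld_condition_def)
  have "total_potential K U y \<ge> total_potential K U x + vdot d (?g x) (\<lambda>i. y i - x i) + mU / 2 * (vdist d y x)\<^sup>2"
     "total_potential K U x \<ge> total_potential K U y + vdot d (?g y) (\<lambda>i. x i - y i) + mU / 2 * (vdist d x y)\<^sup>2"
    using cond x y by (auto simp: sgld_condition_def)
  then have "mU * (vdist d x y)\<^sup>2 \<le> - vdot d (?g x) (\<lambda>i. y i - x i) - vdot d (?g y) (\<lambda>i. x i - y i)"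
    by (simp add: vdist_commute)
  also have "\<dots> = (\<Sum>i<d. (x i - y i) * (?g x i - ?g y i))"
    by (simp add: vdot_def sum_negf[symmetric] sum_subtractf[symmetric] algebra_simps)
  also have "\<dots> = (\<Sum>i<d. \<Sum>j\<le>K. (x i - y i) * (gradient d (U j) x i - gradient d (U j) y i))"
    using x y by (simp add: gradient_total[OF C] sum_subtractf[symmetric] sum_distrib_left)
  also have "\<dots> = (\<Sum>j\<le>K. vdot d (\<lambda>i. x i - y i) (\<lambda>i. gradient d (U j) x i - gradient d (U j) y i))"
    unfolding vdot_def by (rule sum.swap)
  finally show ?thesis .
qed

text \<open>A modulus of strong monotonicity cannot exceed a Lipschitz constant of the same
  gradient; \<open>d \<ge> 1\<close> provides two distinct points. Two unrelated admissible pairs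
  are allowed so that a pair fixed once for \<open>U\<close> can be compared with the one that
  governs the step size.\<close>

lemma sgld_mU_le:
  assumes cond: "sgld_condition d K U LU mU" and cond': "sgld_condition d K U LU' mU'" and d: "1 \<le> d"
  shows "mU \<le> LU' * (real K + 1)"
proof -
  define x y :: vec where "x = (\<lambda>i\<in>{..<d}. 1)" and "y = (\<lambda>i\<in>{..<d}. 0)"
  have x: "x \<in> rvec d" and y: "y \<in> rvec d" by (auto simp: x_def y_def rvec_def)
  have ne: "0 < (vdist d x y)\<^sup>2" using d by (simp add: vdist_power2 x_def y_def)
  have "mU * (vdist d x y)\<^sup>2
      \<le> (\<Sum>j\<le>K. vdot d (\<lambda>i. x i - y i) (\<lambda>i. gradient d (U j) x i - gradient d (U j) y i))"
    by (rule sgld_strongly_monotone[OF cond x y])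
  also have "\<dots> \<le> (\<Sum>j\<le>K. LU' * (vdist d x y)\<^sup>2)"
  proof (rule sum_mono)
    fix j assume j: "j \<in> {..K}"
    have "vdot d (\<lambda>i. x i - y i) (\<lambda>i. gradient d (U j) x i - gradient d (U j) y i)
        \<le> vdist d x y * vdist d (gradient d (U j) x) (gradient d (U j) y)" by (rule vdot_le)
    also have "\<dots> \<le> vdist d x y * (LU' * vdist d x y)"
      using cond' j x y by (intro mult_left_mono) (auto simp: sgld_condition_def lipschitz_gradient_def)
    finally show "vdot d (\<lambda>i. x i - y i) (\<lambda>i. gradient d (U j) x i - gradient d (U j) y i) \<le> LU' * (vdist d x y)\<^sup>2"
      by (simp add: power2_eq_square mult_ac)
  qed
  also have "\<dots> = LU' * (real K + 1) * (vdist d x y)\<^sup>2" by (simp add: algebra_simps)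
  finally show ?thesis using ne by simp
qed

text \<open>Cauchy-Schwarz with weight 1 on \<open>a0\<close> and weight \<open>K / M\<close> on
  each of the M batch members. The total weight \<open>K + 1\<close> is the origin of that factor in
  the step-size restriction.\<close>

lemma weighted_square_le:
  fixes a0 :: real and a :: "nat \<Rightarrow> real"
  assumes M: "1 \<le> M" "1 \<le> K" and S: "finite S" "card S = M"
  shows "(a0 + real K / real M * (\<Sum>j\<in>S. a j))\<^sup>2
    \<le> (real K + 1) * (a0\<^sup>2 + real K / real M * (\<Sum>j\<in>S. (a j)\<^sup>2))"
proof -
  let ?s = "real K / real M * (\<Sum>j\<in>S. a j)"
  have "(\<Sum>j\<in>S. a j)\<^sup>2 \<le> real M * (\<Sum>j\<in>S. (a j)\<^sup>2)"
    using sum_squared_le_sum_of_squares[of a S] S by (simp add: mult.commute)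
  then have "?s\<^sup>2 \<le> (real K / real M)\<^sup>2 * (real M * (\<Sum>j\<in>S. (a j)\<^sup>2))"
    unfolding power_mult_distrib by (rule mult_left_mono) simp
  also have "\<dots> = real K * (real K / real M * (\<Sum>j\<in>S. (a j)\<^sup>2))"
    using M by (simp add: power2_eq_square)
  finally have s: "?s\<^sup>2 / real K \<le> real K / real M * (\<Sum>j\<in>S. (a j)\<^sup>2)"
    using M by (simp add: divide_le_eq mult.commute)
  have "(a0 + ?s)\<^sup>2 \<le> (real K + 1) * (a0\<^sup>2 + ?s\<^sup>2 / real K)"
  proof -
    have "0 \<le> (real K * a0 - ?s)\<^sup>2 / real K" using M by simp
    also have "\<dots> = (real K + 1) * (a0\<^sup>2 + ?s\<^sup>2 / real K) - (a0 + ?s)\<^sup>2"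
    proof -
      have "(k * a - s)\<^sup>2 / k = (k + 1) * (a\<^sup>2 + s\<^sup>2 / k) - (a + s)\<^sup>2" if "k \<noteq> 0" for k a s :: real
        using that by (simp add: field_simps power2_eq_square)
      then show ?thesis using M by simp
    qed
    finally show ?thesis by simp
  qed
  also have "\<dots> \<le> (real K + 1) * (a0\<^sup>2 + real K / real M * (\<Sum>j\<in>S. (a j)\<^sup>2))"
    using s by (intro mult_left_mono add_left_mono) auto
  finally show ?thesis .
qed

text \<open>A non-empty step-size interval forces \<open>LU\<close> to be positive: otherwise its
  right endpoint is at most 0, also for \<open>LU = 0\<close>, since
  \<open>inverse 0 = 0\<close>.\<close>

lemma step_size_bounds:
  assumes "\<gamma> \<in> {0<..<inverse LU * inverse (real K + 1)}"
  shows "0 < LU" "0 < \<gamma>" "\<gamma> * (LU * (real K + 1)) < 1"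
proof -
  show LU: "0 < LU"
  proof (rule ccontr)
    assume "\<not> 0 < LU"
    then have "inverse LU * inverse (real K + 1) \<le> 0" by (intro mult_nonpos_nonneg) auto
    then show False using assms by auto
  qed
  show "0 < \<gamma>" using assms by simp
  have "\<gamma> * (LU * (real K + 1)) < inverse LU * inverse (real K + 1) * (LU * (real K + 1))"
    using assms LU by (intro mult_strict_right_mono) auto
  also have "\<dots> = (inverse LU * LU) * (inverse (real K + 1) * (real K + 1))" by (simp only: mult_ac)
  also have "\<dots> = 1" using LU by (subst (1 2) left_inverse) auto
  finally show "\<gamma> * (LU * (real K + 1)) < 1" .
qed

text \<open>A single batch yields only that distances do not grow, with a gain
  \<open>\<gamma> * P S\<close> from cocoercivity, because strong convexity is imposed on the full
  potential alone. Averaging the gain over the batches restores the full gradient and with it the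
  modulus \<open>mU\<close>.\<close>

lemma sgld_batch_contraction:
  assumes cond: "sgld_condition d K U LU mU" and M: "M \<in> {1..K}"
    and \<gamma>: "\<gamma> \<in> {0<..<inverse LU * inverse (real K + 1)}"
    and x: "x \<in> rvec d" and y: "y \<in> rvec d"
  defines "A z S \<equiv> \<lambda>i\<in>{..<d}. z i - \<gamma> * stoch_gradient d K M U z S i"
  shows "(\<Sum>S\<in>batches K M. (vdist d (A x S) (A y S))\<^sup>2) / card (batches K M)
    \<le> (1 - \<gamma> * mU) * (vdist d x y)\<^sup>2"
proof -
  have C: "cont_differentiable d (U j)" "lipschitz_gradient d LU (U j)" "convex_fun d (U j)" if "j \<le> K" for j
    using cond that by (auto simp: sgld_condition_def)
  note LU = step_size_bounds(1)[OF \<gamma>] and \<gamma>0 = step_size_bounds(2)[OF \<gamma>]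
    and \<gamma>' = less_imp_le[OF step_size_bounds(3)[OF \<gamma>]]
  define D where "D i = x i - y i" for i
  define a where "a j i = gradient d (U j) x i - gradient d (U j) y i" for j i
  define p where "p j = vdot d D (a j)" for j
  define P where "P S = p 0 + real K / real M * (\<Sum>j\<in>S. p j)" for S
  have coc: "(\<Sum>i<d. (a j i)\<^sup>2) \<le> LU * p j" if "j \<le> K" for j
    unfolding a_def p_def D_def using cocoercive[OF C[OF that] LU x y] .
  have step: "(vdist d (A x S) (A y S))\<^sup>2 \<le> (vdist d x y)\<^sup>2 - \<gamma> * P S" if S: "S \<in> batches K M" for S
  proof -
    have fS: "finite S" "card S = M" "S \<subseteq> {1..K}" using S by (auto simp: batches_def intro: finite_subset)
    define g where "g i = a 0 i + real K / real M * (\<Sum>j\<in>S. a j i)" for i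
    have Dg: "(\<Sum>i<d. D i * g i) = P S"
    proof -
      have "(\<Sum>i<d. D i * g i) = p 0 + real K / real M * (\<Sum>i<d. \<Sum>j\<in>S. D i * a j i)"
        by (simp add: g_def p_def vdot_def sum.distrib sum_distrib_left algebra_simps)
      also have "(\<Sum>i<d. \<Sum>j\<in>S. D i * a j i) = (\<Sum>j\<in>S. p j)"
        unfolding p_def vdot_def by (rule sum.swap)
      finally show ?thesis by (simp add: P_def)
    qed
    have g2: "(\<Sum>i<d. (g i)\<^sup>2) \<le> (real K + 1) * LU * P S"
    proof -
      have "(\<Sum>i<d. (g i)\<^sup>2) \<le> (\<Sum>i<d. (real K + 1) * ((a 0 i)\<^sup>2 + real K / real M * (\<Sum>j\<in>S. (a j i)\<^sup>2)))"
        unfolding g_def using M fS by (intro sum_mono weighted_square_le) auto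
      also have "\<dots> = (real K + 1) * ((\<Sum>i<d. (a 0 i)\<^sup>2) + real K / real M * (\<Sum>i<d. \<Sum>j\<in>S. (a j i)\<^sup>2))"
        by (simp only: sum.distrib sum_distrib_left[symmetric])
      also have "(\<Sum>i<d. \<Sum>j\<in>S. (a j i)\<^sup>2) = (\<Sum>j\<in>S. \<Sum>i<d. (a j i)\<^sup>2)" by (rule sum.swap)
      also have "(real K + 1) * ((\<Sum>i<d. (a 0 i)\<^sup>2) + real K / real M * (\<Sum>j\<in>S. \<Sum>i<d. (a j i)\<^sup>2))
          \<le> (real K + 1) * (LU * p 0 + real K / real M * (\<Sum>j\<in>S. LU * p j))"
        using fS coc by (intro mult_left_mono add_mono sum_mono) auto
      also have "\<dots> = (real K + 1) * LU * P S"
        by (simp add: P_def sum_distrib_left[symmetric] algebra_simps)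
      finally show ?thesis .
    qed
    have "0 \<le> (\<Sum>i<d. (g i)\<^sup>2)" by (simp add: sum_nonneg)
    then have "0 \<le> (real K + 1) * LU * P S" using g2 by linarith
    moreover have "0 < (real K + 1) * LU" using LU by simp
    \<comment> \<open>The sign is read off from \<open>g2\<close>: a sum of squares is bounded by a
      positive multiple of \<open>P S\<close>.\<close>
    ultimately have P0: "0 \<le> P S" by (meson zero_le_mult_iff not_less)
    have "(vdist d (A x S) (A y S))\<^sup>2 = (\<Sum>i<d. (D i - \<gamma> * g i)\<^sup>2)"
      by (auto simp: vdist_power2 A_def D_def g_def a_def stoch_gradient_def sum_subtractf algebra_simps intro!: sum.cong)
    also have "\<dots> = (vdist d x y)\<^sup>2 - 2 * \<gamma> * (\<Sum>i<d. D i * g i) + \<gamma>\<^sup>2 * (\<Sum>i<d. (g i)\<^sup>2)"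
      by (simp add: vdist_power2 D_def power2_diff power_mult_distrib sum.distrib sum_subtractf sum_distrib_left mult_ac)
    also have "\<gamma>\<^sup>2 * (\<Sum>i<d. (g i)\<^sup>2) \<le> \<gamma>\<^sup>2 * ((real K + 1) * LU * P S)"
      by (intro mult_left_mono g2) auto
    also have "\<dots> = (\<gamma> * (LU * (real K + 1))) * (\<gamma> * P S)" by (simp add: power2_eq_square mult_ac)
    \<comment> \<open>The step-size restriction lets the quadratic term consume at most half of the
      linear term \<open>2 * \<gamma> * P S\<close>.\<close>
    also have "\<dots> \<le> 1 * (\<gamma> * P S)" using \<gamma>' \<gamma>0 P0 by (intro mult_right_mono) auto
    finally show ?thesis by (simp add: Dg)
  qed
  have ne: "0 < real (card (batches K M))"
    using batches_nonempty[OF M] by (simp add: card_gt_0_iff)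
  have "(\<Sum>S\<in>batches K M. (vdist d (A x S) (A y S))\<^sup>2) / card (batches K M)
      \<le> (\<Sum>S\<in>batches K M. (vdist d x y)\<^sup>2 - \<gamma> * P S) / card (batches K M)"
    using ne by (intro divide_right_mono sum_mono step) auto
  also have "\<dots> = (vdist d x y)\<^sup>2 - \<gamma> * ((\<Sum>S\<in>batches K M. P S) / card (batches K M))"
    using batches_nonempty[OF M] by (simp add: sum_subtractf sum_distrib_left[symmetric] diff_divide_distrib)
  also have "(\<Sum>S\<in>batches K M. P S) / card (batches K M) = p 0 + (\<Sum>j=1..K. p j)"
    using ne batches_nonempty[OF M] batch_average[OF M, of p] by (simp add: P_def sum.distrib add_divide_distrib)
  also have "p 0 + (\<Sum>j=1..K. p j) = (\<Sum>j\<le>K. p j)"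
    by (simp add: atMost_atLeast0 sum.atLeast_Suc_atMost)
  also have "(vdist d x y)\<^sup>2 - \<gamma> * (\<Sum>j\<le>K. p j) \<le> (vdist d x y)\<^sup>2 - \<gamma> * (mU * (vdist d x y)\<^sup>2)"
    using sgld_strongly_monotone[OF cond x y] \<gamma>0
    by (intro diff_left_mono mult_left_mono) (simp_all add: p_def a_def[abs_def] D_def[abs_def])
  finally show ?thesis by (simp add: algebra_simps)
qed

text \<open>The step size is tied to \<open>LU\<close>, yet any admissible modulus is at most
  \<open>LU * (real K + 1)\<close>. The last claim is therefore available for a second pair, whose
  modulus then bounds \<gamma>.\<close>

lemma gamma_bounds:
  assumes cond: "sgld_condition d K U LU mU" and d: "1 \<le> d"
    and \<gamma>: "\<gamma> \<in> {0<..<inverse LU * inverse (real K + 1)}"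
  shows "0 < LU" "0 < \<gamma>" "0 < mU" "mU * \<gamma> < 1" "sgld_condition d K U LU' mU' \<Longrightarrow> mU' * \<gamma> < 1"
proof -
  note LU = step_size_bounds(1)[OF \<gamma>] and \<gamma>0 = step_size_bounds(2)[OF \<gamma>]
  show "0 < LU" "0 < \<gamma>" by (rule LU, rule \<gamma>0)
  show "0 < mU" using cond by (simp add: sgld_condition_def)
  have *: "m * \<gamma> < 1" if "sgld_condition d K U L' m" for L' m
  proof -
    have "m * \<gamma> \<le> (LU * (real K + 1)) * \<gamma>"
      using sgld_mU_le[OF that cond d] \<gamma>0 by (intro mult_right_mono) auto
    then show ?thesis using step_size_bounds(3)[OF \<gamma>] by (simp add: mult.commute)
  qed
  show "mU * \<gamma> < 1" by (rule *[OF cond])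
  show "mU' * \<gamma> < 1" if "sgld_condition d K U LU' mU'" by (rule *[OF that])
qed

lemma Delta1_bounds:
  assumes "0 < mU" "0 < \<gamma>" "mU * \<gamma> < 1"
  shows "0 < Delta1 \<gamma> mU" "Delta1 \<gamma> mU < 1" "mU * \<gamma> / 2 \<le> 1 - Delta1 \<gamma> mU"
proof -
  have q: "0 < mU * \<gamma>" using assms by simp
  show "0 < Delta1 \<gamma> mU" using assms by (simp add: Delta1_def mult.commute)
  show "Delta1 \<gamma> mU < 1" using q by (simp add: Delta1_def mult.commute)
  have "Delta1 \<gamma> mU \<le> 1 - mU * \<gamma> / 2"
    unfolding Delta1_def using assms by (intro real_le_lsqrt) (auto simp: power2_eq_square algebra_simps)
  then show "mU * \<gamma> / 2 \<le> 1 - Delta1 \<gamma> mU" by simp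
qed

lemma nn_integral_fst_factor:
  assumes "prob_space B" and [measurable]: "f \<in> borel_measurable A"
  shows "(\<integral>\<^sup>+v. f (fst v) \<partial>(A \<Otimes>\<^sub>M B)) = (\<integral>\<^sup>+x. f x \<partial>A)"
proof -
  interpret B: prob_space B by fact
  show ?thesis
    by (subst B.nn_integral_fst[symmetric]) (auto simp: B.emeasure_space_1)
qed

lemma nn_integral_snd_factor:
  assumes "prob_space A" "prob_space B" and [measurable]: "f \<in> borel_measurable B"
  shows "(\<integral>\<^sup>+v. f (snd v) \<partial>(A \<Otimes>\<^sub>M B)) = (\<integral>\<^sup>+x. f x \<partial>B)"
proof -
  interpret A: prob_space A by fact
  interpret B: prob_space B by fact
  show ?thesis
    by (subst B.nn_integral_fst[symmetric]) (auto simp: A.emeasure_space_1)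
qed

lemma mean_le_sqrt_mean_square:
  fixes f :: "'a \<Rightarrow> real"
  assumes "finite A" "A \<noteq> {}"
  shows "(\<Sum>x\<in>A. f x) / card A \<le> sqrt ((\<Sum>x\<in>A. (f x)\<^sup>2) / card A)"
proof (rule real_le_rsqrt)
  have c: "0 < real (card A)" using assms by (simp add: card_gt_0_iff)
  have "(\<Sum>x\<in>A. f x)\<^sup>2 \<le> real (card A) * (\<Sum>x\<in>A. (f x)\<^sup>2)"
    using sum_squared_le_sum_of_squares[of f A] by (simp add: mult.commute)
  then show "((\<Sum>x\<in>A. f x) / card A)\<^sup>2 \<le> (\<Sum>x\<in>A. (f x)\<^sup>2) / card A"
    using c by (simp add: power_divide divide_simps power2_eq_square mult_ac)
qed

text \<open>The Gaussian noise cancels in the difference and the new batches agree, so only the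
  driving batch is averaged. Contraction holds for the mean square; Jensen's inequality passes to
  the mean and explains the square root in \<open>Delta1\<close>.\<close>

lemma sgld_step_contraction:
  assumes cond: "sgld_condition d K U LU mU" and M: "M \<in> {1..K}" and d: "1 \<le> d"
    and \<gamma>: "\<gamma> \<in> {0<..<inverse LU * inverse (real K + 1)}"
    and x: "x \<in> space (state_space d K M)" and y: "y \<in> space (state_space d K M)"
  shows "(\<integral>\<^sup>+v. ennreal (dX d (sgld_step d K M U \<gamma> x v) (sgld_step d K M U \<gamma> y v)) \<partial>sgld_noise d K M)
    \<le> ennreal (Delta1 \<gamma> mU * dX d x y)"
proof -
  define A where "A z S = (\<lambda>i\<in>{..<d}. z i - \<gamma> * stoch_gradient d K M U z S i)" for z S
  have x': "fst x \<in> rvec d" and y': "fst y \<in> rvec d" using x y by (auto simp: space_state_space)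
  have B: "batches K M \<noteq> {}" by (rule batches_nonempty[OF M])
  have eq: "dX d (sgld_step d K M U \<gamma> x v) (sgld_step d K M U \<gamma> y v) = vdist d (A (fst x) (fst v)) (A (fst y) (fst v))" for v
    unfolding vdist_def by (auto simp: dX_def sgld_step_def A_def vdist_def intro!: L2_set_cong)
  have "(\<integral>\<^sup>+v. ennreal (dX d (sgld_step d K M U \<gamma> x v) (sgld_step d K M U \<gamma> y v)) \<partial>sgld_noise d K M)
      = (\<integral>\<^sup>+S. ennreal (vdist d (A (fst x) S) (A (fst y) S)) \<partial>batch_law K M)"
    unfolding eq sgld_noise_def
    by (rule nn_integral_fst_factor) (auto intro!: prob_space_pair prob_space_batch_law prob_space_std_gaussian M
          simp: measurable_cong_sets[OF sets_batch_law refl])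
  also have "\<dots> = ennreal ((\<Sum>S\<in>batches K M. vdist d (A (fst x) S) (A (fst y) S)) / card (batches K M))"
    by (rule nn_integral_batch_law) simp
  also have "\<dots> \<le> ennreal (Delta1 \<gamma> mU * dX d x y)"
  proof (rule ennreal_leI)
    have "(\<Sum>S\<in>batches K M. vdist d (A (fst x) S) (A (fst y) S)) / card (batches K M)
        \<le> sqrt ((\<Sum>S\<in>batches K M. (vdist d (A (fst x) S) (A (fst y) S))\<^sup>2) / card (batches K M))"
      by (rule mean_le_sqrt_mean_square) (auto simp: B)
    also have "\<dots> \<le> sqrt ((1 - \<gamma> * mU) * (vdist d (fst x) (fst y))\<^sup>2)"
      unfolding A_def by (intro real_sqrt_le_mono sgld_batch_contraction[OF cond M \<gamma> x' y'])
    also have "\<dots> = Delta1 \<gamma> mU * vdist d (fst x) (fst y)"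
      by (simp add: Delta1_def real_sqrt_mult)
    also have "\<dots> \<le> Delta1 \<gamma> mU * dX d x y"
      using Delta1_bounds(1)[OF gamma_bounds(3,2,4)[OF cond d \<gamma>]] by (intro mult_left_mono) (auto simp: dX_def)
    finally show "(\<Sum>S\<in>batches K M. vdist d (A (fst x) S) (A (fst y) S)) / card (batches K M) \<le> Delta1 \<gamma> mU * dX d x y" .
  qed
  finally show ?thesis .
qed

section \<open>Drift from a reference state\<close>

definition state0 :: "nat \<Rightarrow> nat \<Rightarrow> state" where
  "state0 d M = (\<lambda>i\<in>{..<d}. 0, {1..M})"

lemma state0_space: "M \<in> {1..K} \<Longrightarrow> state0 d M \<in> space (state_space d K M)"
  by (auto simp: state0_def space_state_space rvec_def batches_def)

text \<open>Explicit and increasing in \<gamma>, so that its value at the largest conceivable step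
  size serves for all. Summing over all batches dominates the batch actually drawn,
  \<open>sqrt (2 * \<gamma>) * d\<close> dominates the mean noise since the absolute moment of a
  standard normal is at most 1, and the final 1 covers the batch indicator.\<close>

definition drift_const :: "nat \<Rightarrow> nat \<Rightarrow> nat \<Rightarrow> (nat \<Rightarrow> vec \<Rightarrow> real) \<Rightarrow> real \<Rightarrow> real" where
  "drift_const d K M U \<gamma> =
     \<gamma> * (\<Sum>S\<in>batches K M. \<Sum>i<d. \<bar>stoch_gradient d K M U (fst (state0 d M)) S i\<bar>) + sqrt (2 * \<gamma>) * d + 1"

lemma distr_std_gaussian_component:
  assumes "i < d"
  shows "distr (std_gaussian d) borel (\<lambda>z. z i) = density lborel std_normal_density"
proof -
  have "distr (std_gaussian d) (density lborel std_normal_density) (\<lambda>z. z i) = density lborel std_normal_density"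
    unfolding std_gaussian_def using assms by (intro distr_PiM_component prob_space_normal_density) auto
  moreover have "distr (std_gaussian d) (density lborel std_normal_density) (\<lambda>z. z i) = distr (std_gaussian d) borel (\<lambda>z. z i)"
    by (rule distr_cong) auto
  ultimately show ?thesis by simp
qed

lemma nn_integral_std_gaussian_component:
  assumes i: "i < d" and [measurable]: "f \<in> borel_measurable borel"
  shows "(\<integral>\<^sup>+z. f (z i) \<partial>std_gaussian d) = (\<integral>\<^sup>+t. f t \<partial>density lborel std_normal_density)"
proof -
  have [measurable]: "(\<lambda>z. z i) \<in> borel_measurable (std_gaussian d)"
    unfolding measurable_cong_sets[OF sets_std_gaussian refl] using i by measurable
  show ?thesis
    by (subst distr_std_gaussian_component[OF i, symmetric], subst nn_integral_distr) auto
qed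

lemma std_normal_abs_moment:
  "(\<integral>\<^sup>+t. ennreal \<bar>t\<bar> \<partial>density lborel std_normal_density) = ennreal (sqrt (2 / pi))"
proof -
  have "(\<integral>\<^sup>+t. ennreal \<bar>t\<bar> \<partial>density lborel std_normal_density)
      = (\<integral>\<^sup>+t. ennreal (std_normal_density t * \<bar>t\<bar>) \<partial>lborel)"
    by (subst nn_integral_density) (auto simp: ennreal_mult')
  also have "\<dots> = ennreal (\<integral>t. std_normal_density t * \<bar>t\<bar> \<partial>lborel)"
    using integrable_std_normal_moment_abs[of 1] by (intro nn_integral_eq_integral) auto
  finally show ?thesis using integral_std_normal_moment_abs_odd[of 0] by simp
qed

lemma sgld_step_drift:
  assumes M: "M \<in> {1..K}" and \<gamma>: "0 < \<gamma>" and C: "\<And>j. j \<le> K \<Longrightarrow> cont_differentiable d (U j)"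
  shows "(\<integral>\<^sup>+v. ennreal (dX d (sgld_step d K M U \<gamma> (state0 d M) v) (state0 d M)) \<partial>sgld_noise d K M)
    \<le> ennreal (drift_const d K M U \<gamma>)"
proof -
  let ?\<nu> = "sgld_noise d K M"
  let ?G = "\<lambda>S i. stoch_gradient d K M U (fst (state0 d M)) S i"
  define g0 where "g0 = (\<Sum>S\<in>batches K M. \<Sum>i<d. \<bar>?G S i\<bar>)"
  have g0: "0 \<le> g0" by (simp add: g0_def sum_nonneg)
  interpret \<nu>: prob_space ?\<nu> by (rule prob_space_sgld_noise[OF M])
  have meas[measurable]: "(\<lambda>v. snd (snd v) i) \<in> borel_measurable ?\<nu>" if "i < d" for i
  proof -
    have "(\<lambda>v. snd (snd v)) \<in> ?\<nu> \<rightarrow>\<^sub>M vborel d" unfolding sgld_noise_def by measurable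
    then show ?thesis using that by (rule vborel_component[rotated])
  qed
  have moment: "(\<integral>\<^sup>+v. ennreal \<bar>snd (snd v) i\<bar> \<partial>?\<nu>) \<le> 1" if i: "i < d" for i
  proof -
    have zi: "(\<lambda>z. ennreal \<bar>z i\<bar>) \<in> borel_measurable (std_gaussian d)"
      unfolding measurable_cong_sets[OF sets_std_gaussian refl] using i by measurable
    have "(\<integral>\<^sup>+v. ennreal \<bar>snd (snd v) i\<bar> \<partial>?\<nu>)
        = (\<integral>\<^sup>+w. ennreal \<bar>snd w i\<bar> \<partial>(batch_law K M \<Otimes>\<^sub>M std_gaussian d))"
      unfolding sgld_noise_def using zi
      by (intro nn_integral_snd_factor[where f = "\<lambda>w. ennreal \<bar>snd w i\<bar>"] prob_space_pair prob_space_batch_law prob_space_std_gaussian M)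
         (auto intro: measurable_compose[OF measurable_snd])
    also have "\<dots> = (\<integral>\<^sup>+z. ennreal \<bar>z i\<bar> \<partial>std_gaussian d)"
      using zi by (intro nn_integral_snd_factor[where f = "\<lambda>z. ennreal \<bar>z i\<bar>"] prob_space_batch_law prob_space_std_gaussian M)
    also have "\<dots> = ennreal (sqrt (2 / pi))"
      using std_normal_abs_moment by (simp add: nn_integral_std_gaussian_component[OF i, where f = "\<lambda>t. ennreal \<bar>t\<bar>"])
    also have "\<dots> \<le> 1" using pi_gt3 by (simp add: ennreal_le_1)
    finally show ?thesis .
  qed
  have pt: "dX d (sgld_step d K M U \<gamma> (state0 d M) v) (state0 d M) \<le> \<gamma> * g0 + 1 + (\<Sum>i<d. sqrt (2 * \<gamma>) * \<bar>snd (snd v) i\<bar>)"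
    if "v \<in> space ?\<nu>" for v
  proof -
    have S: "fst v \<in> batches K M" using that by (auto simp: sgld_noise_def space_pair_measure)
    have "vdist d (fst (sgld_step d K M U \<gamma> (state0 d M) v)) (fst (state0 d M))
        \<le> (\<Sum>i<d. \<bar>sqrt (2 * \<gamma>) * snd (snd v) i - \<gamma> * ?G (fst v) i\<bar>)"
      by (rule order_trans[OF vdist_le_sum]) (simp add: sgld_step_def state0_def)
    also have "\<dots> \<le> (\<Sum>i<d. sqrt (2 * \<gamma>) * \<bar>snd (snd v) i\<bar> + \<gamma> * \<bar>?G (fst v) i\<bar>)"
      using \<gamma> by (intro sum_mono order_trans[OF abs_triangle_ineq4]) (auto simp: abs_mult)
    also have "\<dots> = (\<Sum>i<d. sqrt (2 * \<gamma>) * \<bar>snd (snd v) i\<bar>) + \<gamma> * (\<Sum>i<d. \<bar>?G (fst v) i\<bar>)"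
      by (simp add: sum.distrib sum_distrib_left)
    also have "(\<Sum>i<d. \<bar>?G (fst v) i\<bar>) \<le> g0"
      unfolding g0_def using S by (intro member_le_sum) (auto simp: sum_nonneg)
    finally show ?thesis using \<gamma> by (simp add: dX_def)
  qed
  have "(\<integral>\<^sup>+v. ennreal (dX d (sgld_step d K M U \<gamma> (state0 d M) v) (state0 d M)) \<partial>?\<nu>)
      \<le> (\<integral>\<^sup>+v. ennreal (\<gamma> * g0 + 1) + (\<Sum>i<d. ennreal (sqrt (2 * \<gamma>)) * ennreal \<bar>snd (snd v) i\<bar>) \<partial>?\<nu>)"
  proof (rule nn_integral_mono)
    fix v assume "v \<in> space ?\<nu>"
    from ennreal_leI[OF pt[OF this]]
    have "ennreal (dX d (sgld_step d K M U \<gamma> (state0 d M) v) (state0 d M))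
        \<le> ennreal ((\<gamma> * g0 + 1) + (\<Sum>i<d. sqrt (2 * \<gamma>) * \<bar>snd (snd v) i\<bar>))" .
    also have "\<dots> = ennreal (\<gamma> * g0 + 1) + ennreal (\<Sum>i<d. sqrt (2 * \<gamma>) * \<bar>snd (snd v) i\<bar>)"
      using \<gamma> g0 by (intro ennreal_plus) (auto intro!: sum_nonneg)
    also have "ennreal (\<Sum>i<d. sqrt (2 * \<gamma>) * \<bar>snd (snd v) i\<bar>) = (\<Sum>i<d. ennreal (sqrt (2 * \<gamma>)) * ennreal \<bar>snd (snd v) i\<bar>)"
      using \<gamma> by (subst sum_ennreal[symmetric]) (auto simp: ennreal_mult')
    finally show "ennreal (dX d (sgld_step d K M U \<gamma> (state0 d M) v) (state0 d M))
        \<le> ennreal (\<gamma> * g0 + 1) + (\<Sum>i<d. ennreal (sqrt (2 * \<gamma>)) * ennreal \<bar>snd (snd v) i\<bar>)" .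
  qed
  also have "\<dots> = ennreal (\<gamma> * g0 + 1) + (\<Sum>i<d. ennreal (sqrt (2 * \<gamma>)) * (\<integral>\<^sup>+v. ennreal \<bar>snd (snd v) i\<bar> \<partial>?\<nu>))"
    by (subst nn_integral_add, simp, measurable, subst nn_integral_sum)
       (auto simp: nn_integral_cmult \<nu>.emeasure_space_1)
  also have "\<dots> \<le> ennreal (\<gamma> * g0 + 1) + (\<Sum>i<d. ennreal (sqrt (2 * \<gamma>)) * 1)"
    by (intro add_mono sum_mono mult_left_mono moment) auto
  also have "\<dots> = ennreal (drift_const d K M U \<gamma>)"
    using \<gamma> g0 unfolding drift_const_def g0_def[symmetric]
    by (simp add: ennreal_plus[symmetric] ennreal_of_nat_eq_real_of_nat ennreal_mult'[symmetric] mult.commute del: ennreal_plus)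
  finally show ?thesis .
qed

lemma drift_const_nonneg: "0 < \<gamma> \<Longrightarrow> 0 \<le> drift_const d K M U \<gamma>"
  by (simp add: drift_const_def sum_nonneg)

section \<open>The Wasserstein quantities of the bound\<close>

lemma dX_commute: "dX d x y = dX d y x"
  by (simp add: dX_def vdist_commute)

section \<open>SGLD as a contractive chain of iterated random functions\<close>

lemma sgld_contractive:
  assumes cond: "sgld_condition d K U LU mU" and M: "M \<in> {1..K}" and d: "1 \<le> d"
    and \<gamma>: "\<gamma> \<in> {0<..<inverse LU * inverse (real K + 1)}"
  shows "contractive_chain (sgld_noise d K M) (state_space d K M) (sgld_step d K M U \<gamma>) (dX d)
    (Delta1 \<gamma> mU) (drift_const d K M U \<gamma>) (state0 d M)"
proof -
  note b = gamma_bounds[OF cond d \<gamma>]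
  note \<Delta> = Delta1_bounds[OF b(3,2,4)]
  have C: "\<And>j. j \<le> K \<Longrightarrow> cont_differentiable d (U j)" using cond by (simp add: sgld_condition_def)
  interpret product_prob_space "\<lambda>_::nat. sgld_noise d K M" UNIV
    by (rule product_prob_spaceI) (rule prob_space_sgld_noise[OF M])
  interpret sequence_space "sgld_noise d K M" ..
  show ?thesis
    by unfold_locales
      (use \<Delta> b sgld_step_measurable[OF C] dX_measurable dX_nonneg dX_triangle state0_space[OF M]
        sgld_step_contraction[OF cond M d \<gamma>] sgld_step_drift[OF M b(2) C] drift_const_nonneg[OF b(2)] in auto)
qed

lemma sgld_space_eq: "sgld_space d K M \<xi> = \<xi> \<Otimes>\<^sub>M (\<Pi>\<^sub>M i\<in>(UNIV::nat set). sgld_noise d K M)"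
  by (simp add: sgld_space_def sgld_noise_def)

lemma sgld_chain_orbit: "sgld_chain d K M U \<gamma> k \<omega> = orbit (sgld_step d K M U \<gamma>) (fst \<omega>) (snd \<omega>) k"
proof (induction k)
  case (Suc k)
  have "sgld_theta d K M U \<gamma> \<omega> k = fst (orbit (sgld_step d K M U \<gamma>) (fst \<omega>) (snd \<omega>) k)"
    by (simp add: Suc[symmetric] sgld_chain_def)
  then show ?case
    using sgld_step_def[of d K M U \<gamma> "orbit (sgld_step d K M U \<gamma>) (fst \<omega>) (snd \<omega>) k" "snd \<omega> k"]
    by (simp add: sgld_chain_def sgld_aux_batch_def split_beta')
qed (simp add: sgld_chain_def sgld_aux_batch_def)

text \<open>\<open>sgld_invariant\<close> is phrased with the whole noise sequence and the chain at
  time 1. Only coordinate 0 of the sequence enters there, and its marginal is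
  \<open>sgld_noise\<close>, which gives invariance under the one-step kernel.\<close>

lemma sgld_invariant_imp_invariant:
  assumes chain: "contractive_chain (sgld_noise d K M) (state_space d K M) (sgld_step d K M U \<gamma>) D \<rho> \<kappa> x0"
    and inv: "sgld_invariant d K M U \<gamma> \<pi>"
  shows "contractive_chain.invariant (sgld_noise d K M) (state_space d K M) (sgld_step d K M U \<gamma>) \<pi>"
proof -
  interpret C: contractive_chain "sgld_noise d K M" "state_space d K M" "sgld_step d K M U \<gamma>" D \<rho> \<kappa> x0
    by (rule chain)
  have pi: "prob_space \<pi>" and sets[measurable_cong]: "sets \<pi> = sets (state_space d K M)"
    using inv by (auto simp: sgld_invariant_def)
  have N: "distr C.S (sgld_noise d K M) (\<lambda>\<eta>. \<eta> 0) = sgld_noise d K M"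
    by (rule distr_PiM_component) (auto intro: C.prob_space_N)
  interpret pi: prob_space \<pi> by (rule pi)
  have "\<pi> \<Otimes>\<^sub>M sgld_noise d K M = distr \<pi> \<pi> (\<lambda>x. x) \<Otimes>\<^sub>M distr C.S (sgld_noise d K M) (\<lambda>\<eta>. \<eta> 0)"
    by (simp add: N distr_id)
  also have "\<dots> = distr (\<pi> \<Otimes>\<^sub>M C.S) (\<pi> \<Otimes>\<^sub>M sgld_noise d K M) (\<lambda>(x, \<eta>). (x, \<eta> 0))"
    by (rule pair_measure_distr) (auto simp: N C.M.sigma_finite_measure_axioms)
  finally have "distr (\<pi> \<Otimes>\<^sub>M sgld_noise d K M) (state_space d K M) (\<lambda>(x, v). sgld_step d K M U \<gamma> x v)
      = distr (distr (\<pi> \<Otimes>\<^sub>M C.S) (\<pi> \<Otimes>\<^sub>M sgld_noise d K M) (\<lambda>(x, \<eta>). (x, \<eta> 0))) (state_space d K M) (\<lambda>(x, v). sgld_step d K M U \<gamma> x v)"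
    by simp
  also have "\<dots> = distr (\<pi> \<Otimes>\<^sub>M C.S) (state_space d K M) (sgld_chain d K M U \<gamma> 1)"
    by (subst distr_distr) (auto simp: sgld_chain_orbit split_beta' o_def intro!: distr_cong)
  also have "\<dots> = \<pi>" using inv by (simp add: sgld_invariant_def sgld_space_eq)
  finally show ?thesis using pi sets by (simp add: C.invariant_def)
qed

section \<open>Wasserstein distance from a point mass\<close>

lemma dX_measurable2 [measurable (raw)]:
  "f \<in> R \<rightarrow>\<^sub>M state_space d K M \<Longrightarrow> g \<in> R \<rightarrow>\<^sub>M state_space d K M \<Longrightarrow> (\<lambda>r. dX d (f r) (g r)) \<in> borel_measurable R"
  using measurable_compose[OF measurable_Pair dX_measurable, of f R d K M g] by simp

text \<open>A coupling with a point mass charges only pairs whose first component is at distance 0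
  from x, so all couplings have the same cost and the infimum is over a constant.\<close>

lemma W1_return:
  assumes x: "x \<in> space (state_space d K M)" and pi: "prob_space \<pi>" and sets: "sets \<pi> = sets (state_space d K M)"
  shows "W1 d (return (state_space d K M) x) \<pi> = enn2real (\<integral>\<^sup>+y. ennreal (dX d x y) \<partial>\<pi>)"
proof -
  let ?X = "state_space d K M"
  let ?r = "return ?X x"
  note [measurable_cong] = sets and [measurable] = x
  interpret pi: prob_space \<pi> by (rule pi)
  interpret r: prob_space ?r by (rule prob_space_return[OF x])
  have val: "(\<integral>\<^sup>+z. ennreal (dX d (fst z) (snd z)) \<partial>\<zeta>) = (\<integral>\<^sup>+y. ennreal (dX d x y) \<partial>\<pi>)"
    if \<zeta>: "\<zeta> \<in> couplings ?r \<pi>" for \<zeta>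
  proof -
    have [measurable_cong]: "sets \<zeta> = sets (?X \<Otimes>\<^sub>M ?X)"
      using \<zeta> sets by (auto simp: couplings_def cong: sets_pair_measure_cong)
    have d1: "distr \<zeta> ?r fst = ?r" and d2: "distr \<zeta> \<pi> snd = \<pi>" using \<zeta> by (auto simp: couplings_def)
    \<comment> \<open>Concentration at x is expressed as distance 0 from x, which is a measurable
      condition; the triangle inequality then replaces \<open>fst z\<close> by x in the
      cost.\<close>
    have [measurable]: "Measurable.pred ?X (\<lambda>y. dX d x y = 0)" by measurable
    have "dX d x x = 0" by (simp add: dX_def vdist_def L2_set_def)
    then have "AE y in ?r. dX d x y = 0" by (subst AE_return) (auto simp: x)
    then have "AE y in distr \<zeta> ?r fst. dX d x y = 0" by (simp only: d1)
    then have AE: "AE z in \<zeta>. dX d x (fst z) = 0"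
      by (subst (asm) AE_distr_iff) auto
    have "(\<integral>\<^sup>+z. ennreal (dX d (fst z) (snd z)) \<partial>\<zeta>) = (\<integral>\<^sup>+z. ennreal (dX d x (snd z)) \<partial>\<zeta>)"
    proof (rule nn_integral_cong_AE, use AE in eventually_elim)
      fix z :: "state \<times> state" assume "dX d x (fst z) = 0"
      then have "dX d (fst z) (snd z) = dX d x (snd z)"
        using dX_triangle[of d "fst z" "snd z" x] dX_triangle[of d x "snd z" "fst z"] dX_commute[of d x "fst z"] by simp
      then show "ennreal (dX d (fst z) (snd z)) = ennreal (dX d x (snd z))" by simp
    qed
    also have "\<dots> = (\<integral>\<^sup>+y. ennreal (dX d x y) \<partial>distr \<zeta> \<pi> snd)"
      by (subst nn_integral_distr) auto
    finally show ?thesis by (simp only: d2)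
  qed
  \<comment> \<open>Without any coupling the infimum would be \<open>\<infinity>\<close>, which \<open>enn2real\<close> sends to \<open>0\<close>.\<close>
  have mem: "?r \<Otimes>\<^sub>M \<pi> \<in> couplings ?r \<pi>"
    unfolding couplings_def
  proof (safe intro!: measure_eqI)
    fix A assume "A \<in> sets (distr (?r \<Otimes>\<^sub>M \<pi>) ?r fst)"
    then have A[measurable]: "A \<in> sets ?X" by simp
    have [measurable]: "fst \<in> ?r \<Otimes>\<^sub>M \<pi> \<rightarrow>\<^sub>M ?X"
      using measurable_fst[of ?r \<pi>] by (simp add: measurable_cong_sets[OF refl sets_return])
    have "emeasure (distr (?r \<Otimes>\<^sub>M \<pi>) ?r fst) A = emeasure (?r \<Otimes>\<^sub>M \<pi>) (A \<times> space \<pi>)"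
      using sets.sets_into_space[OF A] by (subst emeasure_distr) (auto intro!: arg_cong2[where f = emeasure] simp: space_pair_measure)
    then show "emeasure (distr (?r \<Otimes>\<^sub>M \<pi>) ?r fst) A = emeasure ?r A"
      by (simp add: pi.emeasure_pair_measure_Times pi.emeasure_space_1)
  next
    fix A assume "A \<in> sets (distr (?r \<Otimes>\<^sub>M \<pi>) \<pi> snd)"
    then have A[measurable]: "A \<in> sets \<pi>" by simp
    have "emeasure (distr (?r \<Otimes>\<^sub>M \<pi>) \<pi> snd) A = emeasure (?r \<Otimes>\<^sub>M \<pi>) (space ?r \<times> A)"
      using sets.sets_into_space[OF A] by (subst emeasure_distr) (auto intro!: arg_cong2[where f = emeasure] simp: space_pair_measure)
    then show "emeasure (distr (?r \<Otimes>\<^sub>M \<pi>) \<pi> snd) A = emeasure \<pi> A"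
      using r.emeasure_space_1 by (subst (asm) pi.emeasure_pair_measure_Times) auto
  qed auto
  have "(INF \<zeta>\<in>couplings ?r \<pi>. \<integral>\<^sup>+z. ennreal (dX d (fst z) (snd z)) \<partial>\<zeta>) = (INF \<zeta>\<in>couplings ?r \<pi>. \<integral>\<^sup>+y. ennreal (dX d x y) \<partial>\<pi>)"
    by (intro INF_cong refl val)
  also have "\<dots> = (\<integral>\<^sup>+y. ennreal (dX d x y) \<partial>\<pi>)" using mem by (intro cINF_const) auto
  finally show ?thesis by (simp add: W1_def)
qed

section \<open>Lower bound for the spread of the invariant law\<close>

lemma std_normal_abs_shift:
  "ennreal (sqrt (2 / pi)) \<le> (\<integral>\<^sup>+t. ennreal \<bar>c - t\<bar> \<partial>density lborel std_normal_density)"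
proof -
  let ?N = "density lborel std_normal_density"
  have "(\<integral>\<^sup>+t. ennreal \<bar>c - t\<bar> \<partial>?N) = (\<integral>\<^sup>+t. ennreal (std_normal_density t) * ennreal \<bar>c - t\<bar> \<partial>lborel)"
    by (subst nn_integral_density) auto
  also have "\<dots> = (\<integral>\<^sup>+t. ennreal (std_normal_density (- t)) * ennreal \<bar>c + t\<bar> \<partial>lborel)"
    by (subst nn_integral_real_affine[where c = "-1" and t = 0]) auto
  also have "\<dots> = (\<integral>\<^sup>+t. ennreal \<bar>c + t\<bar> \<partial>?N)"
    by (subst nn_integral_density) (auto simp: normal_density_def)
  finally have sym: "(\<integral>\<^sup>+t. ennreal \<bar>c - t\<bar> \<partial>?N) = (\<integral>\<^sup>+t. ennreal \<bar>c + t\<bar> \<partial>?N)" .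
  \<comment> \<open>Averaging over t and its reflection:
    \<open>\<bar>c - t\<bar> + \<bar>c + t\<bar>\<close> is at least
    \<open>2 * \<bar>t\<bar>\<close>, so the mean distance is smallest for centre 0.\<close>
  have "2 * ennreal (sqrt (2 / pi)) = (\<integral>\<^sup>+t. 2 * ennreal \<bar>t\<bar> \<partial>?N)"
    by (subst nn_integral_cmult) (auto simp: std_normal_abs_moment)
  also have "\<dots> \<le> (\<integral>\<^sup>+t. ennreal \<bar>c - t\<bar> + ennreal \<bar>c + t\<bar> \<partial>?N)"
  proof (rule nn_integral_mono)
    fix t :: real
    have "ennreal (2 * \<bar>t\<bar>) \<le> ennreal (\<bar>c - t\<bar> + \<bar>c + t\<bar>)" by (intro ennreal_leI) linarith
    then show "2 * ennreal \<bar>t\<bar> \<le> ennreal \<bar>c - t\<bar> + ennreal \<bar>c + t\<bar>" by (simp add: ennreal_mult')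
  qed
  also have "\<dots> = 2 * (\<integral>\<^sup>+t. ennreal \<bar>c - t\<bar> \<partial>?N)"
    by (subst nn_integral_add) (auto simp: sym mult_2)
  finally show ?thesis by (subst (asm) ennreal_mult_le_mult_iff) auto
qed

text \<open>Given the batch, coordinate 0 of the new state is Gaussian with variance
  \<open>2 * \<gamma>\<close>; wherever its centre lies, its mean distance from any fixed point is
  at least that of a centred variable.\<close>

lemma sgld_step_spread:
  assumes M: "M \<in> {1..K}" and d: "1 \<le> d" and \<gamma>: "0 < \<gamma>"
    and C: "\<And>j. j \<le> K \<Longrightarrow> cont_differentiable d (U j)"
    and x[measurable]: "x \<in> space (state_space d K M)" and y[measurable]: "y \<in> space (state_space d K M)"
  shows "ennreal (sqrt \<gamma>) \<le> (\<integral>\<^sup>+v. ennreal (dX d x (sgld_step d K M U \<gamma> y v)) \<partial>sgld_noise d K M)"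
proof -
  let ?B = "batch_law K M" and ?G = "std_gaussian d"
  interpret B: prob_space ?B by (rule prob_space_batch_law[OF M])
  interpret G: prob_space ?G by (rule prob_space_std_gaussian)
  interpret BG: prob_space "?B \<Otimes>\<^sub>M ?G" by (intro prob_space_pair prob_space_batch_law prob_space_std_gaussian M)
  have [measurable]: "(\<lambda>z. z 0) \<in> borel_measurable ?G"
    unfolding measurable_cong_sets[OF sets_std_gaussian refl] by (rule vborel_component[of 0 d]) (use d in auto)
  define a where "a S = fst x 0 - (fst y 0 - \<gamma> * stoch_gradient d K M U (fst y) S 0)" for S
  have [measurable]: "sgld_step d K M U \<gamma> y \<in> ?B \<Otimes>\<^sub>M (?B \<Otimes>\<^sub>M ?G) \<rightarrow>\<^sub>M state_space d K M"
    using measurable_compose[OF measurable_Pair1'[OF y, of "sgld_noise d K M"] sgld_step_measurable[OF C]]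
    by (simp add: sgld_noise_def)
  have inner: "ennreal (sqrt \<gamma>) \<le> (\<integral>\<^sup>+z. ennreal \<bar>a S - sqrt (2 * \<gamma>) * z 0\<bar> \<partial>?G)" for S
  proof -
    let ?s = "sqrt (2 * \<gamma>)"
    have s: "0 < ?s" using \<gamma> by simp
    \<comment> \<open>This is \<open>pi < 4\<close>.\<close>
    have "sqrt \<gamma> \<le> ?s * sqrt (2 / pi)"
      unfolding real_sqrt_mult[symmetric] using \<gamma> pi_less_4 by (intro real_sqrt_le_mono) (simp add: field_simps)
    then have "ennreal (sqrt \<gamma>) \<le> ennreal ?s * ennreal (sqrt (2 / pi))"
      using s by (subst ennreal_mult'[symmetric]) (auto intro: ennreal_leI)
    also have "\<dots> \<le> ennreal ?s * (\<integral>\<^sup>+t. ennreal \<bar>a S / ?s - t\<bar> \<partial>density lborel std_normal_density)"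
      by (intro mult_left_mono std_normal_abs_shift) auto
    also have "\<dots> = ennreal ?s * (\<integral>\<^sup>+z. ennreal \<bar>a S / ?s - z 0\<bar> \<partial>?G)"
      using d by (subst nn_integral_std_gaussian_component[where f = "\<lambda>t. ennreal \<bar>a S / ?s - t\<bar>"]) auto
    also have "\<dots> = (\<integral>\<^sup>+z. ennreal ?s * ennreal \<bar>a S / ?s - z 0\<bar> \<partial>?G)"
      by (rule nn_integral_cmult[symmetric]) measurable
    also have "\<dots> = (\<integral>\<^sup>+z. ennreal \<bar>a S - ?s * z 0\<bar> \<partial>?G)"
    proof (rule nn_integral_cong)
      fix z :: vec
      have "?s * \<bar>a S / ?s - z 0\<bar> = \<bar>?s * (a S / ?s - z 0)\<bar>" using s by (simp only: abs_mult abs_of_pos)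
      also have "?s * (a S / ?s - z 0) = a S - ?s * z 0" using s by (simp add: right_diff_distrib)
      finally show "ennreal ?s * ennreal \<bar>a S / ?s - z 0\<bar> = ennreal \<bar>a S - ?s * z 0\<bar>"
        using s by (subst ennreal_mult'[symmetric]) auto
    qed
    finally show ?thesis .
  qed
  have low: "\<bar>a S - sqrt (2 * \<gamma>) * z 0\<bar> \<le> dX d x (sgld_step d K M U \<gamma> y (S, S', z))" for S S' z
  proof -
    have "(a S - sqrt (2 * \<gamma>) * z 0)\<^sup>2 \<le> (vdist d (fst x) (fst (sgld_step d K M U \<gamma> y (S, S', z))))\<^sup>2"
      unfolding vdist_power2 using d
      by (intro order_trans[OF _ member_le_sum[of 0]]) (auto simp: sgld_step_def a_def algebra_simps)
    then have "\<bar>a S - sqrt (2 * \<gamma>) * z 0\<bar> \<le> vdist d (fst x) (fst (sgld_step d K M U \<gamma> y (S, S', z)))"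
      by (simp only: abs_le_square_iff[symmetric] abs_of_nonneg vdist_nonneg)
    then show ?thesis by (simp add: dX_def)
  qed
  have "ennreal (sqrt \<gamma>) \<le> (\<integral>\<^sup>+S. \<integral>\<^sup>+S'. \<integral>\<^sup>+z. ennreal (dX d x (sgld_step d K M U \<gamma> y (S, S', z))) \<partial>?G \<partial>?B \<partial>?B)"
    using inner low
    by (intro B.nn_integral_ge_const AE_I2 order_trans[OF inner] nn_integral_mono ennreal_leI) auto
  also have "\<dots> = (\<integral>\<^sup>+v. ennreal (dX d x (sgld_step d K M U \<gamma> y v)) \<partial>sgld_noise d K M)"
    unfolding sgld_noise_def
    by (subst BG.nn_integral_fst[symmetric], measurable)
       (auto intro!: nn_integral_cong G.nn_integral_fst)
  finally show ?thesis .
qed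

text \<open>Both \<open>enn2real\<close> and the Bochner integral would turn an infinite value into
  0. The first moment of \<pi> excludes this at every x and for the outer integral, so
  \<open>mean_W1\<close> is the true double integral.\<close>

lemma mean_W1_eq:
  assumes chain: "contractive_chain (sgld_noise d K M) (state_space d K M) (sgld_step d K M U \<gamma>) (dX d) \<rho> \<kappa> x0"
    and inv: "contractive_chain.invariant (sgld_noise d K M) (state_space d K M) (sgld_step d K M U \<gamma>) \<pi>"
  shows "(\<integral>\<^sup>+x. \<integral>\<^sup>+y. ennreal (dX d x y) \<partial>\<pi> \<partial>\<pi>) = ennreal (mean_W1 d K M \<pi>)"
proof -
  interpret C: contractive_chain "sgld_noise d K M" "state_space d K M" "sgld_step d K M U \<gamma>" "dX d" \<rho> \<kappa> x0
    by (rule chain)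
  have pi: "prob_space \<pi>" and sets[measurable_cong]: "sets \<pi> = sets (state_space d K M)"
    using inv by (auto simp: C.invariant_def)
  have sp: "space \<pi> = space (state_space d K M)" by (rule sets_eq_imp_space_eq[OF sets])
  interpret pi: prob_space \<pi> by (rule pi)
  have fin: "(\<integral>\<^sup>+y. ennreal (dX d x y) \<partial>\<pi>) \<le> ennreal (dX d x x0 + \<kappa> / (1 - \<rho>))"
    if [measurable]: "x \<in> space (state_space d K M)" for x
  proof -
    have "(\<integral>\<^sup>+y. ennreal (dX d x y) \<partial>\<pi>) \<le> (\<integral>\<^sup>+y. ennreal (dX d x x0) + ennreal (dX d y x0) \<partial>\<pi>)"
    proof (rule nn_integral_mono)
      fix y
      have "dX d x y \<le> dX d x x0 + dX d y x0" using dX_triangle[of d x y x0] by (simp add: dX_commute)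
      then show "ennreal (dX d x y) \<le> ennreal (dX d x x0) + ennreal (dX d y x0)"
        by (simp add: ennreal_plus[symmetric] dX_nonneg ennreal_leI del: ennreal_plus)
    qed
    also have "\<dots> = ennreal (dX d x x0) + (\<integral>\<^sup>+y. ennreal (dX d y x0) \<partial>\<pi>)"
      by (subst nn_integral_add) (auto simp: pi.emeasure_space_1)
    also have "\<dots> \<le> ennreal (dX d x x0) + ennreal (\<kappa> / (1 - \<rho>))"
      by (intro add_mono C.invariant_first_moment inv) auto
    finally show ?thesis
      using C.rho C.kappa by (simp add: ennreal_plus[symmetric] dX_nonneg del: ennreal_plus)
  qed
  have fin2: "(\<integral>\<^sup>+x. \<integral>\<^sup>+y. ennreal (dX d x y) \<partial>\<pi> \<partial>\<pi>) \<le> ennreal (\<kappa> / (1 - \<rho>)) + ennreal (\<kappa> / (1 - \<rho>))"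
  proof -
    have "(\<integral>\<^sup>+x. \<integral>\<^sup>+y. ennreal (dX d x y) \<partial>\<pi> \<partial>\<pi>) \<le> (\<integral>\<^sup>+x. ennreal (dX d x x0) + ennreal (\<kappa> / (1 - \<rho>)) \<partial>\<pi>)"
      using fin C.rho C.kappa by (intro nn_integral_mono) (auto simp: sp dX_nonneg ennreal_plus)
    also have "\<dots> = (\<integral>\<^sup>+x. ennreal (dX d x x0) \<partial>\<pi>) + ennreal (\<kappa> / (1 - \<rho>))"
      by (subst nn_integral_add) (auto simp: pi.emeasure_space_1)
    also have "\<dots> \<le> ennreal (\<kappa> / (1 - \<rho>)) + ennreal (\<kappa> / (1 - \<rho>))"
      by (intro add_mono C.invariant_first_moment inv) auto
    finally show ?thesis .
  qed
  have "mean_W1 d K M \<pi> = (\<integral>x. enn2real (\<integral>\<^sup>+y. ennreal (dX d x y) \<partial>\<pi>) \<partial>\<pi>)"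
    unfolding mean_W1_def by (intro Bochner_Integration.integral_cong refl W1_return) (auto simp: sp pi sets)
  also have "\<dots> = enn2real (\<integral>\<^sup>+x. ennreal (enn2real (\<integral>\<^sup>+y. ennreal (dX d x y) \<partial>\<pi>)) \<partial>\<pi>)"
    by (rule integral_eq_nn_integral) auto
  also have "(\<integral>\<^sup>+x. ennreal (enn2real (\<integral>\<^sup>+y. ennreal (dX d x y) \<partial>\<pi>)) \<partial>\<pi>) = (\<integral>\<^sup>+x. \<integral>\<^sup>+y. ennreal (dX d x y) \<partial>\<pi> \<partial>\<pi>)"
  proof (rule nn_integral_cong)
    fix x assume "x \<in> space \<pi>"
    then have "(\<integral>\<^sup>+y. ennreal (dX d x y) \<partial>\<pi>) < top"
      using fin[of x] by (auto simp: sp intro: le_less_trans)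
    then show "ennreal (enn2real (\<integral>\<^sup>+y. ennreal (dX d x y) \<partial>\<pi>)) = (\<integral>\<^sup>+y. ennreal (dX d x y) \<partial>\<pi>)" by simp
  qed
  finally have "mean_W1 d K M \<pi> = enn2real (\<integral>\<^sup>+x. \<integral>\<^sup>+y. ennreal (dX d x y) \<partial>\<pi> \<partial>\<pi>)" .
  moreover have "(\<integral>\<^sup>+x. \<integral>\<^sup>+y. ennreal (dX d x y) \<partial>\<pi> \<partial>\<pi>) < top"
    using fin2 by (rule le_less_trans) simp
  ultimately show ?thesis by simp
qed

lemma mean_W1_nonneg: "0 \<le> mean_W1 d K M \<pi>"
  unfolding mean_W1_def W1_def by (intro integral_nonneg_AE) auto

text \<open>By invariance a stationary point may be replaced by its image after one more step, and
  the fresh noise of that step keeps it away from every x.\<close>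

lemma sqrt_gamma_le_mean_W1:
  assumes M: "M \<in> {1..K}" and d: "1 \<le> d" and \<gamma>: "0 < \<gamma>"
    and C: "\<And>j. j \<le> K \<Longrightarrow> cont_differentiable d (U j)"
    and chain: "contractive_chain (sgld_noise d K M) (state_space d K M) (sgld_step d K M U \<gamma>) (dX d) \<rho> \<kappa> x0"
    and inv: "contractive_chain.invariant (sgld_noise d K M) (state_space d K M) (sgld_step d K M U \<gamma>) \<pi>"
  shows "sqrt \<gamma> \<le> mean_W1 d K M \<pi>"
proof -
  interpret C: contractive_chain "sgld_noise d K M" "state_space d K M" "sgld_step d K M U \<gamma>" "dX d" \<rho> \<kappa> x0
    by (rule chain)
  have pi: "prob_space \<pi>" and sets[measurable_cong]: "sets \<pi> = sets (state_space d K M)"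
    using inv by (auto simp: C.invariant_def)
  have sp: "space \<pi> = space (state_space d K M)" by (rule sets_eq_imp_space_eq[OF sets])
  interpret pi: prob_space \<pi> by (rule pi)
  have "ennreal (sqrt \<gamma>) \<le> (\<integral>\<^sup>+y. ennreal (dX d x y) \<partial>\<pi>)" if x[measurable]: "x \<in> space (state_space d K M)" for x
  proof -
    have "ennreal (sqrt \<gamma>) \<le> (\<integral>\<^sup>+y. \<integral>\<^sup>+v. ennreal (dX d x (sgld_step d K M U \<gamma> y v)) \<partial>sgld_noise d K M \<partial>\<pi>)"
      by (intro pi.nn_integral_ge_const AE_I2 sgld_step_spread M d \<gamma> C x) (auto simp: sp)
    also have "\<dots> = (\<integral>\<^sup>+y. ennreal (dX d x y) \<partial>\<pi>)"
      by (rule C.invariant_nn_integral[OF inv]) measurable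
    finally show ?thesis .
  qed
  then have "ennreal (sqrt \<gamma>) \<le> (\<integral>\<^sup>+x. \<integral>\<^sup>+y. ennreal (dX d x y) \<partial>\<pi> \<partial>\<pi>)"
    by (rule pi.nn_integral_ge_const[OF AE_I2]) (auto simp: sp)
  then show ?thesis
    by (simp add: mean_W1_eq[OF chain inv] mean_W1_nonneg)
qed

section \<open>Autocovariances and the spectral variance\<close>

lemma (in prob_space) abs_expectation_mult_le:
  fixes f g :: "'a \<Rightarrow> real"
  assumes [measurable]: "f \<in> borel_measurable M" "g \<in> borel_measurable M"
    and f: "\<And>x. x \<in> space M \<Longrightarrow> \<bar>f x\<bar> \<le> A" and g: "\<And>x. x \<in> space M \<Longrightarrow> \<bar>g x\<bar> \<le> A"
  shows "\<bar>expectation (\<lambda>x. f x * g x)\<bar> \<le> sqrt (expectation (\<lambda>x. (f x)\<^sup>2)) * sqrt (expectation (\<lambda>x. (g x)\<^sup>2))"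
proof -
  have sq: "(\<integral>\<^sup>+x. (ennreal \<bar>f x\<bar>)\<^sup>2 \<partial>M) = ennreal (expectation (\<lambda>x. (f x)\<^sup>2))"
    if [measurable]: "f \<in> borel_measurable M" and f: "\<And>x. x \<in> space M \<Longrightarrow> \<bar>f x\<bar> \<le> A" for f
  proof -
    have "(\<integral>\<^sup>+x. (ennreal \<bar>f x\<bar>)\<^sup>2 \<partial>M) = (\<integral>\<^sup>+x. ennreal ((f x)\<^sup>2) \<partial>M)"
      by (intro nn_integral_cong) (simp add: ennreal_power)
    also have "\<dots> = ennreal (expectation (\<lambda>x. (f x)\<^sup>2))"
      using f by (intro nn_integral_eq_integral integrable_const_bound[of _ "A\<^sup>2"] AE_I2)
        (auto simp: abs_le_square_iff[symmetric] intro: order_trans[OF _ abs_ge_self])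
    finally show ?thesis .
  qed
  have "(ennreal \<bar>expectation (\<lambda>x. f x * g x)\<bar>)\<^sup>2 \<le> (\<integral>\<^sup>+x. ennreal \<bar>f x\<bar> * ennreal \<bar>g x\<bar> \<partial>M)\<^sup>2"
  proof (rule power_mono)
    have "ennreal (norm (expectation (\<lambda>x. f x * g x))) \<le> (\<integral>\<^sup>+x. norm (f x * g x) \<partial>M)"
      by (intro integral_norm_bound_ennreal integrable_const_bound[of _ "A * A"] AE_I2)
         (auto simp: abs_mult intro!: mult_mono' f g)
    then show "ennreal \<bar>expectation (\<lambda>x. f x * g x)\<bar> \<le> (\<integral>\<^sup>+x. ennreal \<bar>f x\<bar> * ennreal \<bar>g x\<bar> \<partial>M)"
      by (simp add: abs_mult ennreal_mult')
  qed simp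
  also have "\<dots> \<le> (\<integral>\<^sup>+x. (ennreal \<bar>f x\<bar>)\<^sup>2 \<partial>M) * (\<integral>\<^sup>+x. (ennreal \<bar>g x\<bar>)\<^sup>2 \<partial>M)"
    by (rule Cauchy_Schwarz_nn_integral) auto
  also have "\<dots> = ennreal (expectation (\<lambda>x. (f x)\<^sup>2) * expectation (\<lambda>x. (g x)\<^sup>2))"
    using f g by (simp add: sq ennreal_mult')
  finally have "\<bar>expectation (\<lambda>x. f x * g x)\<bar>\<^sup>2 \<le> expectation (\<lambda>x. (f x)\<^sup>2) * expectation (\<lambda>x. (g x)\<^sup>2)"
    by (simp add: ennreal_power ennreal_le_iff)
  then show ?thesis by (simp add: real_sqrt_mult[symmetric] real_le_rsqrt)
qed

section \<open>Continuity of the stationary autocovariances in mean square\<close>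

context contractive_chain begin

lemma stationary_integral:
  assumes inv: "invariant \<pi>" and [measurable]: "g \<in> borel_measurable X"
    and bd: "\<And>x. x \<in> space X \<Longrightarrow> \<bar>g x\<bar> \<le> (C::real)"
  shows "(\<integral>\<omega>. g (orbit stp (fst \<omega>) (snd \<omega>) l) \<partial>(\<pi> \<Otimes>\<^sub>M S)) = (\<integral>x. g x \<partial>\<pi>)"
proof -
  have "(\<integral>\<omega>. g (orbit stp (fst \<omega>) (snd \<omega>) l) \<partial>(\<pi> \<Otimes>\<^sub>M S)) = autocov \<pi> (\<lambda>_. 1) g l"
    by (simp add: autocov_def)
  also have "\<dots> = (\<integral>x. \<integral>\<eta>. 1 * g (orbit stp x \<eta> l) \<partial>S \<partial>\<pi>)"
    by (rule autocov_iterated[OF inv]) (auto intro: bd)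
  also have "\<dots> = (\<integral>x. \<integral>\<eta>. g (fst (orbit stp x \<eta> l, \<lambda>i. \<eta> (l + i))) \<partial>S \<partial>\<pi>)" by simp
  also have "\<dots> = (\<integral>x. \<integral>\<eta>. g (fst (x, \<eta>)) \<partial>S \<partial>\<pi>)"
    by (rule stationary_orbit[OF inv, where C = C]) (auto intro!: bd simp: space_pair_measure)
  finally show ?thesis by (simp add: P.prob_space)
qed

text \<open>The product difference telescopes into one term with \<open>u - v\<close> at time 0 and
  one with \<open>u - v\<close> at time \<open>l\<close>; stationarity makes every second moment in
  Cauchy-Schwarz an integral over \<pi>. For centred functions at distance \<epsilon> this is at
  most \<open>2 * \<epsilon>\<close> times the root of the variance bound.\<close>

lemma autocov_diff_le:
  assumes inv: "invariant \<pi>" and [measurable]: "u \<in> borel_measurable X" "v \<in> borel_measurable X"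
    and u: "\<And>x. x \<in> space X \<Longrightarrow> \<bar>u x\<bar> \<le> A" and v: "\<And>x. x \<in> space X \<Longrightarrow> \<bar>v x\<bar> \<le> A"
  shows "\<bar>autocov \<pi> u u l - autocov \<pi> v v l\<bar>
    \<le> sqrt (\<integral>x. (u x - v x)\<^sup>2 \<partial>\<pi>) * (sqrt (\<integral>x. (u x)\<^sup>2 \<partial>\<pi>) + sqrt (\<integral>x. (v x)\<^sup>2 \<partial>\<pi>))"
proof -
  have sets[measurable_cong]: "sets \<pi> = sets X" using inv by (simp add: invariant_def)
  have sp: "space \<pi> = space X" by (rule sets_eq_imp_space_eq[OF sets])
  interpret pi: prob_space \<pi> using inv by (simp add: invariant_def)
  interpret PS: pair_prob_space \<pi> S ..
  have A: "0 \<le> A" using u[OF x0] by linarith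
  let ?Y = "\<lambda>k \<omega>. orbit stp (fst \<omega>) (snd \<omega>) k"
  have Y: "?Y k \<omega> \<in> space X" if "\<omega> \<in> space (\<pi> \<Otimes>\<^sub>M S)" for k \<omega>
    using that by (auto simp: space_pair_measure sp)
  have uv: "\<bar>u x - v x\<bar> \<le> 2 * A" "\<bar>u x\<bar> \<le> 2 * A" "\<bar>v x\<bar> \<le> 2 * A" if "x \<in> space X" for x
    using u[OF that] v[OF that] A by linarith+
  have sq: "(\<integral>\<omega>. (g (?Y k \<omega>))\<^sup>2 \<partial>(\<pi> \<Otimes>\<^sub>M S)) = (\<integral>x. (g x)\<^sup>2 \<partial>\<pi>)"
    if [measurable]: "g \<in> borel_measurable X" and g: "\<And>x. x \<in> space X \<Longrightarrow> \<bar>g x\<bar> \<le> 2 * A" for g :: "'s \<Rightarrow> real" and k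
  proof (rule stationary_integral[OF inv, where C = "(2 * A)\<^sup>2"])
    fix x assume "x \<in> space X"
    then show "\<bar>(g x)\<^sup>2\<bar> \<le> (2 * A)\<^sup>2" using power_mono[OF g, of x 2] by simp
  qed measurable
  have cs: "\<bar>\<integral>\<omega>. f (?Y j \<omega>) * g (?Y k \<omega>) \<partial>(\<pi> \<Otimes>\<^sub>M S)\<bar> \<le> sqrt (\<integral>x. (f x)\<^sup>2 \<partial>\<pi>) * sqrt (\<integral>x. (g x)\<^sup>2 \<partial>\<pi>)"
    if [measurable]: "f \<in> borel_measurable X" "g \<in> borel_measurable X"
      and f: "\<And>x. x \<in> space X \<Longrightarrow> \<bar>f x\<bar> \<le> 2 * A" and g: "\<And>x. x \<in> space X \<Longrightarrow> \<bar>g x\<bar> \<le> 2 * A"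
    for f g :: "'s \<Rightarrow> real" and j k
  proof -
    have "\<bar>\<integral>\<omega>. f (?Y j \<omega>) * g (?Y k \<omega>) \<partial>(\<pi> \<Otimes>\<^sub>M S)\<bar>
        \<le> sqrt (\<integral>\<omega>. (f (?Y j \<omega>))\<^sup>2 \<partial>(\<pi> \<Otimes>\<^sub>M S)) * sqrt (\<integral>\<omega>. (g (?Y k \<omega>))\<^sup>2 \<partial>(\<pi> \<Otimes>\<^sub>M S))"
      by (rule PS.P.abs_expectation_mult_le[where A = "2 * A"]) (auto intro!: f g Y simp del: orbit.simps)
    then show ?thesis by (simp only: sq[OF that(1) f] sq[OF that(2) g])
  qed
  have int: "integrable (\<pi> \<Otimes>\<^sub>M S) (\<lambda>\<omega>. f (?Y j \<omega>) * g (?Y k \<omega>))"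
    if [measurable]: "f \<in> borel_measurable X" "g \<in> borel_measurable X"
      and f: "\<And>x. x \<in> space X \<Longrightarrow> \<bar>f x\<bar> \<le> 2 * A" and g: "\<And>x. x \<in> space X \<Longrightarrow> \<bar>g x\<bar> \<le> 2 * A"
    for f g :: "'s \<Rightarrow> real" and j k
  proof (rule PS.P.integrable_const_bound[of _ "2 * A * (2 * A)"], rule AE_I2)
    fix \<omega> assume "\<omega> \<in> space (\<pi> \<Otimes>\<^sub>M S)"
    then show "norm (f (?Y j \<omega>) * g (?Y k \<omega>)) \<le> 2 * A * (2 * A)"
      unfolding real_norm_def abs_mult by (intro mult_mono' f g Y abs_ge_zero)
  qed measurable
  have "autocov \<pi> u u l - autocov \<pi> v v l
      = (\<integral>\<omega>. u (?Y 0 \<omega>) * u (?Y l \<omega>) \<partial>(\<pi> \<Otimes>\<^sub>M S)) - (\<integral>\<omega>. v (?Y 0 \<omega>) * v (?Y l \<omega>) \<partial>(\<pi> \<Otimes>\<^sub>M S))"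
    by (simp add: autocov_def)
  also have "\<dots> = (\<integral>\<omega>. u (?Y 0 \<omega>) * u (?Y l \<omega>) - v (?Y 0 \<omega>) * v (?Y l \<omega>) \<partial>(\<pi> \<Otimes>\<^sub>M S))"
    by (rule Bochner_Integration.integral_diff[symmetric]) (intro int uv; measurable)+
  also have "\<dots> = (\<integral>\<omega>. (u (?Y 0 \<omega>) - v (?Y 0 \<omega>)) * u (?Y l \<omega>) + v (?Y 0 \<omega>) * (u (?Y l \<omega>) - v (?Y l \<omega>)) \<partial>(\<pi> \<Otimes>\<^sub>M S))"
    by (simp add: algebra_simps)
  also have "\<dots> = (\<integral>\<omega>. (u (?Y 0 \<omega>) - v (?Y 0 \<omega>)) * u (?Y l \<omega>) \<partial>(\<pi> \<Otimes>\<^sub>M S))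
      + (\<integral>\<omega>. v (?Y 0 \<omega>) * (u (?Y l \<omega>) - v (?Y l \<omega>)) \<partial>(\<pi> \<Otimes>\<^sub>M S))"
    using int[of "\<lambda>x. u x - v x" u 0 l] int[of v "\<lambda>x. u x - v x" 0 l] uv
    by (intro Bochner_Integration.integral_add) auto
  also have "\<bar>\<dots>\<bar> \<le> sqrt (\<integral>x. (u x - v x)\<^sup>2 \<partial>\<pi>) * sqrt (\<integral>x. (u x)\<^sup>2 \<partial>\<pi>) + sqrt (\<integral>x. (v x)\<^sup>2 \<partial>\<pi>) * sqrt (\<integral>x. (u x - v x)\<^sup>2 \<partial>\<pi>)"
    using cs[of "\<lambda>x. u x - v x" u 0 l] cs[of v "\<lambda>x. u x - v x" 0 l] uv
    by (intro order_trans[OF abs_triangle_ineq] add_mono) auto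
  finally show ?thesis by (simp add: algebra_simps)
qed

end

section \<open>Two-sided sums over lags\<close>

lemma geometric_tail_sum_le:
  fixes C \<rho> :: real
  assumes "0 \<le> C" "0 \<le> \<rho>" "\<rho> < 1" "finite F"
  shows "(\<Sum>k\<in>F. if k < b then 0 else C * \<rho> ^ k) \<le> C * \<rho> ^ b / (1 - \<rho>)"
proof -
  obtain m where m: "F \<subseteq> {..<b + m}"
    using finite_nat_set_iff_bounded[THEN iffD1, OF assms(4)] by (auto simp: subset_eq intro: trans_less_add2)
  have "(\<Sum>k\<in>F. if k < b then 0 else C * \<rho> ^ k) \<le> (\<Sum>k<b + m. if k < b then 0 else C * \<rho> ^ k)"
    using m assms by (intro sum_mono2) auto
  also have "\<dots> = C * \<rho> ^ b * (\<Sum>k<m. \<rho> ^ k)"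
    by (simp add: sum_lessThan_add sum_distrib_left power_add mult_ac)
  also have "(\<Sum>k<m. \<rho> ^ k) \<le> 1 / (1 - \<rho>)"
    using assms by (simp add: sum_gp_strict divide_right_mono)
  finally show ?thesis using assms by (simp add: mult_left_mono)
qed

text \<open>The absolute value is injective on the nonnegative and on the negative integers, hence
  the factor 2. Summability is part of the claim because \<open>infsum\<close> of a non-summable
  family is 0.\<close>

lemma infsum_int_tail:
  fixes e :: "nat \<Rightarrow> real"
  assumes "0 \<le> C" "0 \<le> \<rho>" "\<rho> < 1" and e: "\<And>k. \<bar>e k\<bar> \<le> (if k < b then 0 else C * \<rho> ^ k)"
  shows "(\<lambda>l::int. e (nat \<bar>l\<bar>)) summable_on UNIV"
    and "\<bar>\<Sum>\<^sub>\<infinity>l\<in>(UNIV::int set). e (nat \<bar>l\<bar>)\<bar> \<le> 2 * C * \<rho> ^ b / (1 - \<rho>)"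
proof -
  define f where "f k = (if k < b then 0 else C * \<rho> ^ k)" for k
  have f0: "0 \<le> f k" for k using assms by (simp add: f_def)
  have fin: "(\<Sum>l\<in>F. f (nat \<bar>l\<bar>)) \<le> 2 * C * \<rho> ^ b / (1 - \<rho>)" if F: "finite F" for F :: "int set"
  proof -
    have "(\<Sum>l\<in>F. f (nat \<bar>l\<bar>)) = (\<Sum>l\<in>F \<inter> {0..}. f (nat \<bar>l\<bar>)) + (\<Sum>l\<in>F - {0..}. f (nat \<bar>l\<bar>))"
      using F by (subst sum.Int_Diff[of F _ "{0..}"]) auto
    also have "(\<Sum>l\<in>F \<inter> {0..}. f (nat \<bar>l\<bar>)) = (\<Sum>k\<in>(\<lambda>l. nat \<bar>l\<bar>) ` (F \<inter> {0..}). f k)"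
      by (rule sum.reindex_cong[symmetric, where l = "\<lambda>l. nat \<bar>l\<bar>"]) (auto simp: inj_on_def)
    also have "(\<Sum>l\<in>F - {0..}. f (nat \<bar>l\<bar>)) = (\<Sum>k\<in>(\<lambda>l. nat \<bar>l\<bar>) ` (F - {0..}). f k)"
      by (rule sum.reindex_cong[symmetric, where l = "\<lambda>l. nat \<bar>l\<bar>"]) (auto simp: inj_on_def)
    also have "(\<Sum>k\<in>(\<lambda>l. nat \<bar>l\<bar>) ` (F \<inter> {0..}). f k) + (\<Sum>k\<in>(\<lambda>l. nat \<bar>l\<bar>) ` (F - {0..}). f k)
        \<le> C * \<rho> ^ b / (1 - \<rho>) + C * \<rho> ^ b / (1 - \<rho>)"
      unfolding f_def using assms F by (intro add_mono geometric_tail_sum_le) auto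
    finally show ?thesis by simp
  qed
  have sf: "(\<lambda>l::int. f (nat \<bar>l\<bar>)) summable_on UNIV"
    using fin f0 by (intro nonneg_bdd_above_summable_on bdd_aboveI[where M = "2 * C * \<rho> ^ b / (1 - \<rho>)"]) auto
  have ef: "\<bar>e k\<bar> \<le> f k" for k using e by (simp add: f_def)
  have "(\<lambda>l::int. norm (e (nat \<bar>l\<bar>))) summable_on UNIV"
    using ef by (intro summable_on_comparison_test[OF sf]) auto
  then show se: "(\<lambda>l::int. e (nat \<bar>l\<bar>)) summable_on UNIV" by (rule abs_summable_summable)
  have le: "infsum (\<lambda>l::int. f (nat \<bar>l\<bar>)) UNIV \<le> 2 * C * \<rho> ^ b / (1 - \<rho>)"
    by (rule infsum_le_finite_sums[OF sf]) (rule fin)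
  have 1: "infsum (\<lambda>l::int. e (nat \<bar>l\<bar>)) UNIV \<le> infsum (\<lambda>l::int. f (nat \<bar>l\<bar>)) UNIV"
    using ef by (intro infsum_mono se sf) (auto simp: abs_le_iff)
  have 2: "infsum (\<lambda>l::int. - e (nat \<bar>l\<bar>)) UNIV \<le> infsum (\<lambda>l::int. f (nat \<bar>l\<bar>)) UNIV"
    using ef by (intro infsum_mono se sf summable_on_uminus[THEN iffD2]) (auto simp: abs_le_iff)
  show "\<bar>\<Sum>\<^sub>\<infinity>l\<in>(UNIV::int set). e (nat \<bar>l\<bar>)\<bar> \<le> 2 * C * \<rho> ^ b / (1 - \<rho>)"
    using 1 2 le by (simp add: infsum_uminus)
qed

text \<open>Serves two purposes: plain truncation with \<open>a' = a\<close> and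
  \<open>b0 = b\<close>, and damping by a lag window, where \<open>a'\<close> agrees with
  \<open>a\<close> only below \<open>b0\<close> but stays within the same geometric envelope of it
  up to \<open>b\<close>.\<close>

lemma infsum_int_approx:
  fixes a a' :: "nat \<Rightarrow> real"
  assumes C: "0 \<le> C" "0 \<le> \<rho>" "\<rho> < 1" and b0: "b0 \<le> b"
    and eq: "\<And>k. k < b0 \<Longrightarrow> a' k = a k"
    and dom: "\<And>k. k < b \<Longrightarrow> \<bar>a k - a' k\<bar> \<le> C * \<rho> ^ k" "\<And>k. \<bar>a k\<bar> \<le> C * \<rho> ^ k"
  shows "\<bar>(\<Sum>\<^sub>\<infinity>l\<in>(UNIV::int set). a (nat \<bar>l\<bar>)) - (\<Sum>l\<in>{- int b<..<int b}. a' (nat \<bar>l\<bar>))\<bar> \<le> 2 * C * \<rho> ^ b0 / (1 - \<rho>)"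
proof -
  define t where "t k = (if k < b then a' k else 0)" for k
  have mem: "l \<in> {- int b<..<int b} \<longleftrightarrow> nat \<bar>l\<bar> < b" for l by auto
  have te: "\<bar>a k - t k\<bar> \<le> (if k < b0 then 0 else C * \<rho> ^ k)" for k
    using b0 eq dom[of k] by (auto simp: t_def)
  note tail = infsum_int_tail[of C \<rho> "\<lambda>k. a k - t k" b0, OF C te]
  have st: "(\<lambda>l::int. t (nat \<bar>l\<bar>)) summable_on UNIV"
    using summable_on_finite[of "{- int b<..<int b}" "\<lambda>l. t (nat \<bar>l\<bar>)"]
    by (rule summable_on_cong_neutral[THEN iffD1, rotated -1]) (auto simp: t_def)
  have it: "infsum (\<lambda>l::int. t (nat \<bar>l\<bar>)) UNIV = (\<Sum>l\<in>{- int b<..<int b}. a' (nat \<bar>l\<bar>))"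
    by (subst infsum_cong_neutral[of "{- int b<..<int b}" UNIV "\<lambda>l. a' (nat \<bar>l\<bar>)"]) (auto simp: t_def)
  have "(\<Sum>\<^sub>\<infinity>l\<in>(UNIV::int set). a (nat \<bar>l\<bar>)) = (\<Sum>\<^sub>\<infinity>l\<in>(UNIV::int set). (a (nat \<bar>l\<bar>) - t (nat \<bar>l\<bar>)) + t (nat \<bar>l\<bar>))"
    by simp
  also have "\<dots> = (\<Sum>\<^sub>\<infinity>l\<in>(UNIV::int set). a (nat \<bar>l\<bar>) - t (nat \<bar>l\<bar>)) + infsum (\<lambda>l::int. t (nat \<bar>l\<bar>)) UNIV"
    using tail(1) st by (rule infsum_add)
  finally show ?thesis using tail(2) it by simp
qed

lemma sum_int_interval_le:
  fixes a :: "nat \<Rightarrow> real"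
  assumes "\<And>k. k < b \<Longrightarrow> \<bar>a k\<bar> \<le> c" "0 \<le> c"
  shows "(\<Sum>l\<in>{- int b<..<int b}. \<bar>a (nat \<bar>l\<bar>)\<bar>) \<le> 2 * b * c"
proof -
  have "(\<Sum>l\<in>{- int b<..<int b}. \<bar>a (nat \<bar>l\<bar>)\<bar>) \<le> (\<Sum>l\<in>{- int b<..<int b}. c)"
    using assms by (intro sum_mono) auto
  also have "\<dots> = real (nat (2 * int b - 1)) * c" by simp
  also have "\<dots> \<le> 2 * real b * c" using assms by (intro mult_right_mono) auto
  finally show ?thesis by simp
qed

text \<open>The estimation error is collected once per lag, fewer than \<open>2 * (2 * b0)\<close>
  times. The bias starts only at lag \<open>b0\<close>, since smaller lags have weight 1.\<close>

lemma spectral_variance_approx: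
  fixes cov :: "nat \<Rightarrow> real"
  assumes C: "0 \<le> C" "0 \<le> \<rho>" "\<rho> < 1" and w: "lag_window w"
    and cov: "\<And>k. \<bar>cov k\<bar> \<le> C * \<rho> ^ k"
    and close: "\<And>l. l < 2 * b0 \<Longrightarrow> \<bar>emp_autocov n x h l - cov l\<bar> \<le> \<tau>" and \<tau>: "0 \<le> \<tau>"
  shows "\<bar>spectral_variance w (2 * b0) n x h - (\<Sum>\<^sub>\<infinity>l\<in>(UNIV::int set). cov (nat \<bar>l\<bar>))\<bar>
    \<le> 2 * (2 * b0) * \<tau> + 2 * C * \<rho> ^ b0 / (1 - \<rho>)"
proof -
  define b where "b = 2 * b0"
  define W where "W k = w (real k / real b)" for k
  have W: "w (of_int l / real b) = W (nat \<bar>l\<bar>)" for l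
    using w by (cases "0 \<le> l") (auto simp: W_def lag_window_def minus_divide_left[symmetric])
  have W01: "0 \<le> W k" "W k \<le> 1" if "k < b" for k
    using w that by (auto simp: W_def lag_window_def abs_le_iff)
  \<comment> \<open>Lags below half the bandwidth fall into the plateau of the window.\<close>
  have W1: "W k = 1" if "k < b0" for k
  proof -
    have "real k / real b \<in> {-1/2..1/2}" using that by (simp add: b_def field_simps)
    then show ?thesis using w by (simp add: W_def lag_window_def)
  qed
  have "\<bar>(\<Sum>\<^sub>\<infinity>l\<in>(UNIV::int set). cov (nat \<bar>l\<bar>)) - (\<Sum>l\<in>{- int b<..<int b}. W (nat \<bar>l\<bar>) * cov (nat \<bar>l\<bar>))\<bar> \<le> 2 * C * \<rho> ^ b0 / (1 - \<rho>)"
  proof (rule infsum_int_approx[OF C])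
    fix k assume k: "k < b"
    have "\<bar>cov k - W k * cov k\<bar> = (1 - W k) * \<bar>cov k\<bar>"
    proof -
      have "cov k - W k * cov k = (1 - W k) * cov k" by (simp add: algebra_simps)
      then show ?thesis using W01[OF k] by (simp add: abs_mult)
    qed
    also have "\<dots> \<le> 1 * \<bar>cov k\<bar>" using W01[OF k] by (intro mult_right_mono) auto
    finally show "\<bar>cov k - W k * cov k\<bar> \<le> C * \<rho> ^ k" using cov[of k] by simp
  qed (auto simp: b_def W1 cov)
  moreover have "spectral_variance w b n x h - (\<Sum>l\<in>{- int b<..<int b}. W (nat \<bar>l\<bar>) * cov (nat \<bar>l\<bar>))
      = (\<Sum>l\<in>{- int b<..<int b}. W (nat \<bar>l\<bar>) * (emp_autocov n x h (nat \<bar>l\<bar>) - cov (nat \<bar>l\<bar>)))"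
    by (simp add: spectral_variance_def W sum_subtractf[symmetric] algebra_simps)
  moreover have "\<bar>\<Sum>l\<in>{- int b<..<int b}. W (nat \<bar>l\<bar>) * (emp_autocov n x h (nat \<bar>l\<bar>) - cov (nat \<bar>l\<bar>))\<bar> \<le> 2 * b * \<tau>"
  proof -
    have *: "\<bar>W k * (emp_autocov n x h k - cov k)\<bar> \<le> \<tau>" if k: "k < b" for k
    proof -
    have "\<bar>W k * (emp_autocov n x h k - cov k)\<bar> \<le> 1 * \<tau>"
      unfolding abs_mult using W01[OF k] close[of k] k by (intro mult_mono) (auto simp: b_def)
    then show ?thesis by simp
    qed
    show ?thesis
      using order_trans[OF sum_abs sum_int_interval_le[of b "\<lambda>k. W k * (emp_autocov n x h k - cov k)", OF * \<tau>]] by simp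
  qed
  ultimately show ?thesis by (simp add: b_def)
qed

text \<open>Replacing the empirical mean by the true one changes each product by at most
  \<open>3 * (A * \<bar>m\<bar>)\<close>, where \<open>m\<close> is the error of the mean. The
  second hypothesis carries the factor \<open>A\<close> so that it has the scale of the first and
  both can come from one estimate; 4 is 1 + 3.\<close>

lemma emp_autocov_approx:
  assumes n: "0 < n" and y: "\<And>k. \<bar>h (x k) - c\<bar> \<le> A"
    and prod: "\<bar>(\<Sum>k<n - l. (h (x k) - c) * (h (x (k + l)) - c)) - n * v\<bar> \<le> T"
    and mean: "\<bar>\<Sum>k<n. (h (x k) - c) * A\<bar> \<le> T"
  shows "\<bar>emp_autocov n x h l - v\<bar> \<le> 4 * T / n"
proof -
  define y where "y k = h (x k) - c" for k
  define m where "m = (\<Sum>k<n. y k) / n"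
  have A: "0 \<le> A" using y[of 0] by linarith
  have yA: "\<bar>y k\<bar> \<le> A" for k using y by (simp add: y_def)
  have "\<bar>\<Sum>k<n. y k\<bar> \<le> (\<Sum>k<n. A)" by (intro order_trans[OF sum_abs] sum_mono yA)
  then have mA: "\<bar>m\<bar> \<le> A" using n by (simp add: m_def divide_le_eq mult.commute)
  have mT: "A * \<bar>m\<bar> \<le> T / n"
  proof -
    have "A * \<bar>m\<bar> = \<bar>\<Sum>k<n. y k * A\<bar> / n"
      using A by (simp add: m_def sum_distrib_right[symmetric] abs_mult)
    then show ?thesis using mean n by (simp add: y_def divide_right_mono)
  qed
  have em: "emp_mean n x h = m + c"
    using n by (simp add: emp_mean_def m_def y_def sum_subtractf field_simps)
  have ac: "emp_autocov n x h l = (\<Sum>k<n - l. (y k - m) * (y (k + l) - m)) / n"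
    by (simp add: emp_autocov_def em y_def diff_diff_eq add.commute)
  have "n * (emp_autocov n x h l - v) = ((\<Sum>k<n - l. y k * y (k + l)) - n * v)
      + (\<Sum>k<n - l. (y k - m) * (y (k + l) - m) - y k * y (k + l))"
  proof -
    have "(\<Sum>k<n - l. (y k - m) * (y (k + l) - m) - y k * y (k + l))
        = (\<Sum>k<n - l. (y k - m) * (y (k + l) - m)) - (\<Sum>k<n - l. y k * y (k + l))" by (rule sum_subtractf)
    moreover have "n * emp_autocov n x h l = (\<Sum>k<n - l. (y k - m) * (y (k + l) - m))"
      unfolding ac using n by simp
    ultimately show ?thesis
      by (simp add: right_diff_distrib[of "real n" "emp_autocov n x h l" v])
  qed
  also have "\<bar>\<dots>\<bar> \<le> T + n * (3 * (A * \<bar>m\<bar>))"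
  proof (rule order_trans[OF abs_triangle_ineq add_mono])
    show "\<bar>(\<Sum>k<n - l. y k * y (k + l)) - n * v\<bar> \<le> T" using prod by (simp add: y_def)
    have "\<bar>\<Sum>k<n - l. (y k - m) * (y (k + l) - m) - y k * y (k + l)\<bar> \<le> (\<Sum>k<n - l. 3 * (A * \<bar>m\<bar>))"
    proof (intro order_trans[OF sum_abs] sum_mono)
      fix k
      have "(y k - m) * (y (k + l) - m) - y k * y (k + l) = m * (m - y k - y (k + l))"
        by (simp add: algebra_simps)
      also have "\<bar>\<dots>\<bar> \<le> \<bar>m\<bar> * (3 * A)"
        unfolding abs_mult using mA yA[of k] yA[of "k + l"] by (intro mult_left_mono) auto
      finally show "\<bar>(y k - m) * (y (k + l) - m) - y k * y (k + l)\<bar> \<le> 3 * (A * \<bar>m\<bar>)" by (simp add: mult_ac)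
    qed
    also have "\<dots> \<le> n * (3 * (A * \<bar>m\<bar>))"
      unfolding sum_constant using A by (intro mult_right_mono) auto
    finally show "\<bar>\<Sum>k<n - l. (y k - m) * (y (k + l) - m) - y k * y (k + l)\<bar> \<le> n * (3 * (A * \<bar>m\<bar>))" .
  qed
  also have "\<dots> \<le> T + n * (3 * (T / n))" by (intro add_left_mono mult_left_mono mT) auto
  also have "\<dots> = 4 * T" using n by simp
  finally show ?thesis using n by (simp add: abs_mult le_divide_eq mult.commute)
qed

text \<open>The crude bound for samples shorter than one window.\<close>

lemma emp_autocov_bound:
  assumes n: "0 < n" and y: "\<And>k. \<bar>h (x k) - c\<bar> \<le> A"
  shows "\<bar>emp_autocov n x h l\<bar> \<le> 4 * A\<^sup>2"
proof -
  have A: "0 \<le> A" using y[of 0] by linarith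
  have "emp_mean n x h - c = (\<Sum>k<n. h (x k) - c) / n"
    using n by (simp add: emp_mean_def sum_subtractf field_simps)
  moreover have "\<bar>\<Sum>k<n. h (x k) - c\<bar> \<le> (\<Sum>k<n. A)" by (intro order_trans[OF sum_abs] sum_mono y)
  ultimately have m: "\<bar>emp_mean n x h - c\<bar> \<le> A" using n by (simp add: divide_le_eq mult.commute)
  have d: "\<bar>h (x k) - emp_mean n x h\<bar> \<le> 2 * A" for k using y[of k] m by linarith
  have "\<bar>\<Sum>k<n - l. (h (x k) - emp_mean n x h) * (h (x (k + l)) - emp_mean n x h)\<bar> \<le> (\<Sum>k<n - l. 2 * A * (2 * A))"
    unfolding abs_mult by (intro order_trans[OF sum_abs] sum_mono, unfold abs_mult, intro mult_mono' d abs_ge_zero)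
  also have "\<dots> \<le> n * (4 * A\<^sup>2)" by (auto simp: power2_eq_square intro!: mult_right_mono)
  finally show ?thesis using n by (simp add: emp_autocov_def divide_le_eq mult.commute)
qed

section \<open>Choice of the window length\<close>

lemma ln_nat_ge_half: "2 \<le> n \<Longrightarrow> 1 / 2 \<le> ln (real n)"
proof -
  assume "2 \<le> n"
  then have "ln 2 \<le> ln (real n)" by simp
  then show ?thesis using ln2_ge_two_thirds by linarith
qed

lemma le_divide_less_one: "0 \<le> x \<Longrightarrow> 0 < q \<Longrightarrow> q < 1 \<Longrightarrow> x \<le> x / (q::real)"
  by (simp add: le_divide_eq mult_left_le)

lemma power_ceiling_le_exp:
  fixes \<rho> t q :: real
  assumes \<rho>: "0 < \<rho>" "\<rho> < 1" and t: "0 \<le> t" and q: "0 < q" "q / 2 \<le> ln (1 / \<rho>)"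
  defines "s \<equiv> nat \<lceil>t / ln (1 / \<rho>)\<rceil>"
  shows "\<rho> ^ s \<le> exp (- t)" "real s \<le> 2 * t / q + 1"
proof -
  define \<Lambda> where "\<Lambda> = ln (1 / \<rho>)"
  have \<Lambda>: "0 < \<Lambda>" using q by (simp add: \<Lambda>_def)
  have ln\<rho>: "ln \<rho> = - \<Lambda>" using \<rho> by (simp add: \<Lambda>_def ln_div)
  have s: "t / \<Lambda> \<le> s" "s \<le> t / \<Lambda> + 1"
    using t \<Lambda> by (auto simp: s_def \<Lambda>_def[symmetric] intro: real_nat_ceiling_ge)
  have "t \<le> s * \<Lambda>" using s(1) \<Lambda> by (simp add: divide_le_eq)
  have "\<rho> ^ s = exp (s * ln \<rho>)" using \<rho> by (simp add: exp_of_nat_mult)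
  also have "\<dots> \<le> exp (- t)" using \<open>t \<le> s * \<Lambda>\<close> by (simp add: ln\<rho>)
  finally show "\<rho> ^ s \<le> exp (- t)" .
  have "t / \<Lambda> \<le> t / (q / 2)" using t q by (intro divide_left_mono) (auto simp: \<Lambda>_def[symmetric] \<Lambda>)
  then show "real s \<le> 2 * t / q + 1" using s(2) by (simp add: mult.commute)
qed

lemma ln_le_mult_powr:
  fixes x l :: real
  assumes "1 \<le> x" "0 < l"
  shows "1 \<le> x powr (1 / l)" "ln x \<le> l * x powr (1 / l)"
proof -
  show "1 \<le> x powr (1 / l)" using assms by (intro ge_one_powr_ge_zero) auto
  have "1 + ln x / l \<le> exp (ln x / l)" by (rule exp_ge_add_one_self)
  also have "\<dots> = x powr (1 / l)" using assms by (simp add: powr_def)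
  finally show "ln x \<le> l * x powr (1 / l)" using assms by (simp add: field_simps)
qed

text \<open>Forgetting to the required precision takes a number of steps logarithmic in
  \<open>1 / \<delta>\<close>, \<open>n\<close> and \<open>1 / q\<close>, divided by
  \<open>q\<close>. All these logarithms are absorbed into \<open>ln n * E\<close>, with one further
  power of \<open>1 / q\<close> spent on \<open>ln (1 / q)\<close>.\<close>

lemma window_length:
  fixes \<rho> q \<delta> :: real and n N :: nat
  assumes \<rho>: "0 < \<rho>" "\<rho> < 1" and q: "0 < q" "q < 1" "q / 2 \<le> ln (1 / \<rho>)"
    and n: "2 \<le> n" and \<delta>: "0 < \<delta>" "\<delta> < 1" and N: "1 \<le> N"
  defines "E \<equiv> (real N / \<delta>) powr (1 / ln (real n))"
  shows "\<exists>s::nat. \<rho> ^ s \<le> \<delta> * q ^ 3 / (real n)\<^sup>2 \<and> real s \<le> 20 * (ln n * E / q\<^sup>2)"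
proof -
  define l where "l = ln (real n)"
  have l: "1 / 2 \<le> l" using ln_nat_ge_half[OF n] by (simp add: l_def)
  have N\<delta>: "1 / \<delta> \<le> real N / \<delta>" "1 \<le> real N / \<delta>" using N \<delta> by (auto simp: field_simps)
  note E = ln_le_mult_powr[OF N\<delta>(2), of l, folded l_def]
  have E1: "1 \<le> E" and EN: "ln (real N / \<delta>) \<le> l * E" using E l by (auto simp: E_def l_def)
  \<comment> \<open>Makes \<open>exp (- t)\<close> equal to
    \<open>\<delta> * q ^ 3 / (real n)\<^sup>2\<close>. The \<delta> pays for Markov's inequality,
    one power of n for the sum over the sample and the other for \<open>L / B\<close> of order n;
    the powers of q pay for \<open>1 / (1 - \<rho>)\<close> and \<open>1 / \<sigma>\<close>.\<close>
  define t where "t = 2 * l + ln (1 / \<delta>) + 3 * ln (1 / q)"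
  have d0: "0 \<le> ln (1 / \<delta>)" "0 \<le> ln (1 / q)" using \<delta> q by auto
  have t0: "0 \<le> t" using l d0 by (simp add: t_def)
  have "exp (- t) = exp (- (2 * l)) * exp (- ln (1 / \<delta>)) * exp (- (3 * ln (1 / q)))"
    by (simp add: t_def exp_add[symmetric])
  also have "exp (- (2 * l)) = 1 / (real n)\<^sup>2"
  proof -
    have "exp (2 * l) = exp l ^ 2" by (simp add: exp_double)
    then show ?thesis using n by (simp add: l_def exp_minus inverse_eq_divide)
  qed
  also have "exp (- ln (1 / \<delta>)) = \<delta>" using \<delta> by (simp add: ln_div)
  also have "exp (- (3 * ln (1 / q))) = q ^ 3"
  proof -
    have "- (3 * ln (1 / q)) = real 3 * ln q" using q by (simp add: ln_div)
    then show ?thesis using q by (simp only: exp_of_nat_mult exp_ln)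
  qed
  finally have et: "exp (- t) = \<delta> * q ^ 3 / (real n)\<^sup>2" by simp
  define s where "s = nat \<lceil>t / ln (1 / \<rho>)\<rceil>"
  note s = power_ceiling_le_exp[OF \<rho> t0 q(1,3), folded s_def]
  have lE: "l \<le> l * E" using E1 l by simp
  have lEq: "l * E \<le> l * E / q" "l * E / q \<le> l * E / q\<^sup>2"
  proof -
    have p: "0 < l * E" using E1 l by (intro mult_pos_pos) auto
    show "l * E \<le> l * E / q" using p q by (intro le_divide_less_one) auto
    have "l * E / q \<le> (l * E / q) / q" using p q by (intro le_divide_less_one) auto
    then show "l * E / q \<le> l * E / q\<^sup>2" by (simp add: power2_eq_square)
  qed
  have "t \<le> 9 * (l * E / q)"
  proof -
    have "ln (1 / \<delta>) \<le> ln (real N / \<delta>)" using N\<delta> \<delta> by (subst ln_le_cancel_iff) auto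
    moreover have "ln (1 / q) \<le> 1 / q" using q ln_le_minus_one[of "1 / q"] by simp
    moreover have "1 / q \<le> 2 * (l * E / q)"
    proof -
      have "1 \<le> 2 * (l * E)" using l lE by linarith
      then show ?thesis using q by (simp add: divide_right_mono)
    qed
    moreover have "2 * l + a + 3 * c \<le> 9 * y"
      if "a \<le> x" "c \<le> p" "p \<le> 2 * y" "x \<le> z" "l \<le> z" "z \<le> y" for a c x p y z :: real
      using that by linarith
    ultimately show ?thesis unfolding t_def using EN lE lEq(1) by blast
  qed
  then have "2 * t / q \<le> 18 * (l * E / q\<^sup>2)"
    using q by (simp add: field_simps power2_eq_square)
  moreover have "1 \<le> 2 * (l * E / q\<^sup>2)" using l lE lEq by linarith
  ultimately have "real s \<le> 20 * (l * E / q\<^sup>2)" using s(2) by linarith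
  with s(1) et show ?thesis unfolding l_def by (intro exI[of _ s]) auto
qed

section \<open>Uniform concentration of the empirical autocovariances\<close>

context contractive_chain begin

text \<open>The hypothesis \<open>L * \<sigma> \<le> B * n\<close> trades the Lipschitz constant for
  \<open>B\<close>, and \<open>q \<le> \<mu> * \<sigma>\<close> trades the resulting
  \<open>1 / \<sigma>\<close> for \<open>\<mu> / q\<close>. The constants \<open>C0\<close>,
  \<open>K0\<close> and \<mu> are thus all that survives of the initial law, the drift and the step
  size, and \<open>L\<close> has disappeared.\<close>

lemma autocov_concentration:
  fixes H :: "('s \<Rightarrow> real) set" and B L \<sigma> \<mu> q \<delta> C0 K0 :: real and n b :: nat
  assumes xi: "prob_space \<xi>" "sets \<xi> = sets X" "(\<integral>\<^sup>+x. ennreal (D x x0) \<partial>\<xi>) \<le> ennreal C0" "0 < C0"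
    and inv: "invariant \<pi>" and H: "finite H" "H \<noteq> {}"
    and meas: "\<And>h. h \<in> H \<Longrightarrow> h \<in> borel_measurable X"
    and bd: "\<And>h x. h \<in> H \<Longrightarrow> x \<in> space X \<Longrightarrow> \<bar>h x\<bar> \<le> B"
    and lip: "\<And>h x y. h \<in> H \<Longrightarrow> x \<in> space X \<Longrightarrow> y \<in> space X \<Longrightarrow> \<bar>h x - h y\<bar> \<le> L * D x y"
    and L: "0 \<le> L" and B: "0 < B" and rho0: "0 < \<rho>"
    and q: "0 < q" "q < 1" "q / 2 \<le> 1 - \<rho>" "q / 2 \<le> ln (1 / \<rho>)"
    and \<sigma>: "0 < \<sigma>" "L * \<sigma> \<le> B * n" "q \<le> \<mu> * \<sigma>" and K0: "\<kappa> \<le> K0"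
    and n: "2 \<le> n" and \<delta>: "0 < \<delta>" "\<delta> < 1" and b: "1 \<le> b" "b \<le> 8 * (ln n / q)"
  defines "E \<equiv> (real (card H) / \<delta>) powr (1 / ln (real n))"
  shows "\<exists>A\<in>sets (\<xi> \<Otimes>\<^sub>M S). measure (\<xi> \<Otimes>\<^sub>M S) A \<ge> 1 - \<delta> \<and> (\<forall>\<omega>\<in>A. \<forall>h\<in>H. \<forall>l<b.
    \<bar>emp_autocov n (orbit stp (fst \<omega>) (snd \<omega>)) h l
       - autocov \<pi> (\<lambda>x. h x - (\<integral>y. h y \<partial>\<pi>)) (\<lambda>x. h x - (\<integral>y. h y \<partial>\<pi>)) l\<bar>
    \<le> 4 * B\<^sup>2 * (208 + 64 * \<mu> * (C0 + K0)) * (ln n * E / q / sqrt n))"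
proof -
  have spxi: "space \<xi> = space X" by (rule sets_eq_imp_space_eq[OF xi(2)])
  interpret xi: prob_space \<xi> by (rule xi)
  interpret XS: pair_prob_space \<xi> S ..
  interpret pi: prob_space \<pi> using inv by (simp add: invariant_def)
  have spi: "space \<pi> = space X" using inv by (intro sets_eq_imp_space_eq) (simp add: invariant_def)
  define N where "N = card H"
  have N: "1 \<le> N" using H by (simp add: N_def Suc_le_eq card_gt_0_iff)
  define l where "l = ln (real n)"
  have l: "1 / 2 \<le> l" using ln_nat_ge_half[OF n] by (simp add: l_def)
  have N\<delta>: "1 \<le> real N / \<delta>" using N \<delta> by (simp add: field_simps)
  have E1: "1 \<le> E" and EN: "ln (real N / \<delta>) \<le> l * E"
    using ln_le_mult_powr[OF N\<delta>, of l] l by (auto simp: E_def l_def N_def)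
  \<comment> \<open>The common scale of all errors: \<open>sqrt r\<close> is at most
    \<open>8 * G\<close> and \<open>sqrt (r * lam)\<close> at most \<open>13 * G\<close>.\<close>
  define G where "G = l * E / q"
  have lE: "l \<le> l * E" using E1 l by simp
  have lEq: "l * E \<le> G" unfolding G_def using lE l q by (intro le_divide_less_one) auto
  have G: "1 / 2 \<le> G" using l lE lEq by linarith
  have \<mu>: "0 \<le> \<mu>" using \<sigma> q by (metis less_le_trans linorder_not_le mult_neg_pos order_less_asym)
  have K00: "0 \<le> K0" using kappa K0 by linarith
  obtain s where s: "\<rho> ^ s \<le> \<delta> * q ^ 3 / (real n)\<^sup>2" "real s \<le> 20 * (l * E / q\<^sup>2)"
    using window_length[OF rho0 rho(2) q(1,2,4) n \<delta> N] unfolding l_def E_def N_def by blast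
  define r where "r = s + b"
  have rb: "real r \<le> 28 * (l * E / q\<^sup>2)"
  proof -
    have "l / q \<le> l * E / q\<^sup>2"
    proof -
      have "l / q \<le> l * E / q" using lE q by (simp add: divide_right_mono)
      also have "\<dots> \<le> (l * E / q) / q" using G q by (intro le_divide_less_one) (auto simp: G_def[symmetric])
      finally show ?thesis by (simp add: power2_eq_square)
    qed
    then have "real b \<le> 8 * (l * E / q\<^sup>2)" using b(2) unfolding l_def by linarith
    then have "real s + real b \<le> 20 * (l * E / q\<^sup>2) + 8 * (l * E / q\<^sup>2)" by (intro add_mono s(2))
    then show ?thesis by (simp add: r_def mult.commute)
  qed
  have rG: "real r \<le> 56 * G\<^sup>2"
  proof -
    have "1 \<le> 2 * (l * E)" using l lE by linarith
    from mult_right_mono[OF this, of "l * E"] have "l * E \<le> 2 * (l * E) * (l * E)" using l lE by simp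
    then have "l * E / q\<^sup>2 \<le> 2 * (l * E) * (l * E) / q\<^sup>2" by (rule divide_right_mono) simp
    also have "\<dots> = 2 * G\<^sup>2" by (simp add: G_def power_divide power2_eq_square)
    finally show ?thesis using rb by simp
  qed
  have sqr: "sqrt r \<le> 8 * G"
    using rG G by (intro real_le_lsqrt) (auto simp: power_mult_distrib intro: order_trans)
  define A where "A = 2 * B"
  have A: "0 < A" "A\<^sup>2 = 4 * B\<^sup>2" using B by (auto simp: A_def power_mult_distrib)
  define c where "c h = (\<integral>y. h y \<partial>\<pi>)" for h :: "'s \<Rightarrow> real"
  define u where "u h x = h x - c h" for h and x :: 's
  have cB: "\<bar>c h\<bar> \<le> B" if "h \<in> H" for h
    unfolding c_def using bd[OF that] B by (intro pi.abs_expectation_le) (auto simp: spi)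
  have uA: "\<bar>u h x\<bar> \<le> A" if "h \<in> H" "x \<in> space X" for h x
    using bd[OF that] cB[OF that(1)] by (simp add: u_def A_def)
  have u_meas: "u h \<in> borel_measurable X" if "h \<in> H" for h
    unfolding u_def using meas[OF that] by measurable
  have ulip: "\<bar>u h x - u h y\<bar> \<le> L * D x y" if "h \<in> H" "x \<in> space X" "y \<in> space X" for h x y
    using lip[OF that] by (simp add: u_def)
  have orb: "orbit stp (fst \<omega>) (snd \<omega>) k \<in> space X" if "\<omega> \<in> space (\<xi> \<Otimes>\<^sub>M S)" for \<omega> k
    using that by (auto simp: space_pair_measure spxi)
  have sqn: "0 < sqrt (real n)" "sqrt (real n) * sqrt (real n) = n" using n by auto
  have goal_eq: "4 * B\<^sup>2 * (208 + 64 * \<mu> * (C0 + K0)) * (ln n * E / q / sqrt n)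
      = A\<^sup>2 * (208 + 64 * \<mu> * (C0 + K0)) * (G / sqrt n)" by (simp add: A G_def l_def)
  show ?thesis
  proof (cases "r \<le> n")
    case False
    \<comment> \<open>A window longer than the sample means \<open>sqrt n \<le> 8 * G\<close>; the
      claimed bound then exceeds \<open>5 * A\<^sup>2\<close>, which holds without probability as 4
      + 1.\<close>
    have "sqrt n \<le> sqrt r" using False by simp
    from order_trans[OF this sqr] have "1 \<le> 8 * G / sqrt n" using sqn by (simp add: le_divide_eq)
    then have "5 * 1 \<le> (208 + 64 * \<mu> * (C0 + K0)) * (G / sqrt n)"
    proof -
      have "40 * (G / sqrt n) \<le> (208 + 64 * \<mu> * (C0 + K0)) * (G / sqrt n)"
        using \<mu> xi(4) K00 G sqn by (intro mult_right_mono) (auto intro!: add_increasing2 mult_nonneg_nonneg)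
      with \<open>1 \<le> 8 * G / sqrt n\<close> show ?thesis by simp
    qed
    then have big: "5 * A\<^sup>2 \<le> A\<^sup>2 * (208 + 64 * \<mu> * (C0 + K0)) * (G / sqrt n)"
      using mult_left_mono[of 5 "(208 + 64 * \<mu> * (C0 + K0)) * (G / sqrt n)" "A\<^sup>2"] by (simp add: mult_ac)
    show ?thesis
    proof (intro bexI[of _ "space (\<xi> \<Otimes>\<^sub>M S)"] conjI ballI allI impI)
      fix \<omega> h j assume \<omega>: "\<omega> \<in> space (\<xi> \<Otimes>\<^sub>M S)" and h: "h \<in> H"
      have "\<bar>emp_autocov n (orbit stp (fst \<omega>) (snd \<omega>)) h j\<bar> \<le> 4 * A\<^sup>2"
        using n uA[OF h orb[OF \<omega>]] by (intro emp_autocov_bound[where c = "c h"]) (auto simp: u_def)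
      moreover have "\<bar>autocov \<pi> (u h) (u h) j\<bar> \<le> A\<^sup>2" using uA[OF h] by (intro abs_autocov_le inv)
      ultimately show "\<bar>emp_autocov n (orbit stp (fst \<omega>) (snd \<omega>)) h j
          - autocov \<pi> (\<lambda>x. h x - (\<integral>y. h y \<partial>\<pi>)) (\<lambda>x. h x - (\<integral>y. h y \<partial>\<pi>)) j\<bar>
        \<le> 4 * B\<^sup>2 * (208 + 64 * \<mu> * (C0 + K0)) * (ln n * E / q / sqrt n)"
        unfolding goal_eq using big by (simp add: u_def[abs_def] c_def)
    qed (use \<delta> XS.P.prob_space in auto)
  next
    case True
    \<comment> \<open>The argument of the logarithm pays for the union over
      \<open>N * (b + 1)\<close> indices and \<open>r\<close> residue classes, using
      \<open>(b + 1) * r \<le> 2 * n * n\<close>.\<close>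
    define lam where "lam = ln (8 * (real n)\<^sup>2 * (real N / \<delta>))"
    have lam_eq: "lam = ln 8 + 2 * l + ln (real N / \<delta>)"
    proof -
      have "ln (8 * (real n)\<^sup>2 * x) = ln 8 + 2 * ln (real n) + ln x" if "0 < x" for x
        using that n by (simp add: ln_mult ln_realpow)
      from this[of "real N / \<delta>"] show ?thesis using N\<delta> by (simp add: lam_def l_def del: times_divide_eq_right)
    qed
    have ln8: "ln (8::real) \<le> 3 * l" "0 < ln (8::real)"
    proof -
      have "ln (8::real) = 3 * ln 2" using ln_realpow[of 2 3] by simp
      moreover have "ln 2 \<le> l" using n by (simp add: l_def)
      ultimately show "ln (8::real) \<le> 3 * l" by simp
    qed simp
    have "0 \<le> ln (real N / \<delta>)" using N\<delta> by (rule ln_ge_zero)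
    then have lam: "0 < lam" "lam \<le> 6 * (l * E)"
      using lam_eq ln8 l EN lE by linarith+
    \<comment> \<open>The index \<open>(h, j)\<close> with \<open>j < b\<close> stands for the lag-j
      product of h. The extra index \<open>(h, b)\<close> multiplies h by the constant
      \<open>A\<close> at lag 0 and has covariance 0; it controls the empirical mean.\<close>
    define U V and lag :: "('s \<Rightarrow> real) \<times> nat \<Rightarrow> nat"
      where "U i = u (fst i)" and "V i = (if snd i < b then u (fst i) else (\<lambda>_. A))"
        and "lag i = (if snd i < b then snd i else 0)" for i :: "('s \<Rightarrow> real) \<times> nat"
    define I where "I = H \<times> {..b}"
    have bn: "b \<le> n" using True by (simp add: r_def)
    have union: "real (card I) * (2 * r * exp (- lam)) \<le> \<delta> / 2"
    proof -
      have e: "exp (- lam) = \<delta> / (8 * (real n)\<^sup>2 * N)"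
        using n N \<delta> by (simp add: lam_def exp_minus)
      have c: "real (card I) = real N * (real b + 1)"
        by (simp add: I_def card_cartesian_product N_def algebra_simps)
      have "real (card I) * (2 * r * exp (- lam)) = \<delta> * ((real b + 1) * r) / (4 * (real n)\<^sup>2)"
        unfolding c e using N n by (simp add: divide_simps)
      also have "\<dots> \<le> \<delta> * (2 * n * n) / (4 * (real n)\<^sup>2)"
      proof -
        have "(real b + 1) * r \<le> (2 * real n) * real n"
          using bn True n by (intro mult_mono) auto
        then show ?thesis using \<delta> by (intro divide_right_mono mult_left_mono) auto
      qed
      also have "\<dots> = \<delta> / 2" using n by (simp add: power2_eq_square)
      finally show ?thesis .
    qed
    define T where "T = 2 * real r * A\<^sup>2 + 4 * A * L * n * \<rho> ^ s * (C0 + \<kappa> / (1 - \<rho>)) / \<delta>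
      + 4 * A * L * n * \<rho> ^ s * \<kappa> / (1 - \<rho>) + 2 * A\<^sup>2 * sqrt (real n * real r * lam)"
    have Ifin: "finite I" using H by (simp add: I_def)
    have "\<exists>F\<in>sets (\<xi> \<Otimes>\<^sub>M S). measure (\<xi> \<Otimes>\<^sub>M S) F \<ge> 1 - \<delta> \<and> (\<forall>\<omega>\<in>F. \<forall>i\<in>I.
      \<bar>(\<Sum>k<n - lag i. U i (orbit stp (fst \<omega>) (snd \<omega>) k) * V i (orbit stp (fst \<omega>) (snd \<omega>) (k + lag i)))
        - n * autocov \<pi> (U i) (V i) (lag i)\<bar> \<le> T)"
      unfolding T_def
      by (rule lag_estimate[OF xi inv Ifin])
         (use u_meas uA ulip L A rho0 True \<delta> lam union b D_nonneg in
           \<open>auto simp: I_def U_def V_def lag_def r_def\<close>)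
    then obtain F where F: "F \<in> sets (\<xi> \<Otimes>\<^sub>M S)" "measure (\<xi> \<Otimes>\<^sub>M S) F \<ge> 1 - \<delta>"
      and est: "\<And>\<omega> i. \<omega> \<in> F \<Longrightarrow> i \<in> I \<Longrightarrow>
        \<bar>(\<Sum>k<n - lag i. U i (orbit stp (fst \<omega>) (snd \<omega>) k) * V i (orbit stp (fst \<omega>) (snd \<omega>) (k + lag i)))
        - n * autocov \<pi> (U i) (V i) (lag i)\<bar> \<le> T" by blast
    have T: "4 * T / n \<le> A\<^sup>2 * (208 + 64 * \<mu> * (C0 + K0)) * (G / sqrt n)"
    proof -
      define g where "g = G / sqrt n"
      have g0: "0 \<le> g" using G sqn by (simp add: g_def)
      have inv_n: "1 / n \<le> 2 * g"
      proof -
        have "sqrt n \<le> n" using n by (intro real_le_lsqrt) (auto simp: power2_eq_square)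
        then have "1 / real n \<le> 1 / sqrt n" using sqn by (intro divide_left_mono) (auto intro: mult_pos_pos)
        also have "\<dots> \<le> 2 * G / sqrt n" using G sqn by (intro divide_right_mono) auto
        finally show ?thesis by (simp add: g_def)
      qed
      have t1: "real r / n \<le> 8 * g"
      proof -
        have "real r / n = (sqrt r / sqrt n) * (sqrt r / sqrt n)" by simp
        also have "\<dots> \<le> 1 * (sqrt r / sqrt n)" using True sqn by (intro mult_right_mono) auto
        also have "\<dots> \<le> 8 * G / sqrt n" using sqr sqn by (simp add: divide_right_mono)
        finally show ?thesis by (simp add: g_def)
      qed
      have t2: "sqrt (real n * real r * lam) / n \<le> 13 * g"
      proof -
        have "r * lam \<le> (28 * (l * E / q\<^sup>2)) * (6 * (l * E))"
          using rb lam l lE by (intro mult_mono) auto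
        also have "\<dots> = 168 * G\<^sup>2" by (simp add: G_def power_divide power2_eq_square)
        also have "\<dots> \<le> (13 * G)\<^sup>2" by (simp add: power_mult_distrib)
        finally have "sqrt (r * lam) \<le> 13 * G" using G by (intro real_le_lsqrt) auto
        moreover have "sqrt (real n * real r * lam) / n = sqrt (r * lam) / sqrt n"
        proof -
          have "sqrt (real n * real r * lam) = sqrt n * sqrt (r * lam)"
            by (simp only: real_sqrt_mult mult.assoc)
          moreover have "sqrt n * sqrt (r * lam) / (sqrt n * sqrt n) = sqrt (r * lam) / sqrt n"
            by (rule mult_divide_mult_cancel_left) (use sqn in simp)
          ultimately show ?thesis by (simp only: sqn(2))
        qed
        ultimately show ?thesis using sqn by (simp add: g_def divide_right_mono)
      qed
      \<comment> \<open>The point at which \<open>L\<close> is eliminated in favour of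
        \<open>B\<close>.\<close>
      have Lq: "L * q\<^sup>2 \<le> B * n * \<mu>"
      proof -
        have "L * q\<^sup>2 \<le> L * (q * 1)" unfolding power2_eq_square using L q by (intro mult_left_mono) auto
        also have "\<dots> \<le> L * (\<mu> * \<sigma>)" using L \<sigma> by (simp add: mult_left_mono)
        also have "\<dots> = (L * \<sigma>) * \<mu>" by simp
        also have "\<dots> \<le> B * n * \<mu>" using \<sigma> \<mu> by (intro mult_right_mono) auto
        finally show ?thesis .
      qed
      have k: "\<kappa> / (1 - \<rho>) \<le> 2 * K0 / q"
      proof -
        have "\<kappa> / (1 - \<rho>) \<le> K0 / (q / 2)" using kappa K0 q rho by (intro frac_le) auto
        then show ?thesis by (simp add: mult.commute)
      qed
      \<comment> \<open>Treats at once the two error terms containing \<open>\<rho> ^ s\<close>;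
        \<open>Z\<close> is a moment of size up to \<open>z / q\<close>.\<close>
      have key: "4 * A * L * n * \<rho> ^ s * Z / \<delta> \<le> n * (A\<^sup>2 * (8 * \<mu> * z) * g)"
        if Z: "0 \<le> Z" "Z \<le> 2 * z / q" "0 \<le> z" for Z z
      proof -
        have "4 * A * L * n * \<rho> ^ s * Z / \<delta> \<le> 4 * A * L * n * (\<delta> * q ^ 3 / (real n)\<^sup>2) * (2 * z / q) / \<delta>"
          using A L \<delta> Z s(1) rho q by (intro divide_right_mono mult_mono mult_left_mono) auto
        also have "\<dots> = 8 * A * (L * q\<^sup>2) * z / n"
        proof -
          have "4 * A * L * n * (\<delta> * (q * q * q) / (n * n)) * (2 * z / q) / \<delta> = 8 * A * (L * (q * q)) * z / n"
            if "0 < n" for n :: real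
            using \<delta> q that by (simp add: divide_simps)
          from this[of "real n"] show ?thesis using n by (simp add: power2_eq_square power3_eq_cube mult.assoc)
        qed
        also have "\<dots> \<le> 8 * A * (B * n * \<mu>) * z / n"
          using A Z Lq by (intro divide_right_mono mult_right_mono mult_left_mono) auto
        also have "\<dots> = n * (A\<^sup>2 * (4 * \<mu> * z) * (1 / n))" using n by (simp add: A_def power2_eq_square field_simps)
        also have "\<dots> \<le> n * (A\<^sup>2 * (4 * \<mu> * z) * (2 * g))"
          using inv_n \<mu> Z by (intro mult_left_mono) auto
        finally show ?thesis by (simp add: mult_ac)
      qed
      have k0: "0 \<le> \<kappa> / (1 - \<rho>)" using kappa rho by simp
      have t3: "4 * A * L * n * \<rho> ^ s * (C0 + \<kappa> / (1 - \<rho>)) / \<delta> \<le> n * (A\<^sup>2 * (8 * \<mu> * (C0 + K0)) * g)"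
      proof (rule key)
        have "q * C0 \<le> 2 * C0" using xi(4) q by (intro mult_right_mono) auto
        then have "C0 \<le> 2 * C0 / q" using q by (simp add: le_divide_eq mult.commute)
        then show "C0 + \<kappa> / (1 - \<rho>) \<le> 2 * (C0 + K0) / q" using k by (simp add: add_divide_distrib)
      qed (use k0 xi(4) K00 in auto)
      have t4: "4 * A * L * n * \<rho> ^ s * \<kappa> / (1 - \<rho>) \<le> n * (A\<^sup>2 * (8 * \<mu> * K0) * g)"
      proof -
        have "4 * A * L * n * \<rho> ^ s * \<kappa> / (1 - \<rho>) = 4 * A * L * n * \<rho> ^ s * (\<kappa> / (1 - \<rho>)) * 1" by simp
        also have "\<dots> \<le> 4 * A * L * n * \<rho> ^ s * (\<kappa> / (1 - \<rho>)) * (1 / \<delta>)"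
          using A L k0 rho \<delta> by (intro mult_left_mono mult_nonneg_nonneg) auto
        also have "\<dots> = 4 * A * L * n * \<rho> ^ s * (\<kappa> / (1 - \<rho>)) / \<delta>" by simp
        also have "\<dots> \<le> n * (A\<^sup>2 * (8 * \<mu> * K0) * g)" by (rule key) (use k0 k K00 in auto)
        finally show ?thesis .
      qed
      have "4 * T / n = 8 * A\<^sup>2 * (real r / n) + 4 * (4 * A * L * n * \<rho> ^ s * (C0 + \<kappa> / (1 - \<rho>)) / \<delta>) / n
          + 4 * (4 * A * L * n * \<rho> ^ s * \<kappa> / (1 - \<rho>)) / n + 8 * A\<^sup>2 * (sqrt (real n * real r * lam) / n)"
        by (simp add: T_def add_divide_distrib mult_ac)
      also have "\<dots> \<le> 8 * A\<^sup>2 * (8 * g) + 4 * (n * (A\<^sup>2 * (8 * \<mu> * (C0 + K0)) * g)) / n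
          + 4 * (n * (A\<^sup>2 * (8 * \<mu> * K0) * g)) / n + 8 * A\<^sup>2 * (13 * g)"
        by (intro add_mono mult_left_mono divide_right_mono t1 t2 t3 t4) auto
      also have "\<dots> = A\<^sup>2 * (168 + 32 * \<mu> * (C0 + K0) + 32 * \<mu> * K0) * g"
      proof -
        have cancel: "4 * (real n * x) / real n = 4 * x" for x :: real using n by simp
        show ?thesis unfolding cancel by (simp add: algebra_simps)
      qed
      also have "\<dots> \<le> A\<^sup>2 * (208 + 64 * \<mu> * (C0 + K0)) * g"
      proof (intro mult_right_mono mult_left_mono g0)
        have "\<mu> * K0 \<le> \<mu> * (C0 + K0)" using \<mu> xi(4) by (intro mult_left_mono) auto
        then show "168 + 32 * \<mu> * (C0 + K0) + 32 * \<mu> * K0 \<le> 208 + 64 * \<mu> * (C0 + K0)" by simp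
      qed simp
      finally show ?thesis by (simp add: g_def)
    qed
    show ?thesis
    proof (intro bexI[OF _ F(1)] conjI ballI allI impI F(2))
      fix \<omega> h j assume \<omega>: "\<omega> \<in> F" and h: "h \<in> H" and j: "j < b"
      have \<omega>': "\<omega> \<in> space (\<xi> \<Otimes>\<^sub>M S)" using \<omega> F(1) sets.sets_into_space by blast
      have cov0: "autocov \<pi> (u h) (\<lambda>_. A) 0 = 0"
      proof -
        have "autocov \<pi> (u h) (\<lambda>_. A) 0 = (\<integral>x. \<integral>\<eta>. u h x * A \<partial>S \<partial>\<pi>)"
          using u_meas[OF h] uA[OF h] A by (subst autocov_iterated[OF inv, where A = A and A' = A]) auto
        also have "\<dots> = 0"
        proof -
          have "integrable \<pi> h"
            using bd[OF h] meas[OF h] inv by (intro pi.integrable_const_bound[of _ B] AE_I2)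
              (auto simp: spi invariant_def cong: measurable_cong_sets)
          then show ?thesis by (simp add: P.prob_space u_def c_def pi.prob_space)
        qed
        finally show ?thesis .
      qed
      have "\<bar>emp_autocov n (orbit stp (fst \<omega>) (snd \<omega>)) h j - autocov \<pi> (u h) (u h) j\<bar> \<le> 4 * T / n"
      proof (rule emp_autocov_approx[where c = "c h" and A = A])
        show "\<bar>h (orbit stp (fst \<omega>) (snd \<omega>) k) - c h\<bar> \<le> A" for k
          using uA[OF h orb[OF \<omega>']] by (simp add: u_def)
        show "\<bar>(\<Sum>k<n - j. (h (orbit stp (fst \<omega>) (snd \<omega>) k) - c h) * (h (orbit stp (fst \<omega>) (snd \<omega>) (k + j)) - c h))
            - n * autocov \<pi> (u h) (u h) j\<bar> \<le> T"
          using est[OF \<omega>, of "(h, j)"] h j by (simp add: I_def U_def V_def lag_def u_def[abs_def])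
        show "\<bar>\<Sum>k<n. (h (orbit stp (fst \<omega>) (snd \<omega>) k) - c h) * A\<bar> \<le> T"
          using est[OF \<omega>, of "(h, b)"] h cov0 by (simp add: I_def U_def V_def lag_def u_def[abs_def])
      qed (use n in simp)
      with T show "\<bar>emp_autocov n (orbit stp (fst \<omega>) (snd \<omega>)) h j
          - autocov \<pi> (\<lambda>x. h x - (\<integral>y. h y \<partial>\<pi>)) (\<lambda>x. h x - (\<integral>y. h y \<partial>\<pi>)) j\<bar>
        \<le> 4 * B\<^sup>2 * (208 + 64 * \<mu> * (C0 + K0)) * (ln n * E / q / sqrt n)"
        unfolding goal_eq by (simp add: u_def[abs_def] c_def)
    qed
  qed
qed

end

section \<open>Excess variance of the empirical minimiser\<close>

text \<open>By \<open>ln x \<le> x - 1\<close> the rate \<open>ln (1 / \<rho>)\<close> is at least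
  \<open>1 - \<rho>\<close>, hence at least \<open>q / 2\<close>. Half the bandwidth is already
  enough for \<open>\<rho> ^ b0\<close> to fall below \<open>1 / n\<close>.\<close>

lemma truncation_bounds:
  fixes mU \<gamma> :: real and n :: nat
  assumes b: "0 < mU" "0 < \<gamma>" "mU * \<gamma> < 1" and n: "2 \<le> n"
  defines "b0 \<equiv> nat \<lceil>ln (real n) / ln (1 / Delta1 \<gamma> mU)\<rceil>"
  shows "1 \<le> b0" "real (2 * b0) \<le> 8 * (ln n / (mU * \<gamma>))" "Delta1 \<gamma> mU ^ b0 \<le> 1 / n"
    "mU * \<gamma> / 2 \<le> ln (1 / Delta1 \<gamma> mU)"
proof -
  let ?\<rho> = "Delta1 \<gamma> mU" and ?q = "mU * \<gamma>"
  note \<Delta> = Delta1_bounds[OF b]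
  have q: "0 < ?q" using b by simp
  have l: "1 / 2 \<le> ln (real n)" by (rule ln_nat_ge_half[OF n])
  have "ln ?\<rho> \<le> ?\<rho> - 1" using \<Delta> by (intro ln_le_minus_one)
  then show \<Lambda>: "?q / 2 \<le> ln (1 / ?\<rho>)" using \<Delta> by (simp add: ln_div)
  have "0 < ln (real n) / ln (1 / ?\<rho>)" using l q \<Lambda> by (intro divide_pos_pos) auto
  then show "1 \<le> b0" by (simp add: b0_def Suc_le_eq)
  note p = power_ceiling_le_exp[OF \<Delta>(1,2) _ q \<Lambda>, of "ln (real n)", folded b0_def]
  show "?\<rho> ^ b0 \<le> 1 / n" using p(1) l n by (simp add: exp_minus inverse_eq_divide)
  have "ln (real n) \<le> ln (real n) / ?q" using l q b by (intro le_divide_less_one) auto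
  moreover have "real b0 \<le> 2 * (ln (real n) / ?q) + 1" using p(2) l by simp
  moreover have "b \<le> 4 * y" if "a \<le> y" "b \<le> 2 * y + 1" "1 / 2 \<le> a" for a b y :: real
    using that by linarith
  ultimately have "real b0 \<le> 4 * (ln (real n) / ?q)" using l by blast
  then show "real (2 * b0) \<le> 8 * (ln n / ?q)" by simp
qed

text \<open>The signs of \<open>L\<close> and \<open>B\<close> are consequences of the class having
  a member: two states with distinct positions and the same batch have positive distance.\<close>

lemma Lip_b_nonneg:
  assumes h: "h \<in> Lip_b d K M L B" and M: "M \<in> {1..K}" and d: "1 \<le> d"
  shows "0 \<le> L" "0 \<le> B"
proof -
  let ?x = "state0 d M" and ?y = "((\<lambda>i\<in>{..<d}. 1, {1..M}) :: state)"
  have x: "?x \<in> space (state_space d K M)" by (rule state0_space[OF M])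
  have y: "?y \<in> space (state_space d K M)" using M by (auto simp: space_state_space rvec_def batches_def)
  have "(vdist d (fst ?x) (fst ?y))\<^sup>2 = real d" by (simp add: vdist_power2 state0_def)
  then have "vdist d (fst ?x) (fst ?y) \<noteq> 0" using d by auto
  then have pos: "0 < dX d ?x ?y" by (simp add: dX_def state0_def less_le)
  have "0 \<le> \<bar>h ?x - h ?y\<bar>" by simp
  also have "\<dots> \<le> L * dX d ?x ?y" using h x y unfolding Lip_b_def by blast
  finally show "0 \<le> L" using pos by (simp add: zero_le_mult_iff)
  have "\<bar>h ?x\<bar> \<le> B" using h x unfolding Lip_b_def by blast
  then show "0 \<le> B" by linarith
qed

text \<open>
  This constant does not involve \<open>\<gamma>\<close>: \<open>LU\<close> and \<open>mU\<close> may be any admissible pair for \<open>U\<close>, not only the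
  one of the theorem, and \<open>1 / mU\<close> is then an upper bound for every admissible step size.
\<close>

definition rate_const ::
    "nat \<Rightarrow> nat \<Rightarrow> nat \<Rightarrow> (nat \<Rightarrow> vec \<Rightarrow> real) \<Rightarrow> real \<Rightarrow> real \<Rightarrow> state measure \<Rightarrow> real" where
  "rate_const d K M U LU mU \<xi> = 256 * (208 + 64 * sqrt (LU * (real K + 1)) *
     ((enn2real (\<integral>\<^sup>+x. ennreal (dX d x (state0 d M)) \<partial>\<xi>) + 1) + drift_const d K M U (1 / mU)))"

lemma drift_const_mono: "0 \<le> \<gamma> \<Longrightarrow> \<gamma> \<le> \<gamma>' \<Longrightarrow> drift_const d K M U \<gamma> \<le> drift_const d K M U \<gamma>'"
  unfolding drift_const_def by (intro add_mono mult_right_mono sum_nonneg) auto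

text \<open>Here \<open>16 * (l / q)\<close> bounds twice the bandwidth. The deviation grows like
  \<open>l\<^sup>2 / q\<^sup>2\<close>; since \<open>l\<close> is at least 1/2 and \<open>q\<close>
  is below 1, this is dominated by the powers of \<open>l\<close> and \<open>q\<close> in the
  theorem.\<close>

lemma rate_term_le:
  fixes q B R E l n :: real
  assumes q: "0 < q" "q < 1" and l: "1 / 2 \<le> l" and n: "0 < n" and R: "0 \<le> R" and E: "0 \<le> E"
  shows "16 * (l / q) * (B\<^sup>2 * R / 64 * (l * E / q / sqrt n)) \<le> B\<^sup>2 * R / q powr (4 + 2 / l) * sqrt (l ^ 5 / n) * E"
proof -
  have l0: "0 < l" using l by linarith
  have "l\<^sup>2 \<le> 2 * sqrt (l ^ 5)"
  proof -
    have "l\<^sup>2 = sqrt (l ^ 4)" using l0 by (simp add: real_sqrt_unique[symmetric] power_mult[symmetric])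
    also have "\<dots> \<le> sqrt (2\<^sup>2 * l ^ 5)"
    proof (rule real_sqrt_le_mono)
      have "1 * l ^ 4 \<le> (4 * l) * l ^ 4" using l by (intro mult_right_mono) auto
      then show "l ^ 4 \<le> 2\<^sup>2 * l ^ 5" by (simp add: eval_nat_numeral mult_ac)
    qed
    also have "\<dots> = 2 * sqrt (l ^ 5)" by (simp add: real_sqrt_mult)
    finally show ?thesis .
  qed
  then have ll: "l\<^sup>2 / sqrt n \<le> 2 * sqrt (l ^ 5 / n)"
    using n by (simp add: real_sqrt_divide divide_right_mono)
  have "q powr (4 + 2 / l) \<le> q powr 2"
    using q l0 by (intro powr_mono') auto
  then have qq: "1 / q\<^sup>2 \<le> 1 / q powr (4 + 2 / l)"
    using q by (intro divide_left_mono) (auto simp: powr_numeral)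
  have "16 * (l / q) * (B\<^sup>2 * R / 64 * (l * E / q / sqrt n)) = B\<^sup>2 * R * (1 / q\<^sup>2) * (l\<^sup>2 / sqrt n / 4) * E"
    by (simp add: power2_eq_square mult_ac)
  also have "\<dots> \<le> B\<^sup>2 * R * (1 / q powr (4 + 2 / l)) * sqrt (l ^ 5 / n) * E"
  proof (intro mult_right_mono mult_mono mult_left_mono qq)
    have "a / 4 \<le> b" if "0 \<le> b" "a \<le> 2 * b" for a b :: real using that by linarith
    moreover have "0 \<le> sqrt (l ^ 5 / n)" using l0 n by simp
    ultimately show "l\<^sup>2 / sqrt n / 4 \<le> sqrt (l ^ 5 / n)" using ll by blast
  qed (use R E q l0 n in auto)
  finally show ?thesis by simp
qed

text \<open>The comparison runs from \<open>V\<close> at the minimiser to its spectral estimate, by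
  minimality to the estimate at a net point near \<open>h\<close>, to \<open>V\<close> there, and to
  \<open>V h\<close>. Concentration is needed only for net functions, whence the cardinality in the
  bound. The pair \<open>LU0\<close>, \<open>mU0\<close> feeds the constant, \<open>LU\<close> and
  \<open>mU\<close> the rate and the step size. The sign facts and non-emptiness are returned too,
  for the passage to the infimum.\<close>

lemma sgld_excess_variance:
  fixes d K M n :: nat and U :: "nat \<Rightarrow> vec \<Rightarrow> real" and \<epsilon> \<delta> :: real
  assumes d: "1 \<le> d" and M: "M \<in> {1..K}" and cond0: "sgld_condition d K U LU0 mU0"
    and cond: "sgld_condition d K U LU mU"
    and \<gamma>: "\<gamma> \<in> {0<..<inverse LU * inverse (real K + 1)}"
    and xi: "\<xi> \<in> S1 d K M" and inv: "sgld_invariant d K M U \<gamma> \<pi>" and w: "lag_window w"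
    and H: "H \<subseteq> Lip_b d K M L B" and mean: "\<And>h. h \<in> H \<Longrightarrow> (\<integral>x. h x \<partial>\<pi>) = c"
    and n: "2 \<le> n" and \<epsilon>: "0 < \<epsilon>" and \<delta>: "\<delta> \<in> {0<..<1}" and net: "is_net \<pi> \<epsilon> H N"
    and argmin: "\<And>\<omega>. \<omega> \<in> space (sgld_space d K M \<xi>) \<Longrightarrow>
        is_arg_min (spectral_variance w (truncation \<gamma> mU n) n (\<lambda>k. sgld_chain d K M U \<gamma> k \<omega>)) (\<lambda>h. h \<in> N) (hhat \<omega>)"
  defines "q \<equiv> mU * \<gamma>" and "V \<equiv> V_inf d K M U \<gamma> \<pi> c" and "Dv \<equiv> const_D \<pi> H"
    and "\<sigma> \<equiv> const_varsigma d K M L B \<pi>" and "R2 \<equiv> rate_const d K M U LU0 mU0 \<xi>"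
  shows "0 \<le> L" "0 \<le> B" "0 \<le> Dv" "H \<noteq> {}"
    "\<exists>A\<in>sets (sgld_space d K M \<xi>). measure (sgld_space d K M \<xi>) A \<ge> 1 - \<delta> \<and>
      (\<forall>\<omega>\<in>A. \<forall>h\<in>H. V (hhat \<omega>) - V h
        \<le> 100 * (sqrt Dv / q * \<epsilon> * ln n
          + B\<^sup>2 * R2 / q powr (4 + 2 / ln n) * sqrt (ln n ^ 5 / n) * (real (card N) / \<delta>) powr (1 / ln n)
          + \<sigma> / q\<^sup>2 * ln n / n))"
proof -
  note gb = gamma_bounds[OF cond d \<gamma>]
  define \<rho> where "\<rho> = Delta1 \<gamma> mU"
  note \<Delta> = Delta1_bounds[OF gb(3,2,4), folded \<rho>_def q_def]
  have q: "0 < q" "q < 1" using gb by (simp_all add: q_def)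
  define \<kappa> where "\<kappa> = drift_const d K M U \<gamma>"
  have chain: "contractive_chain (sgld_noise d K M) (state_space d K M) (sgld_step d K M U \<gamma>) (dX d) \<rho> \<kappa> (state0 d M)"
    unfolding \<rho>_def \<kappa>_def by (rule sgld_contractive[OF cond M d \<gamma>])
  interpret C: contractive_chain "sgld_noise d K M" "state_space d K M" "sgld_step d K M U \<gamma>" "dX d" \<rho> \<kappa> "state0 d M"
    by (rule chain)
  let ?X = "state_space d K M"
  let ?P = "sgld_space d K M \<xi>"
  have inv': "C.invariant \<pi>" by (rule sgld_invariant_imp_invariant[OF chain inv])
  have pi: "prob_space \<pi>" and sets_pi[measurable_cong]: "sets \<pi> = sets ?X" using inv' by (auto simp: C.invariant_def)
  have spi: "space \<pi> = space ?X" by (rule sets_eq_imp_space_eq[OF sets_pi])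
  interpret pi: prob_space \<pi> by (rule pi)
  have pxi: "prob_space \<xi>" and sets_xi: "sets \<xi> = sets ?X" using xi by (auto simp: S1_def)
  have P_eq: "?P = \<xi> \<Otimes>\<^sub>M C.S" by (rule sgld_space_eq)
  interpret xi: prob_space \<xi> by (rule pxi)
  interpret XS: pair_prob_space \<xi> C.S ..
  interpret P: prob_space ?P unfolding P_eq by (rule XS.P.prob_space_axioms)
  have N: "N \<subseteq> H" "finite N" "\<And>h. h \<in> H \<Longrightarrow> \<exists>g\<in>N. dist_L2 \<pi> h g \<le> \<epsilon>"
    using net by (auto simp: is_net_def)
  have hhat: "hhat \<omega> \<in> N" if "\<omega> \<in> space ?P" for \<omega>
    using argmin[OF that] by (simp add: is_arg_min_def)
  \<comment> \<open>The assumed existence of a minimiser makes the net non-empty.\<close>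
  have Nne: "N \<noteq> {}" using P.not_empty hhat by blast
  then show Hne: "H \<noteq> {}" using N by blast
  then obtain h0 where h0: "h0 \<in> Lip_b d K M L B" using H by blast
  show L: "0 \<le> L" and B: "0 \<le> B" by (rule Lip_b_nonneg[OF h0 M d])+
  have meas: "h \<in> borel_measurable ?X" if "h \<in> H" for h using that H by (auto intro: Lip_b_measurable)
  have bd: "\<bar>h x\<bar> \<le> B" if "h \<in> H" "x \<in> space ?X" for h x using that H unfolding Lip_b_def by blast
  have lip: "\<bar>h x - h y\<bar> \<le> L * dX d x y" if "h \<in> H" "x \<in> space ?X" "y \<in> space ?X" for h x y
    using that H unfolding Lip_b_def by blast
  have cB: "\<bar>c\<bar> \<le> B" if "h \<in> H" for h
    using pi.abs_expectation_le[of h B] bd[OF that] B mean[OF that] by (simp add: spi)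
  define u where "u h x = h x - c" for h :: "state \<Rightarrow> real" and x
  have u_meas[measurable]: "u h \<in> borel_measurable ?X" if "h \<in> H" for h
    unfolding u_def using meas[OF that] by measurable
  have uB: "\<bar>u h x\<bar> \<le> 2 * B" if "h \<in> H" "x \<in> space ?X" for h x
    using bd[OF that] cB[OF that(1)] by (simp add: u_def)
  have ulip: "\<bar>u h x - u h y\<bar> \<le> L * dX d x y" if "h \<in> H" "x \<in> space ?X" "y \<in> space ?X" for h x y
    using lip[OF that] by (simp add: u_def)
  have int_h: "integrable \<pi> h" if "h \<in> H" for h
    using bd[OF that] meas[OF that] by (intro pi.integrable_const_bound[of _ B] AE_I2) (auto simp: spi)
  have u0: "(\<integral>x. u h x \<partial>\<pi>) = 0" if "h \<in> H" for h
    using int_h[OF that] mean[OF that] by (simp add: u_def pi.prob_space)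
  define W where "W = mean_W1 d K M \<pi>"
  have W: "0 \<le> W" by (simp add: W_def mean_W1_nonneg)
  have \<sigma>_eq: "\<sigma> = 2 * B * L * W" by (simp add: \<sigma>_def const_varsigma_def W_def)
  have \<sigma>0: "0 \<le> \<sigma>" using B L W by (simp add: \<sigma>_eq)
  define cov where "cov h = C.autocov \<pi> (u h) (u h)" for h
  have V_eq: "V h = (\<Sum>\<^sub>\<infinity>l\<in>(UNIV::int set). cov h (nat \<bar>l\<bar>))" for h
    by (simp add: V_def V_inf_def cov_def C.autocov_def u_def sgld_chain_orbit sgld_space_eq)
  have cov_le: "\<bar>cov h l\<bar> \<le> \<sigma> * \<rho> ^ l" if "h \<in> H" for h l
    unfolding cov_def \<sigma>_eq using that uB ulip L u0 W mean_W1_eq[OF chain inv']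
    by (intro C.autocov_decay[OF inv']) (auto simp: W_def)
  have cov_B: "\<bar>cov h l\<bar> \<le> 4 * B\<^sup>2" if "h \<in> H" for h l
    using C.abs_autocov_le[OF inv' uB[OF that] uB[OF that], where l = l] by (simp add: cov_def power_mult_distrib)
  have var_eq: "var \<pi> h = (\<integral>x. (u h x)\<^sup>2 \<partial>\<pi>)" if "h \<in> H" for h
    by (simp add: var_def u_def mean[OF that])
  have bdd: "bdd_above (var \<pi> ` H)"
  proof (rule bdd_aboveI2)
    fix h assume h: "h \<in> H"
    have "\<bar>(u h x)\<^sup>2\<bar> \<le> (2 * B)\<^sup>2" if "x \<in> space \<pi>" for x
      using power_mono[OF uB[OF h], of x 2] that by (simp add: spi)
    then have "\<bar>\<integral>x. (u h x)\<^sup>2 \<partial>\<pi>\<bar> \<le> (2 * B)\<^sup>2" by (rule pi.abs_expectation_le) auto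
    then show "var \<pi> h \<le> (2 * B)\<^sup>2" by (simp add: var_eq[OF h])
  qed
  have varD: "(\<integral>x. (u h x)\<^sup>2 \<partial>\<pi>) \<le> Dv" if "h \<in> H" for h
    unfolding Dv_def const_D_def var_eq[OF that, symmetric] using that bdd by (rule cSUP_upper)
  have "0 \<le> (\<integral>x. (u h x)\<^sup>2 \<partial>\<pi>)" for h by simp
  then show D0: "0 \<le> Dv" using Hne varD by (meson all_not_in_conv order_trans)
  define l where "l = ln (real n)"
  have l: "1 / 2 \<le> l" using ln_nat_ge_half[OF n] by (simp add: l_def)
  define b0 where "b0 = nat \<lceil>ln (real n) / ln (1 / \<rho>)\<rceil>"
  define b where "b = 2 * b0"
  note tb = truncation_bounds[OF gb(3,2,4) n, folded \<rho>_def q_def, folded b0_def, folded b_def l_def]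
  have trunc: "truncation \<gamma> mU n = 2 * b0" by (simp add: truncation_def b0_def \<rho>_def)
  define X4 X5 X6 where "X4 = sqrt Dv / q * \<epsilon> * l"
    and "X5 = B\<^sup>2 * R2 / q powr (4 + 2 / l) * sqrt (l ^ 5 / n) * (real (card N) / \<delta>) powr (1 / l)"
    and "X6 = \<sigma> / q\<^sup>2 * l / n"
  have R2: "0 \<le> R2"
  proof -
    have "0 < mU0" "0 < LU0 * (real K + 1)"
      using sgld_mU_le[OF cond0 cond0 d] cond0 by (auto simp: sgld_condition_def)
    then show ?thesis unfolding R2_def rate_const_def
      by (intro mult_nonneg_nonneg add_nonneg_nonneg drift_const_nonneg) auto
  qed
  have X0: "0 \<le> X4" "0 \<le> X5" "0 \<le> X6"
    using q D0 \<epsilon> l n R2 \<sigma>0 by (auto simp: X4_def X5_def X6_def)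
  have sqn: "\<sigma> / (q * n) \<le> 2 * X6" "\<sigma> * l / (q * n) \<le> X6"
  proof -
    have "1 / q \<le> 1 / q / q" using q by (intro le_divide_less_one) auto
    then have "(\<sigma> * l / n) * (1 / q) \<le> (\<sigma> * l / n) * (1 / q / q)" using \<sigma>0 l by (intro mult_left_mono) auto
    then show 2: "\<sigma> * l / (q * n) \<le> X6" by (simp add: X6_def power2_eq_square mult_ac)
    have "\<sigma> / (q * n) * 1 \<le> \<sigma> / (q * n) * (2 * l)" using \<sigma>0 q l by (intro mult_left_mono) auto
    also have "\<dots> = 2 * (\<sigma> * l / (q * n))" by simp
    also have "\<dots> \<le> 2 * X6" using 2 by (rule mult_left_mono) simp
    finally show "\<sigma> / (q * n) \<le> 2 * X6" by (simp only: mult_1_right)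
  qed
  \<comment> \<open>From half the bandwidth on, \<open>\<rho> ^ m\<close> is at most
    \<open>1 / n\<close>, and \<open>1 / (1 - \<rho>)\<close> is at most
    \<open>2 / q\<close>.\<close>
  have tail: "\<sigma> * \<rho> ^ m / (1 - \<rho>) \<le> 4 * X6" if "b0 \<le> m" for m
  proof -
    have "\<rho> ^ m \<le> 1 / n" by (rule order_trans[OF power_decreasing[OF that] tb(3)]) (use \<Delta> in auto)
    then have "\<sigma> * \<rho> ^ m / (1 - \<rho>) \<le> \<sigma> * (1 / n) / (q / 2)"
      using \<sigma>0 \<Delta> q by (intro frac_le mult_left_mono) auto
    also have "\<dots> = 2 * (\<sigma> / (q * n))" by (simp add: mult_ac)
    also have "\<dots> \<le> 2 * (2 * X6)" using sqn(1) by (rule mult_left_mono) simp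
    finally show ?thesis by simp
  qed
  \<comment> \<open>Cauchy-Schwarz does not decay in the lag, so it is used only below the
    bandwidth, at a cost of order \<epsilon> per lag; the remaining lags are handled by
    mixing.\<close>
  have V_diff: "V g - V h \<le> 32 * X4 + 16 * X6" if h: "h \<in> H" and g: "g \<in> H" and hg: "dist_L2 \<pi> h g \<le> \<epsilon>" for h g
  proof -
    define a where "a k = cov g k - cov h k" for k
    have a_le: "\<bar>a k\<bar> \<le> (2 * \<sigma>) * \<rho> ^ k" for k
      using cov_le[OF h, of k] cov_le[OF g, of k] by (simp add: a_def)
    have a_small: "\<bar>a k\<bar> \<le> 2 * \<epsilon> * sqrt Dv" for k
    proof -
      have "\<bar>a k\<bar> \<le> sqrt (\<integral>x. (u g x - u h x)\<^sup>2 \<partial>\<pi>) * (sqrt (\<integral>x. (u g x)\<^sup>2 \<partial>\<pi>) + sqrt (\<integral>x. (u h x)\<^sup>2 \<partial>\<pi>))"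
        unfolding a_def cov_def using h g uB by (intro C.autocov_diff_le[OF inv', where A = "2 * B"]) auto
      also have "\<dots> \<le> \<epsilon> * (sqrt Dv + sqrt Dv)"
      proof (intro mult_mono add_mono real_sqrt_le_mono varD h g)
        show "sqrt (\<integral>x. (u g x - u h x)\<^sup>2 \<partial>\<pi>) \<le> \<epsilon>"
          using hg by (simp add: dist_L2_def u_def power2_commute)
      qed (use \<epsilon> in auto)
      finally show ?thesis by simp
    qed
    have summable: "(\<lambda>l::int. cov h' (nat \<bar>l\<bar>)) summable_on UNIV" if "h' \<in> H" for h'
      using cov_le[OF that] \<sigma>0 \<Delta> by (intro infsum_int_tail(1)[of \<sigma> \<rho> _ 0]) auto
    have "V g - V h = (\<Sum>\<^sub>\<infinity>l\<in>(UNIV::int set). a (nat \<bar>l\<bar>))"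
      unfolding V_eq a_def diff_conv_add_uminus infsum_uminus[symmetric]
      using summable[OF g] summable[OF h] by (intro infsum_add[symmetric] summable_on_uminus[THEN iffD2])
    moreover have "\<bar>(\<Sum>\<^sub>\<infinity>l\<in>(UNIV::int set). a (nat \<bar>l\<bar>)) - (\<Sum>l\<in>{- int b<..<int b}. a (nat \<bar>l\<bar>))\<bar>
        \<le> 2 * (2 * \<sigma>) * \<rho> ^ b / (1 - \<rho>)"
      using \<sigma>0 \<Delta> a_le by (intro infsum_int_approx) auto
    moreover have "\<bar>\<Sum>l\<in>{- int b<..<int b}. a (nat \<bar>l\<bar>)\<bar> \<le> 2 * real b * (2 * \<epsilon> * sqrt Dv)"
      using a_small \<epsilon> D0 by (intro order_trans[OF sum_abs sum_int_interval_le]) auto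
    moreover have "2 * real b * (2 * \<epsilon> * sqrt Dv) \<le> 32 * X4"
    proof -
      have "2 * real b * (2 * \<epsilon> * sqrt Dv) = b * (4 * \<epsilon> * sqrt Dv)" by simp
      also have "\<dots> \<le> (8 * (l / q)) * (4 * \<epsilon> * sqrt Dv)" using tb(2) \<epsilon> D0 by (intro mult_right_mono) auto
      finally show ?thesis by (simp add: X4_def mult_ac)
    qed
    moreover have "2 * (2 * \<sigma>) * \<rho> ^ b / (1 - \<rho>) \<le> 16 * X6" using tail[of b] by (simp add: b_def)
    ultimately show ?thesis by linarith
  qed
  have goal: "\<exists>A\<in>sets ?P. measure ?P A \<ge> 1 - \<delta> \<and> (\<forall>\<omega>\<in>A. \<forall>h\<in>H. V (hhat \<omega>) - V h \<le> 100 * (X4 + X5 + X6))"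
  proof (cases "B * n \<le> L * sqrt \<gamma>")
    case True
    \<comment> \<open>Here \<open>sqrt \<gamma> \<le> W\<close> yields
      \<open>2 * B\<^sup>2 \<le> \<sigma> / n\<close>. Every variance in the class is then of the
      order of the last error term, and the whole space serves as the event.\<close>
    have "B * B \<le> B * (L * W / n)"
    proof (rule mult_left_mono[OF _ B])
      have "sqrt \<gamma> \<le> W" unfolding W_def using cond
        by (intro sqrt_gamma_le_mean_W1[OF M d gb(2) _ chain inv']) (simp add: sgld_condition_def)
      then have "L * sqrt \<gamma> \<le> L * W" using L by (intro mult_left_mono)
      then show "B \<le> L * W / n" using True n by (simp add: le_divide_eq)
    qed
    then have "2 * B\<^sup>2 \<le> 2 * (B * (L * W / n))" by (simp add: power2_eq_square)
    also have "\<dots> = \<sigma> / n" by (simp add: \<sigma>_eq mult_ac)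
    finally have B2: "2 * B\<^sup>2 \<le> \<sigma> / n" .
    have Vb: "\<bar>V h\<bar> \<le> 40 * X6" if h: "h \<in> H" for h
    proof -
      have "\<bar>V h - (\<Sum>l\<in>{- int b<..<int b}. cov h (nat \<bar>l\<bar>))\<bar> \<le> 2 * \<sigma> * \<rho> ^ b / (1 - \<rho>)"
        unfolding V_eq using \<sigma>0 \<Delta> cov_le[OF h] by (intro infsum_int_approx) auto
      moreover have "\<bar>\<Sum>l\<in>{- int b<..<int b}. cov h (nat \<bar>l\<bar>)\<bar> \<le> 2 * real b * (4 * B\<^sup>2)"
        using cov_B[OF h] by (intro order_trans[OF sum_abs sum_int_interval_le]) auto
      moreover have "2 * real b * (4 * B\<^sup>2) \<le> 32 * X6"
      proof -
        have "2 * real b * (4 * B\<^sup>2) = b * (4 * (2 * B\<^sup>2))" by simp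
        also have "\<dots> \<le> (8 * (l / q)) * (4 * (\<sigma> / n))" using tb(2) B2 l q by (intro mult_mono) auto
        also have "\<dots> = 32 * (\<sigma> * l / (q * n))" by simp
        also have "\<dots> \<le> 32 * X6" using sqn(2) by (rule mult_left_mono) simp
        finally show ?thesis .
      qed
      moreover have "2 * \<sigma> * \<rho> ^ b / (1 - \<rho>) \<le> 8 * X6" using tail[of b] by (simp add: b_def)
      ultimately show ?thesis by linarith
    qed
    show ?thesis
    proof (intro bexI[of _ "space ?P"] conjI ballI)
      fix \<omega> h assume "\<omega> \<in> space ?P" "h \<in> H"
      then have "\<bar>V (hhat \<omega>)\<bar> \<le> 40 * X6" "\<bar>V h\<bar> \<le> 40 * X6" using Vb[OF subsetD[OF N(1) hhat]] Vb by simp_all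
      moreover have "a - b \<le> 100 * (y + z + x)"
        if "\<bar>a\<bar> \<le> 40 * x" "\<bar>b\<bar> \<le> 40 * x" "0 \<le> x" "0 \<le> y" "0 \<le> z" for a b x y z :: real
        unfolding distrib_left using that by linarith
      ultimately show "V (hhat \<omega>) - V h \<le> 100 * (X4 + X5 + X6)" using X0 by blast
    qed (use \<delta> P.prob_space in auto)
  next
    case False
    \<comment> \<open>For \<open>B = 0\<close> the negated case condition would read
      \<open>L * sqrt \<gamma> < 0\<close>.\<close>
    then have Bpos: "0 < B" using B L gb(2) by (cases "B = 0") auto
    \<comment> \<open>The added 1 makes \<open>C0\<close> positive. Finiteness of the moment is the
      condition in \<open>S1\<close> at the point \<open>state0 d M\<close>.\<close>
    define C0 K0 \<mu> where "C0 = enn2real (\<integral>\<^sup>+x. ennreal (dX d x (state0 d M)) \<partial>\<xi>) + 1"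
      and "K0 = drift_const d K M U (1 / mU0)" and "\<mu> = sqrt (LU0 * (real K + 1))"
    have R2_eq: "R2 = 256 * (208 + 64 * \<mu> * (C0 + K0))"
      by (simp add: R2_def rate_const_def C0_def K0_def \<mu>_def)
    have C0: "(\<integral>\<^sup>+x. ennreal (dX d x (state0 d M)) \<partial>\<xi>) \<le> ennreal C0" "0 < C0"
    proof -
      have "(\<integral>\<^sup>+x. ennreal (dX d x (state0 d M)) \<partial>\<xi>) < top"
        using xi state0_space[OF M, of d] by (auto simp: S1_def dX_commute[of d _ "state0 d M"])
      then show "(\<integral>\<^sup>+x. ennreal (dX d x (state0 d M)) \<partial>\<xi>) \<le> ennreal C0"
        unfolding C0_def by (subst ennreal_plus) (auto simp: ennreal_enn2real_if intro: add_increasing2)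
      show "0 < C0" unfolding C0_def by (intro add_nonneg_pos) auto
    qed
    have mU0: "0 < mU0" using cond0 by (simp add: sgld_condition_def)
    \<comment> \<open>This makes the drift constant uniform in the step size: it is monotone, and
      \<open>1 / mU0\<close> is known before \<gamma>.\<close>
    have "\<gamma> \<le> 1 / mU0" using gb(5)[OF cond0] mU0 by (simp add: le_divide_eq mult.commute)
    then have K0: "\<kappa> \<le> K0" unfolding \<kappa>_def K0_def using gb(2) by (intro drift_const_mono) auto
    \<comment> \<open>Since \<open>q < 1\<close>, its square is at most \<open>q\<close>, which is
      at most \<open>LU0 * (real K + 1) * \<gamma>\<close>; the root of the latter is
      \<open>\<mu> * sqrt \<gamma>\<close>.\<close>
    have q\<mu>: "q \<le> \<mu> * sqrt \<gamma>"
    proof -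
      have "q * q \<le> q * 1" using q by (intro mult_left_mono) auto
      also have "\<dots> \<le> (LU0 * (real K + 1)) * \<gamma>"
        unfolding q_def using sgld_mU_le[OF cond cond0 d] gb(2) by simp
      finally have "q \<le> sqrt ((LU0 * (real K + 1)) * \<gamma>)" by (intro real_le_rsqrt) (simp add: power2_eq_square)
      then show ?thesis by (simp add: \<mu>_def real_sqrt_mult)
    qed
    define E where "E = (real (card N) / \<delta>) powr (1 / l)"
    define \<tau> where "\<tau> = 4 * B\<^sup>2 * (208 + 64 * \<mu> * (C0 + K0)) * (l * E / q / sqrt n)"
    have "\<exists>A\<in>sets (\<xi> \<Otimes>\<^sub>M C.S). measure (\<xi> \<Otimes>\<^sub>M C.S) A \<ge> 1 - \<delta> \<and> (\<forall>\<omega>\<in>A. \<forall>h\<in>N. \<forall>j<b.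
      \<bar>emp_autocov n (orbit (sgld_step d K M U \<gamma>) (fst \<omega>) (snd \<omega>)) h j
         - C.autocov \<pi> (\<lambda>x. h x - (\<integral>y. h y \<partial>\<pi>)) (\<lambda>x. h x - (\<integral>y. h y \<partial>\<pi>)) j\<bar> \<le> \<tau>)"
      unfolding \<tau>_def E_def l_def
    proof (rule C.autocov_concentration[where \<sigma> = "sqrt \<gamma>" and L = L, OF pxi sets_xi C0 inv' N(2) Nne])
      show "L * sqrt \<gamma> \<le> B * real n" using False by simp
      show "real b \<le> 8 * (ln (real n) / q)" using tb(2) by (simp add: l_def)
      show "1 \<le> b" using tb(1) by (simp add: b_def)
    qed (use N(1) meas bd lip L Bpos \<Delta> q tb(4) gb(2) q\<mu> K0 n \<delta> in auto)
    then obtain A where A: "A \<in> sets ?P" "measure ?P A \<ge> 1 - \<delta>"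
      and close: "\<And>\<omega> h j. \<omega> \<in> A \<Longrightarrow> h \<in> N \<Longrightarrow> j < b \<Longrightarrow>
        \<bar>emp_autocov n (orbit (sgld_step d K M U \<gamma>) (fst \<omega>) (snd \<omega>)) h j
         - C.autocov \<pi> (\<lambda>x. h x - (\<integral>y. h y \<partial>\<pi>)) (\<lambda>x. h x - (\<integral>y. h y \<partial>\<pi>)) j\<bar> \<le> \<tau>"
      unfolding P_eq by blast
    have E0: "0 \<le> E" by (simp add: E_def)
    have \<tau>_eq: "\<tau> = B\<^sup>2 * R2 / 64 * (l * E / q / sqrt n)"
    proof -
      have "B\<^sup>2 * (256 * z) / 64 = 4 * B\<^sup>2 * z" for z by simp
      then show ?thesis by (simp only: \<tau>_def R2_eq)
    qed
    have \<tau>0: "0 \<le> \<tau>" unfolding \<tau>_eq using R2 E0 l q by (intro mult_nonneg_nonneg divide_nonneg_nonneg) auto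
    have \<tau>5: "2 * real b * \<tau> \<le> 2 * X5"
    proof -
      have "b * \<tau> \<le> 8 * (l / q) * \<tau>" using tb(2) \<tau>0 by (intro mult_right_mono) auto
      moreover have "16 * (l / q) * \<tau> \<le> X5"
        unfolding \<tau>_eq X5_def E_def[symmetric] using q l n R2 E0 by (intro rate_term_le) auto
      ultimately show ?thesis using X0 by simp
    qed
    show ?thesis
    proof (intro bexI[OF _ A(1)] conjI ballI A(2))
      fix \<omega> h assume \<omega>: "\<omega> \<in> A" and h: "h \<in> H"
      have \<omega>': "\<omega> \<in> space ?P" using \<omega> A(1) sets.sets_into_space by blast
      let ?x = "\<lambda>k. sgld_chain d K M U \<gamma> k \<omega>"
      let ?V = "spectral_variance w (2 * b0) n ?x"
      have sv: "\<bar>?V g - V g\<bar> \<le> 2 * X5 + 8 * X6" if g: "g \<in> N" for g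
      proof -
        have gH: "g \<in> H" using g N by auto
        have "\<bar>?V g - V g\<bar> \<le> 2 * (2 * real b0) * \<tau> + 2 * \<sigma> * \<rho> ^ b0 / (1 - \<rho>)"
          unfolding V_eq
        proof (rule spectral_variance_approx[OF \<sigma>0 _ _ w cov_le[OF gH] _ \<tau>0])
          fix j assume "j < 2 * b0"
          then show "\<bar>emp_autocov n ?x g j - cov g j\<bar> \<le> \<tau>"
            using close[OF \<omega> g, of j] by (simp add: sgld_chain_orbit cov_def u_def[abs_def] mean[OF gH] b_def)
        qed (use \<Delta> in auto)
        moreover have "2 * \<sigma> * \<rho> ^ b0 / (1 - \<rho>) \<le> 8 * X6" using tail[of b0] by simp
        moreover have "2 * (2 * real b0) * \<tau> \<le> 2 * X5" using \<tau>5 by (simp add: b_def)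
        ultimately show ?thesis by linarith
      qed
      obtain g where g: "g \<in> N" "dist_L2 \<pi> h g \<le> \<epsilon>" using N(3)[OF h] by blast
      have "?V (hhat \<omega>) \<le> ?V g"
        using argmin[OF \<omega>'] g(1) unfolding is_arg_min_def trunc by (auto simp: not_less)
      moreover have "V g - V h \<le> 32 * X4 + 16 * X6" using V_diff[OF h _ g(2)] g(1) N by auto
      moreover have "vh - v \<le> 100 * (x4 + x5 + x6)"
        if "\<bar>sg - vg\<bar> \<le> 2 * x5 + 8 * x6" "\<bar>sh - vh\<bar> \<le> 2 * x5 + 8 * x6" "sh \<le> sg" "vg - v \<le> 32 * x4 + 16 * x6"
          "0 \<le> x4" "0 \<le> x5" "0 \<le> x6" for sg vg sh vh v x4 x5 x6 :: real
        unfolding distrib_left using that by linarith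
      ultimately show "V (hhat \<omega>) - V h \<le> 100 * (X4 + X5 + X6)"
        using sv[OF g(1)] sv[OF hhat[OF \<omega>']] X0 by blast
    qed
  qed
  then show "\<exists>A\<in>sets ?P. measure ?P A \<ge> 1 - \<delta> \<and>
      (\<forall>\<omega>\<in>A. \<forall>h\<in>H. V (hhat \<omega>) - V h
        \<le> 100 * (sqrt Dv / q * \<epsilon> * ln n
          + B\<^sup>2 * R2 / q powr (4 + 2 / ln n) * sqrt (ln n ^ 5 / n) * (real (card N) / \<delta>) powr (1 / ln n)
          + \<sigma> / q\<^sup>2 * ln n / n))"
    unfolding X4_def X5_def X6_def l_def .
qed

text \<open>\<open>sqrt\<close> is an odd function on the reals, so the signs of the terms with
  \<open>R\<close> in the bound have to be checked.\<close>

lemma const_R_nonneg: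
  assumes "0 \<le> L" "0 \<le> B" "0 < mU" "0 < \<gamma>" "mU * \<gamma> < 1"
  shows "0 \<le> const_R d K M \<gamma> mU L B \<xi> \<pi>"
proof -
  have "sqrt (Delta1 \<gamma> mU) \<le> 1" using Delta1_bounds[OF assms(3-5)] by simp
  moreover have "0 \<le> W1 d \<xi> \<pi>" by (simp add: W1_def)
  ultimately show ?thesis
    unfolding const_R_def using assms(1,2) mean_W1_nonneg[of d K M \<pi>]
    by (intro mult_nonneg_nonneg divide_nonneg_nonneg add_nonneg_nonneg) auto
qed

theorem theorem3p7:
  shows "\<exists>c::real. c > 0 \<and>
    (\<forall>(d::nat) (K::nat) (M::nat) (U :: nat \<Rightarrow> vec \<Rightarrow> real).
      d \<ge> 1 \<longrightarrow> M \<in> {1..K} \<longrightarrow>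
      (\<exists>(R1 :: real \<Rightarrow> state measure \<Rightarrow> real) (R2 :: real \<Rightarrow> state measure \<Rightarrow> real).
        \<forall>(LU::real) (mU::real) (\<gamma>::real) (L::real) (B::real)
         (\<xi> :: state measure) (\<pi> :: state measure) (w :: real \<Rightarrow> real)
         (f :: vec \<Rightarrow> real) (G :: (state \<Rightarrow> real) set) (H :: (state \<Rightarrow> real) set).
          sgld_condition d K U LU mU \<longrightarrow>
          \<gamma> \<in> {0<..<inverse LU * inverse (real K + 1)} \<longrightarrow>
          \<xi> \<in> S1 d K M \<longrightarrow>
          sgld_invariant d K M U \<gamma> \<pi> \<longrightarrow>
          lag_window w \<longrightarrow>
          (\<forall>g\<in>G. integrable \<pi> g \<and> (\<integral>x. g x \<partial>\<pi>) = 0) \<longrightarrow>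
          H = (\<lambda>g x. f (fst x) - g x) ` G \<longrightarrow>
          H \<subseteq> Lip_b d K M L B \<longrightarrow>
          totally_bounded_L2 \<pi> H \<longrightarrow>
          (\<forall>(n::nat) (\<epsilon>::real) (\<delta>::real) (H\<epsilon> :: (state \<Rightarrow> real) set)
            (hhat :: outcome \<Rightarrow> state \<Rightarrow> real).
            n \<ge> 2 \<longrightarrow> \<epsilon> > 0 \<longrightarrow> \<delta> \<in> {0<..<1} \<longrightarrow>
            minimal_net \<pi> \<epsilon> H H\<epsilon> \<longrightarrow>
            (\<forall>\<omega>\<in>space (sgld_space d K M \<xi>).
               is_arg_min
                 (spectral_variance w (truncation \<gamma> mU n) n (\<lambda>k. sgld_chain d K M U \<gamma> k \<omega>))
                 (\<lambda>h. h \<in> H\<epsilon>) (hhat \<omega>)) \<longrightarrow>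
            (let R = const_R d K M \<gamma> mU L B \<xi> \<pi>;
                 D = const_D \<pi> H;
                 \<sigma> = const_varsigma d K M L B \<pi>;
                 C4 = (sqrt R + sqrt D) / (mU * \<gamma>);
                 C5 = B\<^sup>2 * R1 L \<xi> / (mU * \<gamma>)\<^sup>2
                      + B\<^sup>2 * R2 L \<xi> / (mU * \<gamma>) powr (4 + 2 / ln (real n))
                      + sqrt (R * D) / (mU * \<gamma>);
                 C6 = (D * (mU * \<gamma>) + \<sigma>) / (mU * \<gamma>)\<^sup>2;
                 V = V_inf d K M U \<gamma> \<pi> (\<integral>x. f (fst x) \<partial>\<pi>)
             in \<exists>A\<in>sets (sgld_space d K M \<xi>).
                  measure (sgld_space d K M \<xi>) A \<ge> 1 - \<delta> \<and>
                  (\<forall>\<omega>\<in>A. V (hhat \<omega>) - (INF h\<in>H. V h)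
                     \<le> c * (C4 * \<epsilon> * ln (real n)
                            + C5 * sqrt (ln (real n) ^ 5 / real n)
                                 * (real (card H\<epsilon>) / \<delta>) powr (1 / ln (real n))
                            + C6 * ln (real n) / real n))))))"
proof (intro exI[of _ 100] conjI allI impI, simp, goal_cases)
  case (1 d K M U)
  then have d: "d \<ge> 1" and M: "M \<in> {1..K}" by simp_all
  \<comment> \<open>If no pair is admissible for \<open>U\<close> the implication is vacuous and any
    numbers will do. The pair is chosen before \<open>LU\<close>, \<open>mU\<close> and \<gamma> are
    introduced.\<close>
  obtain LU0 mU0 where cond0: "\<And>LU mU. sgld_condition d K U LU mU \<Longrightarrow> sgld_condition d K U LU0 mU0"
    by blast
  show ?case
  \<comment> \<open>The deviation is carried entirely by the second summand of \<open>C5\<close>,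
    with a constant independent of \<open>L\<close>.\<close>
  proof (rule exI[of _ "\<lambda>_ _. 0"], rule exI[of _ "\<lambda>_. rate_const d K M U LU0 mU0"], intro allI impI, goal_cases)
    case (1 LU mU \<gamma> L B \<xi> \<pi> w f G H n \<epsilon> \<delta> H\<epsilon> hhat)
    note cond = 1(1) and \<gamma> = 1(2) and xi = 1(3) and inv = 1(4) and w = 1(5) and G = 1(6) and H_def = 1(7)
      and H = 1(8) and n = 1(10) and \<epsilon> = 1(11) and \<delta> = 1(12) and net = 1(13) and argmin = 1(14)
    note gb = gamma_bounds[OF cond d \<gamma>]
    define c where "c = (\<integral>x. f (fst x) \<partial>\<pi>)"
    \<comment> \<open>Integrability of \<open>f\<close> is not given; but
      \<open>f (fst x) = h x + g x\<close>, where \<open>h\<close> is bounded and measurable and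
      \<open>g\<close> is integrable with mean 0.\<close>
    have mean: "(\<integral>x. h x \<partial>\<pi>) = c" if h: "h \<in> H" for h
    proof -
      interpret pi: prob_space \<pi> using inv by (simp add: sgld_invariant_def)
      have sets[measurable_cong]: "sets \<pi> = sets (state_space d K M)" using inv by (simp add: sgld_invariant_def)
      obtain g where g: "g \<in> G" "h = (\<lambda>x. f (fst x) - g x)" using h H_def by auto
      have hL: "h \<in> Lip_b d K M L B" using h H by blast
      have "\<bar>h x\<bar> \<le> B" if "x \<in> space \<pi>" for x
        using hL that unfolding Lip_b_def sets_eq_imp_space_eq[OF sets] by blast
      then have "integrable \<pi> h" using Lip_b_measurable[OF hL]
        by (intro pi.integrable_const_bound[of _ B] AE_I2) auto
      then have "(\<integral>x. h x + g x \<partial>\<pi>) = (\<integral>x. h x \<partial>\<pi>) + (\<integral>x. g x \<partial>\<pi>)"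
        using G g(1) by (intro Bochner_Integration.integral_add) auto
      then show ?thesis using G g by (simp add: c_def)
    qed
    have net': "is_net \<pi> \<epsilon> H H\<epsilon>" using net by (simp add: minimal_net_def)
    note main = sgld_excess_variance[OF d M cond0[OF cond] cond \<gamma> xi inv w H mean n _ \<delta> net' argmin[rule_format]]
    let ?P = "sgld_space d K M \<xi>" and ?V = "V_inf d K M U \<gamma> \<pi> c" and ?q = "mU * \<gamma>"
    let ?R2 = "rate_const d K M U LU0 mU0 \<xi>" and ?R = "const_R d K M \<gamma> mU L B \<xi> \<pi>"
    let ?D = "const_D \<pi> H" and ?\<sigma> = "const_varsigma d K M L B \<pi>"
    let ?r = "sqrt (ln (real n) ^ 5 / real n)" and ?E = "(real (card H\<epsilon>) / \<delta>) powr (1 / ln (real n))"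
    have \<epsilon>0: "0 < \<epsilon>" using \<epsilon> by simp
    obtain A where A: "A \<in> sets ?P" "1 - \<delta> \<le> measure ?P A"
      and bound: "\<And>\<omega> h. \<omega> \<in> A \<Longrightarrow> h \<in> H \<Longrightarrow> ?V (hhat \<omega>) - ?V h
        \<le> 100 * (sqrt ?D / ?q * \<epsilon> * ln n + B\<^sup>2 * ?R2 / ?q powr (4 + 2 / ln n) * ?r * ?E + ?\<sigma> / ?q\<^sup>2 * ln n / n)"
      using main(5)[OF _ \<epsilon>0] by blast
    have L: "0 \<le> L" and B: "0 \<le> B" and D: "0 \<le> ?D" and Hne: "H \<noteq> {}"
      using main(1-4)[OF _ \<epsilon>0] by blast+
    have R: "0 \<le> ?R" by (rule const_R_nonneg[OF L B gb(3,2,4)])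
    have q: "0 < ?q" using gb by simp
    have l: "0 \<le> ln (real n)" using n by simp
    let ?C4 = "(sqrt ?R + sqrt ?D) / ?q"
    let ?C5 = "B\<^sup>2 * 0 / ?q\<^sup>2 + B\<^sup>2 * ?R2 / ?q powr (4 + 2 / ln (real n)) + sqrt (?R * ?D) / ?q"
    let ?C6 = "(?D * ?q + ?\<sigma>) / ?q\<^sup>2"
    define S where "S = 100 * (?C4 * \<epsilon> * ln (real n) + ?C5 * ?r * ?E + ?C6 * ln (real n) / real n)"
    \<comment> \<open>Compared term by term, \<open>S\<close> exceeds the proved bound by
      nonnegative contributions in \<open>R\<close> and \<open>D\<close>.\<close>
    have "100 * (sqrt ?D / ?q * \<epsilon> * ln n + B\<^sup>2 * ?R2 / ?q powr (4 + 2 / ln n) * ?r * ?E + ?\<sigma> / ?q\<^sup>2 * ln n / n) \<le> S"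
      unfolding S_def using R D q l \<epsilon>0
      by (intro mult_left_mono add_mono mult_right_mono divide_right_mono) auto
    then have le: "?V (hhat \<omega>) - S \<le> ?V h" if "\<omega> \<in> A" "h \<in> H" for \<omega> h
      using bound[OF that] by linarith
    have excess: "?V (hhat \<omega>) - (INF h\<in>H. ?V h) \<le> S" if \<omega>: "\<omega> \<in> A" for \<omega>
    proof -
      \<comment> \<open>Neither \<open>S\<close> nor the event depends on \<open>h\<close>, so the
        left side is a lower bound for the whole non-empty class.\<close>
      have "?V (hhat \<omega>) - S \<le> (INF h\<in>H. ?V h)"
        using Hne le[OF \<omega>] by (rule cINF_greatest)
      then show ?thesis by linarith
    qed
    show ?case
      unfolding Let_def c_def[symmetric] by (intro bexI[OF _ A(1)] conjI A(2) ballI excess[unfolded S_def])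
  qed
qed

end
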